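(* Let $\xi>0$, $\tau<0$, $\rho=\xi\tau$, and let $X,X_1,X_2,\ldots$ be i.i.d. with distribution function $F\in\mathcal{F}(\xi,\tau)$. Assume that, as $k,n\to\infty$ with $k/n\to0$, one has $k\sigma^2_{k,n}\to\mu>0$ and $\sqrt{k}\,a(n/k)\to\lambda\in\mathbb{R}$. Let $\hat\rho_n\to\rho$ in probability, let $(\hat\xi^{\mathcal B}_k,\hat\delta^{\mathcal B}_k)$ be the first-order Bayesian EPD estimators with prior variance $\sigma^2_{k,n}$ and external estimator $\hat\tau=\hat\rho_n/H_{k,n}$, and put $$\hat p^{\mathcal B}_{x,k}=\frac kn\,\bar G_{\hat\xi^{\mathcal B}_k,\hat\delta^{\mathcal B}_k,\hat\tau}\!\left(\frac{x}{X_{n-k,n}}\right),\qquad \bar G_{\xi,\delta,\tau}(y)=\{y(1+\delta-\delta y^{\tau})\}^{-1/\xi}.$$ Let $x_n$ be such that $p_n=P(X>x_n)$ satisfies $np_n/k\to0$ and $\log(np_n)/\sqrt{k}\to0$. Put $\zeta=\xi^2(1-2\rho)(1-\rho)^2/\mu$. Then $$\frac{\sqrt{k}}{\log(k/(np_n))}\,\xi\left(\frac{\hat p^{\mathcal B}_{x_n,k}}{p_n}-1\right)$$ is asymptotically normal with the same limit distribution as $\sqrt{k}\,(\hat\xi^{\mathcal B}_k-\xi)$, namely the normal distribution with mean $\frac{\lambda\rho}{1-\rho}\,\frac{\zeta}{\zeta+\rho^4}$ and variance $\frac{\xi^2}{(1+\zeta\rho^{-4})^2}\left(\left(\frac{1-\rho}{\rho}\right)^2+\frac{\zeta^2}{\rho^8}+2\frac{\zeta}{\rho^4}\right)$.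 Hence the asymptotic mean squared error behaviour of the tail probability estimator has the same characteristics as that of the tail index estimator $\hat\xi^{\mathcal B}_k$.
   Context: Class $\mathcal{F}(\xi,\tau)$ ($\xi>0$, $\tau<0$): distribution functions $F$ whose right tail function $\bar F=1-F$ satisfies $\bar F(x)=Cx^{-1/\xi}(1+\xi^{-1}\delta(x))$ for some constant $C>0$, where $\delta(x)$ is eventually (for large $x$) nonzero and of constant sign, and $|\delta(x)|=x^{\tau}\ell_\delta(x)$ with $\ell_\delta$ slowly varying at infinity. Function $a$: with $Q(p)=\inf\{x:F(x)\ge p\}$, $a$ is defined by $Q(1-x^{-1})=C^{\xi}x^{\xi}(1+a(x))$, $x>1$. For $F\in\mathcal{F}(\xi,\tau)$, $a$ is eventually nonzero and of constant sign and $|a(x)|=x^{\rho}\ell_a(x)$ with $\rho=\xi\tau$ and $\ell_a$ slowly varying. Statistics: let $X_{1,n}\le\cdots\le X_{n,n}$ be the order statistics of $X_1,\ldots,X_n$, $Y_{j,k}=X_{n-j+1,n}/X_{n-k,n}$ for $j=1,\ldots,k$, $H_{k,n}=\frac1k\sum_{j=1}^k\log Y_{j,k}$ (the Hill estimator), and $E_{k,n}(s)=\frac1k\sum_{j=1}^kY_{j,k}^{s}$ for $s<0$. Estimators: $(\hat\xi^{\mathcal B}_k,\hat\delta^{\mathcal B}_k)$ are given by the following (implicit) system, with $\tau$ replaced everywhere by $\hat\tau=\hat\rho_n/H_{k,n}$: $$\hat\xi^{\mathcal B}_k=H_{k,n}+\hat\delta^{\mathcal B}_k\,(1-E_{k,n}(\tau)),\qquad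 \hat\delta^{\mathcal B}_k=\frac{1-H_{k,n}\tau}{D^{\mathcal B}_{k,n}}\left(E_{k,n}(\tau)-\frac{1}{1-H_{k,n}\tau}\right),$$ $$D^{\mathcal B}_{k,n}=\frac{\hat\xi^{\mathcal B}_k}{k\sigma^2_{k,n}}-\Big(1-2(1-\hat\xi^{\mathcal B}_k\tau)E_{k,n}(\tau)+(1-2\hat\xi^{\mathcal B}_k\tau-\hat\xi^{\mathcal B}_k\tau^2)E_{k,n}(2\tau)-\tau(1-E_{k,n}(\tau))E_{k,n}(\tau)\Big).$$ These are the first-order approximations of the posterior-mode estimators of $(\xi,\delta)$ when the excesses $Y_{j,k}$ are modelled by the extended Pareto distribution (EPD), whose right tail function is $\bar G_{\xi,\delta,\tau}(y)$, $y>1$ (with $\tau<0<\xi$, $\delta>\max(-1,1/\tau)$), with prior density proportional to $e^{-\xi}/\xi$ on $\xi$ and, on $\delta$, a normal prior with mean $0$ and variance $\sigma^2_{k,n}>0$, left-truncated at $\max(-1,1/\tau)$.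
   Formalization: The implicit system for the Bayesian estimators can have two solutions, and the claim fails for the one whose δ stays away from 0; here the estimators are taken to be the solution with smallest |δ|, and are arbitrary where the system has no solution. *)

theory Defs
  imports "HOL-Probability.Probability"
begin

section \<open>Pareto-type tails\<close>

definition slowly_varying :: "(real \<Rightarrow> real) \<Rightarrow> bool" where
  "slowly_varying l \<longleftrightarrow>
     l \<in> borel_measurable borel \<and>
     (\<forall>\<^sub>F x in at_top. 0 < l x) \<and>
     (\<forall>t>0. ((\<lambda>x. l (t * x) / l x) \<longlongrightarrow> 1) at_top)"

text \<open>Membership of \<open>F\<close> in \<open>\<F>(\<xi>,\<tau>)\<close> with the constant \<open>C\<close> made explicit; \<open>C\<close> is determined by
  \<open>F\<close> and \<open>\<xi>\<close>, since \<open>\<tau> < 0\<close> forces \<open>\<delta>\<close> to vanish at infinity. The function \<open>a\<close> below depends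
  on \<open>C\<close>. The tail identity is imposed on the positive half-line, where it merely defines \<open>\<delta>\<close>.\<close>

definition EP_class :: "real \<Rightarrow> real \<Rightarrow> real \<Rightarrow> (real \<Rightarrow> real) \<Rightarrow> bool" where
  "EP_class \<xi> \<tau> C F \<longleftrightarrow>
     C > 0 \<and>
     (\<exists>\<delta> l.
        (\<forall>x>0. 1 - F x = C * x powr (- 1 / \<xi>) * (1 + \<delta> x / \<xi>)) \<and>
        ((\<forall>\<^sub>F x in at_top. \<delta> x > 0) \<or> (\<forall>\<^sub>F x in at_top. \<delta> x < 0)) \<and>
        slowly_varying l \<and>
        (\<forall>\<^sub>F x in at_top. \<bar>\<delta> x\<bar> = x powr \<tau> * l x))"

definition quantile :: "(real \<Rightarrow> real) \<Rightarrow> real \<Rightarrow> real" where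
  "quantile F p = Inf {x. F x \<ge> p}"

text \<open>The function \<open>a\<close> solving \<open>Q(1 - 1/x) = C\<^sup>\<xi> x\<^sup>\<xi> (1 + a(x))\<close> for \<open>x > 1\<close>.\<close>

definition quantile_dev :: "real \<Rightarrow> real \<Rightarrow> (real \<Rightarrow> real) \<Rightarrow> real \<Rightarrow> real" where
  "quantile_dev \<xi> C F x = quantile F (1 - 1 / x) / (C powr \<xi> * x powr \<xi>) - 1"

section \<open>Statistics of a sample\<close>

text \<open>\<open>order_stat xs i\<close> is the \<open>i\<close>-th smallest entry of the sample \<open>xs\<close>, for
  \<open>1 \<le> i \<le> length xs\<close>. The relative excesses are meaningful for \<open>1 \<le> j \<le> k < length xs\<close>.\<close>

definition order_stat :: "real list \<Rightarrow> nat \<Rightarrow> real" where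
  "order_stat xs i = sort xs ! (i - 1)"

definition rel_excess :: "real list \<Rightarrow> nat \<Rightarrow> nat \<Rightarrow> real" where
  "rel_excess xs k j = order_stat xs (length xs - j + 1) / order_stat xs (length xs - k)"

definition hill :: "real list \<Rightarrow> nat \<Rightarrow> real" where
  "hill xs k = (\<Sum>j=1..k. ln (rel_excess xs k j)) / real k"

definition E_stat :: "real list \<Rightarrow> nat \<Rightarrow> real \<Rightarrow> real" where
  "E_stat xs k s = (\<Sum>j=1..k. rel_excess xs k j powr s) / real k"

section \<open>The Bayesian estimators for the extended Pareto distribution\<close>

text \<open>The arguments \<open>s2\<close>, \<open>\<tau>\<close> and \<open>\<xi>\<close> are the prior variance of \<open>\<delta>\<close>, the value (or estimate)
  of the second-order parameter, and the candidate for the tail index estimate.\<close>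

definition D_bayes :: "real list \<Rightarrow> nat \<Rightarrow> real \<Rightarrow> real \<Rightarrow> real \<Rightarrow> real" where
  "D_bayes xs k s2 \<tau> \<xi> =
     \<xi> / (real k * s2)
     - (1 - 2 * (1 - \<xi> * \<tau>) * E_stat xs k \<tau>
          + (1 - 2 * \<xi> * \<tau> - \<xi> * \<tau>\<^sup>2) * E_stat xs k (2 * \<tau>)
          - \<tau> * (1 - E_stat xs k \<tau>) * E_stat xs k \<tau>)"

definition bayes_system :: "real list \<Rightarrow> nat \<Rightarrow> real \<Rightarrow> real \<Rightarrow> real \<Rightarrow> real \<Rightarrow> bool" where
  "bayes_system xs k s2 \<tau> \<xi> \<delta> \<longleftrightarrow>
     D_bayes xs k s2 \<tau> \<xi> \<noteq> 0 \<and>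
     \<xi> = hill xs k + \<delta> * (1 - E_stat xs k \<tau>) \<and>
     \<delta> = (1 - hill xs k * \<tau>) / D_bayes xs k s2 \<tau> \<xi> * (E_stat xs k \<tau> - 1 / (1 - hill xs k * \<tau>))"

text \<open>Eliminating \<open>\<xi>\<close> from the system leaves a quadratic equation for \<open>\<delta>\<close>, with up to two solutions.
  The system is an expansion of the posterior-mode equations around \<open>\<delta> = 0\<close>, so the estimate is the
  solution with \<open>\<delta>\<close> closest to \<open>0\<close>; the other solution is spurious: its \<open>\<delta>\<close> stays away from \<open>0\<close>
  asymptotically, although it may satisfy \<open>\<xi> > 0\<close> and \<open>\<delta> > max (-1) (1 / \<tau>)\<close>.\<close>

definition bayes_estimate :: "real list \<Rightarrow> nat \<Rightarrow> real \<Rightarrow> real \<Rightarrow> real \<Rightarrow> real \<Rightarrow> bool" where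
  "bayes_estimate xs k s2 \<tau> \<xi> \<delta> \<longleftrightarrow>
     bayes_system xs k s2 \<tau> \<xi> \<delta> \<and>
     (\<forall>\<xi>' \<delta>'. bayes_system xs k s2 \<tau> \<xi>' \<delta>' \<longrightarrow> \<bar>\<delta>\<bar> \<le> \<bar>\<delta>'\<bar>)"

definition EPD_tail :: "real \<Rightarrow> real \<Rightarrow> real \<Rightarrow> real \<Rightarrow> real" where
  "EPD_tail \<xi> \<delta> \<tau> y = (y * (1 + \<delta> - \<delta> * y powr \<tau>)) powr (- 1 / \<xi>)"

definition tail_prob_estimate ::
    "real list \<Rightarrow> nat \<Rightarrow> real \<Rightarrow> real \<Rightarrow> real \<Rightarrow> real \<Rightarrow> real" where
  "tail_prob_estimate xs k \<xi> \<delta> \<tau> x =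
     real k / real (length xs) * EPD_tail \<xi> \<delta> \<tau> (x / order_stat xs (length xs - k))"

section \<open>Modes of convergence\<close>

definition conv_in_prob :: "'a measure \<Rightarrow> (nat \<Rightarrow> 'a \<Rightarrow> real) \<Rightarrow> real \<Rightarrow> bool" where
  "conv_in_prob M Z c \<longleftrightarrow>
     (\<forall>\<epsilon>>0. (\<lambda>n. measure M {\<omega> \<in> space M. \<bar>Z n \<omega> - c\<bar> > \<epsilon>}) \<longlonglongrightarrow> 0)"

definition conv_in_distr :: "'a measure \<Rightarrow> (nat \<Rightarrow> 'a \<Rightarrow> real) \<Rightarrow> real measure \<Rightarrow> bool" where
  "conv_in_distr M Z L \<longleftrightarrow> weak_conv_m (\<lambda>n. distr M borel (Z n)) L"

definition normal_law :: "real \<Rightarrow> real \<Rightarrow> real measure" where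
  "normal_law m v = density lborel (normal_density m (sqrt v))"

text \<open>The asymptotic mean squared error of a normalised estimation error is the second moment of its
  limit distribution (squared asymptotic bias plus asymptotic variance).\<close>

definition has_asymptotic_mse :: "'a measure \<Rightarrow> (nat \<Rightarrow> 'a \<Rightarrow> real) \<Rightarrow> real \<Rightarrow> bool" where
  "has_asymptotic_mse M Z m \<longleftrightarrow>
     (\<exists>L. real_distribution L \<and> conv_in_distr M Z L \<and>
          integrable L (\<lambda>z. z\<^sup>2) \<and> m = (LINT z|L. z\<^sup>2))"

end

theory Submission
  imports Defs
begin

text \<open>With the deterministic threshold \<open>t = (C n / k)\<^sup>\<xi>\<close>, all statistics are functions of the counts \<open>N(y)\<close> of
  observations above \<open>t e\<^sup>y\<close>, and \<open>(n/k) P(X > t e\<^sup>y) = e\<^bsup>-y/\<xi>\<^esup> (1 + d(y))\<close> where \<open>\<surd>k d(y)\<close> tends to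
  \<open>(\<lambda>/\<xi>) e\<^bsup>\<tau>y\<^esup>\<close>. Replacing the random threshold \<open>X\<^bsub>n-k,n\<^esub>\<close> by \<open>t\<close> in an excess sum costs
  \<open>k log (X\<^bsub>n-k,n\<^esub> / t)\<close> to first order, and a Bahadur representation expresses this cost through \<open>N(0)\<close>. Hence
  the Hill estimator and \<open>E\<^bsub>k,n\<^esub>\<close> are, up to negligible terms, sums over a triangular array with i.i.d. rows;
  neither the quantile transform nor the Renyi representation is needed, and \<open>F\<close> may have atoms.
  Eliminating \<open>\<xi>\<close> from the estimating system leaves a quadratic equation for \<open>\<delta>\<close> whose small root is of
  order \<open>1/\<surd>k\<close>, so that \<open>\<surd>k (\<xi>\<^sup>B - \<xi>)\<close> is asymptotically linear in those sums. The tail probability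
  satisfies \<open>log (p\<^sup>B / p) = log (k/(np)) (1 - \<xi>/\<xi>\<^sup>B) + O\<^sub>P(1/\<surd>k)\<close>, which inherits the same limit.\<close>

section \<open>Slow and regular variation\<close>

text \<open>Two obstacles shape the argument. First, \<open>F (quantile F u) = u\<close> can fail at
  jumps; the hypothesis on \<open>quantile_dev\<close> yields two tail inequalities only, at the
  quantile and just below it, and a squeeze between them gives
  \<open>sqrt k * \<delta> (t n)\<close> the limit \<open>lam\<close>. Second,
  \<open>rho_hat\<close> is consistent with no rate, so the power mean is taken at a random exponent
  \<open>s\<close>. Its centring \<open>1 / (1 - \<xi> * s)\<close> uses the same \<open>s\<close>,
  and one tight variable, \<open>R\<close>, bounds the errors for all \<open>s \<le> 0\<close> and
  their dependence on \<open>s\<close>. The weights of the final score come from the system: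
  \<open>\<beta>\<close> is minus the limit of \<open>(1 - E) * (1 - H * \<tau>) / D\<close>, and
  \<open>\<alpha> = 1 + \<beta> * \<tau> / (1 - \<rho>)\<^sup>2\<close> because the system centres
  \<open>E\<close> with the Hill estimator \<open>H\<close> in place of \<open>\<xi>\<close>. The
  score has mean zero under the exponential law of mean \<open>\<xi>\<close>, so the asymptotic mean
  comes from the second-order term of the tail alone.\<close>

lemma slow_uniform_additive:
  fixes h :: "real \<Rightarrow> real"
  assumes [measurable]: "h \<in> borel_measurable borel"
    and h: "\<And>s. ((\<lambda>x. h (x + s) - h x) \<longlongrightarrow> 0) at_top" and "\<epsilon> > 0"
  shows "\<exists>x0. \<forall>x\<ge>x0. \<forall>u\<in>{0..1}. \<bar>h (x + u) - h x\<bar> \<le> \<epsilon>"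
proof (rule ccontr)
  assume "\<not> ?thesis"
  then have "\<exists>x u. x \<ge> real n \<and> u \<in> {0..1} \<and> \<bar>h (x + u) - h x\<bar> > \<epsilon>" for n :: nat
    by (meson not_le)
  then obtain X U where X: "X n \<ge> real n" and U: "U n \<in> {0..1}"
    and bad: "\<bar>h (X n + U n) - h (X n)\<bar> > \<epsilon>" for n :: nat
    by metis
  \<comment> \<open>Along any \<open>Z\<close> tending to infinity, the shifts in [0, 2] whose
    increments are small from some index on exhaust [0, 2]: this is pointwise convergence plus
    continuity of the measure from below.\<close>
  have full: "(\<lambda>n. measure lborel {s \<in> {0..2}. \<forall>m\<ge>n. \<bar>h (Z m + s) - h (Z m)\<bar> \<le> \<epsilon> / 2}) \<longlonglongrightarrow> 2"
    if Z: "\<And>n. Z n \<ge> real n" for Z :: "nat \<Rightarrow> real"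
  proof -
    let ?V = "\<lambda>n. {s \<in> {0..2}. \<forall>m\<ge>n. \<bar>h (Z m + s) - h (Z m)\<bar> \<le> \<epsilon> / 2}"
    have lim: "filterlim Z at_top sequentially"
      by (rule filterlim_at_top_mono[OF filterlim_real_sequentially]) (use Z in auto)
    have "s \<in> (\<Union>n. ?V n)" if "s \<in> {0..2}" for s
    proof -
      have "\<forall>\<^sub>F m in sequentially. \<bar>h (Z m + s) - h (Z m)\<bar> < \<epsilon> / 2"
        using tendstoD[OF filterlim_compose[OF h lim], of "\<epsilon> / 2"] \<open>\<epsilon> > 0\<close> by simp
      then obtain n where "\<forall>m\<ge>n. \<bar>h (Z m + s) - h (Z m)\<bar> < \<epsilon> / 2"
        by (auto simp: eventually_sequentially)
      with that show ?thesis by (auto intro!: exI[of _ n] less_imp_le)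
    qed
    then have un: "(\<Union>n. ?V n) = {0..2}" by blast
    have "(\<lambda>n. measure lborel (?V n)) \<longlonglongrightarrow> measure lborel (\<Union>n. ?V n)"
    proof (rule Lim_measure_incseq)
      show "emeasure lborel (\<Union>n. ?V n) \<noteq> \<infinity>" unfolding un by simp
    qed (auto simp: incseq_def)
    then show ?thesis unfolding un by simp
  qed
  \<comment> \<open>\<open>?V\<close> holds the good shifts from \<open>X\<close>, \<open>?W\<close>
    those from \<open>X + U\<close>, and \<open>W\<close> below is \<open>?W n\<close> moved by
    \<open>U n\<close>. Two subsets of [0, 3] of measure above 3/2 must meet, and a common point
    links \<open>h (X n)\<close> to \<open>h (X n + U n)\<close> within
    \<open>\<epsilon>\<close>.\<close>
  let ?V = "\<lambda>n. {s \<in> {0..2}. \<forall>m\<ge>n. \<bar>h (X m + s) - h (X m)\<bar> \<le> \<epsilon> / 2}"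
  let ?W = "\<lambda>n. {s \<in> {0..2}. \<forall>m\<ge>n. \<bar>h ((X m + U m) + s) - h (X m + U m)\<bar> \<le> \<epsilon> / 2}"
  have XU: "X m + U m \<ge> real m" for m using X[of m] U[of m] by auto
  have "\<forall>\<^sub>F n in sequentially. measure lborel (?V n) > 3/2 \<and> measure lborel (?W n) > 3/2"
    by (intro eventually_conj order_tendstoD(1)[OF full[OF X]] order_tendstoD(1)[OF full[OF XU]]) simp_all
  then obtain n where n: "measure lborel (?V n) > 3/2" "measure lborel (?W n) > 3/2"
    by (auto simp: eventually_sequentially)
  define W where "W = (\<lambda>z. - U n + z) -` ?W n"
  have Wm: "?W n \<in> sets borel" "?V n \<in> sets borel" by measurable
  have [measurable]: "W \<in> sets borel" unfolding W_def
    using measurable_sets[of "(+) (- U n)" borel borel, OF _ Wm(1)] by simp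
  have "measure lborel (?W n) = measure (distr lborel borel ((+) (- U n))) (?W n)"
    by (simp add: lborel_distr_plus)
  also have "\<dots> = measure lborel W"
    using Wm by (subst measure_distr) (auto simp: W_def)
  finally have mW: "measure lborel W > 3/2" using n by simp
  have sub: "?V n \<union> W \<subseteq> {0..3}" using U[of n] by (auto simp: W_def)
  have fin: "emeasure lborel A < \<infinity>" if "A \<subseteq> {0..3}" for A :: "real set"
    using emeasure_mono[OF that, of lborel] by (auto simp: less_top[symmetric] top_unique)
  have "?V n \<inter> W \<noteq> {}"
  proof
    assume d: "?V n \<inter> W = {}"
    have "measure lborel (?V n \<union> W) = measure lborel (?V n) + measure lborel W"
      using Wm sub by (intro measure_Union d order.strict_implies_not_eq[OF fin]) auto
    moreover have "measure lborel (?V n \<union> W) \<le> measure lborel {0..3::real}"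
      using sub Wm by (intro measure_mono_fmeasurable) (auto simp: fmeasurable_def)
    ultimately show False using n mW by simp
  qed
  then obtain z where z: "z \<in> ?V n" "z \<in> W" by blast
  then have "\<bar>h (X n + z) - h (X n)\<bar> \<le> \<epsilon> / 2" "\<bar>h (X n + U n + (- U n + z)) - h (X n + U n)\<bar> \<le> \<epsilon> / 2"
    by (auto simp: W_def)
  moreover have "X n + U n + (- U n + z) = X n + z" by simp
  ultimately show False using bad[of n] by (auto simp only: abs_if split: if_splits)
qed

lemma filterlim_at_top_add_const: "filterlim (\<lambda>x. x + s :: real) at_top at_top"
  by (subst add.commute) (rule filterlim_tendsto_add_at_top[OF tendsto_const filterlim_ident])

text \<open>A negative shift is a positive shift back from \<open>x + u\<close>, which costs one
  unit in the starting point.\<close>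

lemma slowly_varying_log_uniform:
  assumes l: "slowly_varying l" and "\<epsilon> > 0"
  shows "\<exists>x0. \<forall>x\<ge>x0. l (exp x) > 0 \<and> (\<forall>u\<in>{-1..1}. \<bar>ln (l (exp (x + u))) - ln (l (exp x))\<bar> \<le> \<epsilon>)"
proof -
  have [measurable]: "l \<in> borel_measurable borel" using l by (simp add: slowly_varying_def)
  have pos: "\<forall>\<^sub>F x in at_top. l (exp x) > 0"
    using l unfolding slowly_varying_def by (auto intro: eventually_compose_filterlim exp_at_top)
  have "((\<lambda>x. ln (l (exp (x + s))) - ln (l (exp x))) \<longlongrightarrow> 0) at_top" for s
  proof -
    have "((\<lambda>x. l (exp s * x) / l x) \<longlongrightarrow> 1) at_top"
      using l by (simp add: slowly_varying_def)
    from tendsto_ln[OF filterlim_compose[OF this exp_at_top]]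
    have "((\<lambda>x. ln (l (exp s * exp x) / l (exp x))) \<longlongrightarrow> 0) at_top" by simp
    moreover have "\<forall>\<^sub>F x in at_top. l (exp (x + s)) > 0"
      by (rule eventually_compose_filterlim[OF pos]) (rule filterlim_at_top_add_const)
    then have "\<forall>\<^sub>F x in at_top. ln (l (exp s * exp x) / l (exp x)) = ln (l (exp (x + s))) - ln (l (exp x))"
      using pos by eventually_elim (simp add: ln_div exp_add mult.commute)
    ultimately show ?thesis by (rule Lim_transform_eventually)
  qed
  from slow_uniform_additive[OF _ this \<open>\<epsilon> > 0\<close>]
  obtain x0 where x0: "\<forall>x\<ge>x0. \<forall>u\<in>{0..1}. \<bar>ln (l (exp (x + u))) - ln (l (exp x))\<bar> \<le> \<epsilon>" by auto
  obtain x1 where x1: "\<forall>x\<ge>x1. l (exp x) > 0" using pos by (auto simp: eventually_at_top_linorder)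
  show ?thesis
  proof (intro exI[of _ "max (x0 + 1) x1"] allI impI conjI ballI)
    fix x assume x: "x \<ge> max (x0 + 1) x1"
    then show "l (exp x) > 0" using x1 by simp
    fix u :: real assume u: "u \<in> {-1..1}"
    show "\<bar>ln (l (exp (x + u))) - ln (l (exp x))\<bar> \<le> \<epsilon>"
    proof (cases "u \<ge> 0")
      case True then show ?thesis using x0 x u by simp
    next
      case False
      then have "\<bar>ln (l (exp ((x + u) + (- u)))) - ln (l (exp (x + u)))\<bar> \<le> \<epsilon>"
        using x u by (intro x0[rule_format]) auto
      then show ?thesis by simp
    qed
  qed
qed

text \<open>Slow variation is defined for a fixed ratio; here the ratio varies with the index. Local
  uniformity of the logarithm is what lets \<open>r n\<close> move while \<open>x n\<close>
  grows.\<close>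

lemma slowly_varying_moving:
  assumes l: "slowly_varying l" and x: "filterlim x at_top G" and r: "(r \<longlongrightarrow> 1) G"
  shows "((\<lambda>n. l (r n * x n) / l (x n)) \<longlongrightarrow> 1) G"
proof -
  have lr: "((\<lambda>n. ln (r n)) \<longlongrightarrow> 0) G" using tendsto_ln[OF r] by simp
  have lx: "filterlim (\<lambda>n. ln (x n)) at_top G" by (rule filterlim_compose[OF ln_at_top x])
  have rpos: "\<forall>\<^sub>F n in G. r n > 1/2" by (rule order_tendstoD(1)[OF r]) simp
  have xpos: "\<forall>\<^sub>F n in G. x n > 0" using x by (simp add: filterlim_at_top_dense)
  have small: "\<forall>\<^sub>F n in G. \<bar>ln (r n)\<bar> < 1" using tendstoD[OF lr, of 1] by simp
  have "((\<lambda>n. ln (l (r n * x n)) - ln (l (x n))) \<longlongrightarrow> 0) G"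
  proof (rule tendstoI)
    fix e :: real assume "e > 0"
    from slowly_varying_log_uniform[OF l, of "e/2"] \<open>e > 0\<close> obtain x0 where
      x0: "\<forall>x\<ge>x0. \<forall>u\<in>{-1..1}. \<bar>ln (l (exp (x + u))) - ln (l (exp x))\<bar> \<le> e/2" by auto
    have "\<forall>\<^sub>F n in G. ln (x n) \<ge> x0" using lx by (simp add: filterlim_at_top)
    then show "\<forall>\<^sub>F n in G. dist (ln (l (r n * x n)) - ln (l (x n))) 0 < e"
      using rpos xpos small
    proof eventually_elim
      case (elim n)
      then have "\<bar>ln (l (exp (ln (x n) + ln (r n)))) - ln (l (exp (ln (x n))))\<bar> \<le> e/2"
        by (intro x0[rule_format]) auto
      with elim \<open>e > 0\<close> show ?case by (simp add: exp_add mult.commute)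
    qed
  qed
  from tendsto_exp[OF this] have "((\<lambda>n. exp (ln (l (r n * x n)) - ln (l (x n)))) \<longlongrightarrow> 1) G" by simp
  moreover have pos: "\<forall>\<^sub>F x in at_top. l x > 0" using l by (simp add: slowly_varying_def)
  have "filterlim (\<lambda>n. r n * x n) at_top G"
    by (rule filterlim_tendsto_pos_mult_at_top[OF r _ x]) simp
  from eventually_compose_filterlim[OF pos this] eventually_compose_filterlim[OF pos x]
  have "\<forall>\<^sub>F n in G. exp (ln (l (r n * x n)) - ln (l (x n))) = l (r n * x n) / l (x n)"
    by eventually_elim (simp add: exp_diff)
  ultimately show ?thesis by (rule Lim_transform_eventually)
qed

text \<open>One-sided Potter bound: the logarithm gains at most \<open>\<epsilon>\<close> per unit
  step, hence at most \<open>\<epsilon> * (u + 1)\<close> over a distance \<open>u\<close>; the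
  incomplete last step is the origin of the factor \<open>exp \<epsilon>\<close>.\<close>

lemma slowly_varying_Potter:
  assumes l: "slowly_varying l" and "\<epsilon> > 0"
  shows "\<exists>x0>0. \<forall>x\<ge>x0. \<forall>v\<ge>1. 0 < l (x * v) \<and> l (x * v) \<le> exp \<epsilon> * v powr \<epsilon> * l x"
proof -
  from slowly_varying_log_uniform[OF assms] obtain x0 where
    x0: "\<And>x. x\<ge>x0 \<Longrightarrow> l (exp x) > 0"
       "\<And>x u. x\<ge>x0 \<Longrightarrow> u\<in>{-1..1} \<Longrightarrow> \<bar>ln (l (exp (x + u))) - ln (l (exp x))\<bar> \<le> \<epsilon>" by blast
  have step: "ln (l (exp (x + real n))) - ln (l (exp x)) \<le> \<epsilon> * real n" if "x \<ge> x0" for x n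
  proof (induction n)
    case (Suc n)
    have "\<bar>ln (l (exp ((x + real n) + 1))) - ln (l (exp (x + real n)))\<bar> \<le> \<epsilon>"
      using that by (intro x0) auto
    with Suc show ?case by (simp add: algebra_simps)
  qed simp
  have main: "ln (l (exp (x + u))) - ln (l (exp x)) \<le> \<epsilon> * (u + 1)" if "x \<ge> x0" "u \<ge> 0" for x u
  proof -
    define n where "n = nat \<lfloor>u\<rfloor>"
    have n: "real n \<le> u" "u \<le> real n + 1" using that by (auto simp: n_def) 
    have "\<bar>ln (l (exp ((x + real n) + (u - real n)))) - ln (l (exp (x + real n)))\<bar> \<le> \<epsilon>"
      using that n by (intro x0) auto
    moreover have "\<epsilon> * real n \<le> \<epsilon> * u" using n \<open>\<epsilon> > 0\<close> by simp
    ultimately show ?thesis using step[OF that(1), of n] by (simp add: algebra_simps)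
  qed
  show ?thesis
  proof (intro exI[of _ "exp x0"] conjI allI impI)
    fix x v assume xv: "x \<ge> exp x0" "v \<ge> (1::real)"
    then have xp: "x > 0" using exp_gt_zero[of x0] by linarith
    have lx: "ln x \<ge> x0" using xv xp by (simp add: ln_ge_iff)
    have e: "x * v = exp (ln x + ln v)" using xp xv by (simp add: exp_add)
    show p: "0 < l (x * v)" unfolding e using lx xv by (intro x0) (simp add: add_increasing2)
    have px: "0 < l x" using x0(1)[OF lx] xp by simp
    have "ln (l (exp (ln x + ln v))) - ln (l (exp (ln x))) \<le> \<epsilon> * (ln v + 1)"
      using lx xv by (intro main) auto
    then have "ln (l (x * v)) \<le> \<epsilon> + \<epsilon> * ln v + ln (l x)"
      unfolding e[symmetric] using xp by (simp add: algebra_simps)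
    then have "l (x * v) \<le> exp (\<epsilon> + \<epsilon> * ln v + ln (l x))" using p by (metis exp_le_cancel_iff exp_ln)
    also have "\<dots> = exp \<epsilon> * v powr \<epsilon> * l x" using px xv by (simp add: exp_add powr_def)
    finally show "l (x * v) \<le> exp \<epsilon> * v powr \<epsilon> * l x" .
  qed simp
qed

text \<open>The Caratheodory form of the derivative gives an exact factor \<open>g\<close>,
  continuous at 0, so that no remainder term has to be estimated.\<close>

lemma delta_method:
  fixes f s a :: "_ \<Rightarrow> real"
  assumes f: "(f has_real_derivative D) (at 0)" and a: "(a \<longlongrightarrow> 0) G" and sa: "((\<lambda>n. s n * a n) \<longlongrightarrow> L) G"
  shows "((\<lambda>n. s n * (f (a n) - f 0)) \<longlongrightarrow> D * L) G"
proof -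
  from f obtain g where g: "\<And>z. f z - f 0 = g z * (z - 0)" "isCont g 0" "g 0 = D"
    unfolding CARAT_DERIV by blast
  have "((\<lambda>n. g (a n) * (s n * a n)) \<longlongrightarrow> g 0 * L) G"
    by (intro tendsto_mult sa isCont_tendsto_compose[OF g(2) a])
  then show ?thesis by (simp add: g mult_ac)
qed

lemma powr_at_top:
  assumes "(p::real) > 0"
  shows "filterlim (\<lambda>x. x powr p) at_top at_top"
proof -
  have "filterlim (\<lambda>x. exp (p * ln x)) at_top at_top"
    by (intro filterlim_compose[OF exp_at_top] filterlim_tendsto_pos_mult_at_top[OF tendsto_const assms] ln_at_top)
  moreover have "\<forall>\<^sub>F x in at_top. exp (p * ln x) = x powr p"
    using eventually_gt_at_top[of "0::real"] by eventually_elim (simp add: powr_def)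
  ultimately show ?thesis by (rule iffD1[OF filterlim_cong[OF refl refl], rotated])
qed

section \<open>Second-order Pareto tails and the deterministic threshold\<close>

locale ep_tail =
  fixes \<xi> \<tau> C :: real and F \<delta> l :: "real \<Rightarrow> real"
  assumes xi_pos: "\<xi> > 0" and tau_neg: "\<tau> < 0" and C_pos: "C > 0"
    and tail: "\<And>x. x > 0 \<Longrightarrow> 1 - F x = C * x powr (- 1 / \<xi>) * (1 + \<delta> x / \<xi>)"
    and delta_sign: "(\<forall>\<^sub>F x in at_top. \<delta> x > 0) \<or> (\<forall>\<^sub>F x in at_top. \<delta> x < 0)"
    and slow: "slowly_varying l"
    and delta_abs: "\<forall>\<^sub>F x in at_top. \<bar>\<delta> x\<bar> = x powr \<tau> * l x"
begin

text \<open>The eventual sign of \<open>\<delta>\<close> becomes a constant factor \<open>s\<close>,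
  which cancels in every ratio of values of \<open>\<delta>\<close>.\<close>

lemma delta_signed:
  obtains s :: real where "s \<noteq> 0" "\<forall>\<^sub>F x in at_top. x > 0 \<and> l x > 0 \<and> \<delta> x = s * (x powr \<tau> * l x)"
proof -
  have p: "\<forall>\<^sub>F x in at_top. l x > 0" using slow by (simp add: slowly_varying_def)
  show thesis
    using delta_sign
  proof
    assume "\<forall>\<^sub>F x in at_top. \<delta> x > 0"
    then have "\<forall>\<^sub>F x in at_top. x > 0 \<and> l x > 0 \<and> \<delta> x = 1 * (x powr \<tau> * l x)"
      using p delta_abs eventually_gt_at_top[of 0] by eventually_elim simp
    then show thesis by (rule that[of 1, rotated]) simp
  next
    assume "\<forall>\<^sub>F x in at_top. \<delta> x < 0"
    then have "\<forall>\<^sub>F x in at_top. x > 0 \<and> l x > 0 \<and> \<delta> x = (-1) * (x powr \<tau> * l x)"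
      using p delta_abs eventually_gt_at_top[of 0] by eventually_elim simp
    then show thesis by (rule that[of "-1", rotated]) simp
  qed
qed

lemma delta_nonzero: "\<forall>\<^sub>F x in at_top. \<delta> x \<noteq> 0"
  using delta_sign by (auto elim: eventually_mono)

lemma delta_regular:
  assumes x: "filterlim x at_top G" and "v > 0"
  shows "((\<lambda>n. \<delta> (x n * v) / \<delta> (x n)) \<longlongrightarrow> v powr \<tau>) G"
proof -
  obtain s where s: "s \<noteq> 0" "\<forall>\<^sub>F x in at_top. x > 0 \<and> l x > 0 \<and> \<delta> x = s * (x powr \<tau> * l x)"
    by (rule delta_signed)
  have "((\<lambda>x. l (v * x) / l x) \<longlongrightarrow> 1) at_top" using slow \<open>v > 0\<close> by (simp add: slowly_varying_def)
  from tendsto_mult[OF tendsto_const[of "v powr \<tau>"] filterlim_compose[OF this x]]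
  have "((\<lambda>n. v powr \<tau> * (l (v * x n) / l (x n))) \<longlongrightarrow> v powr \<tau>) G"
    by simp
  moreover have xv: "filterlim (\<lambda>n. x n * v) at_top G"
    using filterlim_tendsto_pos_mult_at_top[OF tendsto_const \<open>v > 0\<close> x] by (simp add: mult.commute)
  have "\<forall>\<^sub>F n in G. v powr \<tau> * (l (v * x n) / l (x n)) = \<delta> (x n * v) / \<delta> (x n)"
    using eventually_compose_filterlim[OF s(2) x] eventually_compose_filterlim[OF s(2) xv]
    by eventually_elim (use s(1) \<open>v > 0\<close> in \<open>auto simp: powr_mult mult_ac\<close>)
  ultimately show ?thesis by (rule Lim_transform_eventually)
qed

lemma delta_moving:
  assumes x: "filterlim x at_top G" and r: "(r \<longlongrightarrow> 1) G"
  shows "((\<lambda>n. \<delta> (x n * r n) / \<delta> (x n)) \<longlongrightarrow> 1) G"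
proof -
  obtain s where s: "s \<noteq> 0" "\<forall>\<^sub>F x in at_top. x > 0 \<and> l x > 0 \<and> \<delta> x = s * (x powr \<tau> * l x)"
    by (rule delta_signed)
  have "((\<lambda>n. r n powr \<tau> * (l (r n * x n) / l (x n))) \<longlongrightarrow> 1 powr \<tau> * 1) G"
    by (intro tendsto_mult slowly_varying_moving[OF slow x r] tendsto_powr r tendsto_const) auto
  moreover have xr: "filterlim (\<lambda>n. x n * r n) at_top G"
    using filterlim_tendsto_pos_mult_at_top[OF r _ x] by (simp add: mult.commute)
  have "\<forall>\<^sub>F n in G. r n > 0" by (rule order_tendstoD(1)[OF r]) simp
  with eventually_compose_filterlim[OF s(2) x] eventually_compose_filterlim[OF s(2) xr]
  have "\<forall>\<^sub>F n in G. r n powr \<tau> * (l (r n * x n) / l (x n)) = \<delta> (x n * r n) / \<delta> (x n)"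
    by eventually_elim (use s(1) in \<open>auto simp: powr_mult mult_ac\<close>)
  ultimately show ?thesis by (auto intro: Lim_transform_eventually)
qed

text \<open>Potter's bound with \<open>\<epsilon> = - \<tau> / 2\<close>: half of the decay
  \<open>v powr \<tau>\<close> pays for the slowly varying factor, the other half remains. It
  controls \<open>\<delta>\<close> on a whole ray above a threshold at once.\<close>

lemma delta_Potter:
  "\<exists>K>0. \<exists>x0>0. \<forall>x\<ge>x0. \<forall>v\<ge>1. \<bar>\<delta> (x * v)\<bar> \<le> K * v powr (\<tau> / 2) * \<bar>\<delta> x\<bar>"
proof -
  from slowly_varying_Potter[OF slow, of "- \<tau> / 2"] tau_neg obtain x0 where x0: "x0 > 0"
    "\<And>x v. x \<ge> x0 \<Longrightarrow> v \<ge> 1 \<Longrightarrow> 0 < l (x * v) \<and> l (x * v) \<le> exp (- \<tau> / 2) * v powr (- \<tau> / 2) * l x" by auto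
  obtain x1 where x1: "\<And>x. x \<ge> x1 \<Longrightarrow> \<bar>\<delta> x\<bar> = x powr \<tau> * l x"
    using delta_abs by (auto simp: eventually_at_top_linorder)
  have "\<bar>\<delta> (x * v)\<bar> \<le> exp (- \<tau> / 2) * v powr (\<tau> / 2) * \<bar>\<delta> x\<bar>" if xv: "x \<ge> max x0 x1" "v \<ge> 1" for x v
  proof -
    have "x > 0" using x0 xv by simp
    with xv have "x * v \<ge> x" by simp
    then have "\<bar>\<delta> (x * v)\<bar> = (x * v) powr \<tau> * l (x * v)" using xv by (intro x1) simp
    also have "\<dots> \<le> (x * v) powr \<tau> * (exp (- \<tau> / 2) * v powr (- \<tau> / 2) * l x)"
      using x0(2)[of x v] xv by (intro mult_left_mono) auto
    also have "\<dots> = exp (- \<tau> / 2) * (v powr \<tau> * v powr (- \<tau> / 2)) * (x powr \<tau> * l x)"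
      using xv \<open>x > 0\<close> by (simp add: powr_mult mult_ac)
    also have "v powr \<tau> * v powr (- \<tau> / 2) = v powr (\<tau> / 2)" by (simp flip: powr_add)
    also have "x powr \<tau> * l x = \<bar>\<delta> x\<bar>" using x1 xv by simp
    finally show ?thesis .
  qed
  then have "exp (- \<tau> / 2) > 0 \<and> max x0 x1 > 0 \<and> (\<forall>x\<ge>max x0 x1. \<forall>v\<ge>1. \<bar>\<delta> (x * v)\<bar> \<le> exp (- \<tau> / 2) * v powr (\<tau> / 2) * \<bar>\<delta> x\<bar>)"
    using x0(1) by (simp only: less_max_iff_disj exp_gt_zero simp_thms) blast
  then show ?thesis by blast
qed

lemma delta_vanishes: "(\<delta> \<longlongrightarrow> 0) at_top"
proof -
  obtain K x0 where K: "K > 0" "x0 > 0"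
    "\<And>x v. x \<ge> x0 \<Longrightarrow> v \<ge> 1 \<Longrightarrow> \<bar>\<delta> (x * v)\<bar> \<le> K * v powr (\<tau> / 2) * \<bar>\<delta> x\<bar>"
    using delta_Potter by blast
  have "((\<lambda>v. v powr (\<tau> / 2)) \<longlongrightarrow> 0) at_top"
    by (rule tendsto_neg_powr[OF _ filterlim_ident]) (use tau_neg in simp)
  from filterlim_compose[OF this filterlim_tendsto_pos_mult_at_top[OF tendsto_const _ filterlim_ident, of "1/x0"]]
  have "((\<lambda>x. K * (1 / x0 * x) powr (\<tau> / 2) * \<bar>\<delta> x0\<bar>) \<longlongrightarrow> K * 0 * \<bar>\<delta> x0\<bar>) at_top"
    using K by (intro tendsto_mult tendsto_const) auto
  then have "((\<lambda>x. K * (1 / x0 * x) powr (\<tau> / 2) * \<bar>\<delta> x0\<bar>) \<longlongrightarrow> 0) at_top" by simp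
  moreover have "\<forall>\<^sub>F x in at_top. norm (\<delta> x) \<le> K * (1 / x0 * x) powr (\<tau> / 2) * \<bar>\<delta> x0\<bar>"
    using eventually_ge_at_top[of x0]
  proof eventually_elim
    case (elim x)
    then show ?case using K(3)[of x0 "1 / x0 * x"] K by (simp add: field_simps)
  qed
  ultimately show ?thesis by (rule Lim_null_comparison[rotated])
qed

text \<open>First-order approximation of the quantile at level \<open>1 - k n / n\<close>; with this
  scaling the leading factor of \<open>n / k * (1 - F)\<close> at \<open>threshold k n * r\<close>
  is exactly \<open>r powr (- 1 / \<xi>)\<close>.\<close>

definition threshold :: "(nat \<Rightarrow> nat) \<Rightarrow> nat \<Rightarrow> real" where
  "threshold k n = (C * (real n / real (k n))) powr \<xi>"

lemma scaled_tail:
  assumes "k n > 0" "n > 0" "r > 0"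
  shows "real n / real (k n) * (1 - F (threshold k n * r)) = r powr (- 1 / \<xi>) * (1 + \<delta> (threshold k n * r) / \<xi>)"
proof -
  define z where "z = C * (real n / real (k n))"
  have p: "z > 0" using C_pos assms by (simp add: z_def)
  then have "threshold k n powr (- 1 / \<xi>) = z powr - 1"
    using xi_pos by (simp only: threshold_def powr_powr flip: z_def) simp
  also have "\<dots> = real (k n) / (C * real n)" using p C_pos by (simp add: powr_minus_divide) (simp add: z_def)
  finally have t: "threshold k n powr (- 1 / \<xi>) = real (k n) / (C * real n)" .
  have "threshold k n > 0" using p by (simp only: threshold_def flip: z_def) simp
  then have "1 - F (threshold k n * r) = C * (threshold k n powr (- 1 / \<xi>) * r powr (- 1 / \<xi>)) * (1 + \<delta> (threshold k n * r) / \<xi>)"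
    using assms by (subst tail) (auto simp: powr_mult)
  then show ?thesis unfolding t using assms C_pos by simp
qed

lemma threshold_at_top:
  assumes k: "filterlim k at_top sequentially" and kn: "(\<lambda>n. real (k n) / real n) \<longlonglongrightarrow> 0"
  shows "filterlim (threshold k) at_top sequentially"
proof -
  have ev: "\<forall>\<^sub>F n in sequentially. k n > 0" by (rule eventually_compose_filterlim[OF eventually_gt_at_top k])
  have "\<forall>\<^sub>F n in sequentially. real (k n) / real n > 0"
    using ev eventually_gt_at_top[of 0] by eventually_elim simp
  from filterlim_inverse_at_top[OF kn this]
  have "filterlim (\<lambda>n. C * (real n / real (k n))) at_top sequentially"
    using C_pos by (intro filterlim_tendsto_pos_mult_at_top[OF tendsto_const]) (auto simp: inverse_eq_divide)
  then show ?thesis unfolding threshold_def [abs_def]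
    by (rule filterlim_compose[rotated]) (rule powr_at_top[OF xi_pos])
qed

end

text \<open>Right continuity attains the infimum, and every point to its left fails the inequality.
  In the presence of atoms this pair takes the place of the identity
  \<open>F (Q p) = p\<close>.\<close>

lemma (in real_distribution) quantile_cdf:
  assumes "0 < p" "p < 1"
  shows "p \<le> cdf M (quantile (cdf M) p)" and "y < quantile (cdf M) p \<Longrightarrow> cdf M y < p"
proof -
  let ?S = "{x. cdf M x \<ge> p}"
  have "\<forall>\<^sub>F x in at_top. cdf M x > p" by (rule order_tendstoD(1)[OF cdf_lim_at_top_prob assms(2)])
  then have "\<exists>x. cdf M x > p" by (auto simp: eventually_at_top_linorder)
  then have ne: "?S \<noteq> {}" by (auto intro: less_imp_le)
  have "\<forall>\<^sub>F x in at_bot. cdf M x < p" by (rule order_tendstoD(2)[OF cdf_lim_at_bot assms(1)])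
  then obtain b where b: "\<And>x. x \<le> b \<Longrightarrow> cdf M x < p" by (auto simp: eventually_at_bot_linorder)
  then have bdd: "bdd_below ?S" 
    by (intro bdd_belowI[of _ b]) (use b in \<open>auto simp: not_less[symmetric] intro!: leI\<close>)
  show "cdf M y < p" if "y < quantile (cdf M) p"
  proof (rule ccontr)
    assume "\<not> cdf M y < p"
    then have "Inf ?S \<le> y" using bdd by (intro cInf_lower) auto
    with that show False by (simp add: quantile_def)
  qed
  have "cdf M x \<ge> p" if Sx: "x > Inf ?S" for x
  proof -
    obtain z where "z \<in> ?S" "z < x" using cInf_lessD[OF ne Sx] by blast
    then show ?thesis using cdf_nondecreasing[of z x] by simp
  qed
  then have "\<forall>\<^sub>F x in at_right (Inf ?S). p \<le> cdf M x"
    by (auto simp: eventually_at_right_field intro: exI[of _ "Inf ?S + 1"])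
  moreover have "(cdf M \<longlongrightarrow> cdf M (Inf ?S)) (at_right (Inf ?S))"
    using cdf_is_right_cont[of "Inf ?S"] by (simp add: continuous_within)
  ultimately show "p \<le> cdf M (quantile (cdf M) p)"
    unfolding quantile_def by (intro tendsto_lowerbound) auto
qed

lemma sqrt_nat_at_top:
  assumes "filterlim k at_top sequentially"
  shows "filterlim (\<lambda>n. sqrt (real (k n))) at_top sequentially"
  by (intro filterlim_compose[OF sqrt_at_top] filterlim_compose[OF filterlim_real_sequentially] assms)

lemma tendsto_0_of_scaled:
  fixes a s :: "_ \<Rightarrow> real"
  assumes "((\<lambda>n. s n * a n) \<longlongrightarrow> L) G" "filterlim s at_top G"
  shows "(a \<longlongrightarrow> 0) G"
proof -
  have "((\<lambda>n. (s n * a n) / s n) \<longlongrightarrow> 0) G"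
    by (rule tendsto_divide_0[OF assms(1) filterlim_at_top_imp_at_infinity[OF assms(2)]])
  moreover have "\<forall>\<^sub>F n in G. (s n * a n) / s n = a n"
    using assms(2)[unfolded filterlim_at_top_dense, rule_format, of 0] by eventually_elim simp
  ultimately show ?thesis by (rule Lim_transform_eventually)
qed

text \<open>The tail is at most \<open>k / n\<close> at the quantile \<open>t * (1 + a)\<close> and
  larger than \<open>k / n\<close> at any smaller point. Solving both inequalities for
  \<open>\<delta>\<close> bounds it near \<open>t\<close> from both sides, and
  \<open>delta_moving\<close> carries the bounds to \<open>t\<close> itself.\<close>

lemma (in ep_tail) delta_threshold:
  assumes N: "real_distribution N" "F = cdf N"
    and k: "filterlim k at_top sequentially" and kn: "(\<lambda>n. real (k n) / real n) \<longlonglongrightarrow> 0"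
    and lam: "(\<lambda>n. sqrt (real (k n)) * quantile_dev \<xi> C F (real n / real (k n))) \<longlonglongrightarrow> lam"
  shows "(\<lambda>n. sqrt (real (k n)) * \<delta> (threshold k n)) \<longlonglongrightarrow> lam"
proof -
  define a where "a n = quantile_dev \<xi> C F (real n / real (k n))" for n
  \<comment> \<open>\<open>1 + b n = (1 + a n) * (1 - 1 / k n)\<close> marks a point strictly below
    the quantile; the relative shift \<open>1 / k\<close> is negligible against
    \<open>1 / sqrt k\<close>.\<close>
  define b where "b n = a n - 1 / real (k n) - a n / real (k n)" for n
  define t where "t = threshold k"
  have sk: "filterlim (\<lambda>n. sqrt (real (k n))) at_top sequentially" by (rule sqrt_nat_at_top[OF k])
  have kpos: "\<forall>\<^sub>F n in sequentially. k n > 1" by (rule eventually_compose_filterlim[OF eventually_gt_at_top k])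
  have "\<forall>\<^sub>F n in sequentially. real (k n) / real n < 1" by (rule order_tendstoD(2)[OF kn]) simp
  then have klt: "\<forall>\<^sub>F n in sequentially. k n < n" using eventually_gt_at_top[of 0]
    by eventually_elim (simp add: field_simps)
  have sa: "(\<lambda>n. sqrt (real (k n)) * a n) \<longlonglongrightarrow> lam" using lam by (simp add: a_def)
  have a0: "a \<longlonglongrightarrow> 0" by (rule tendsto_0_of_scaled[OF sa sk])
  have i0: "(\<lambda>n. 1 / sqrt (real (k n))) \<longlonglongrightarrow> 0"
    by (rule tendsto_divide_0[OF tendsto_const filterlim_at_top_imp_at_infinity[OF sk]])
  have "(\<lambda>n. sqrt (real (k n)) * a n - (1 + a n) * (1 / sqrt (real (k n)))) \<longlonglongrightarrow> lam - (1 + 0) * 0"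
    by (intro tendsto_intros sa a0 i0)
  moreover have "\<forall>\<^sub>F n in sequentially. sqrt (real (k n)) * a n - (1 + a n) * (1 / sqrt (real (k n))) = sqrt (real (k n)) * b n"
    using kpos by eventually_elim (simp add: b_def field_simps flip: power2_eq_square)
  ultimately have sb: "(\<lambda>n. sqrt (real (k n)) * b n) \<longlonglongrightarrow> lam"
    by (auto intro: Lim_transform_eventually)
  have b0: "b \<longlonglongrightarrow> 0" by (rule tendsto_0_of_scaled[OF sb sk])
  have t: "filterlim t at_top sequentially" unfolding t_def by (rule threshold_at_top[OF k kn])
  \<comment> \<open>The factor \<open>\<xi>\<close> normalises the derivative at 0 to 1, so that
    \<open>lam\<close> is passed on unchanged.\<close>
  have der: "((\<lambda>x. \<xi> * (1 + x) powr (1 / \<xi>)) has_real_derivative 1) (at 0)"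
    using xi_pos by (auto intro!: derivative_eq_intros)
  have up: "(\<lambda>n. sqrt (real (k n)) * (\<xi> * ((1 + c n) powr (1 / \<xi>) - 1))) \<longlonglongrightarrow> lam"
    if "c \<longlonglongrightarrow> 0" "(\<lambda>n. sqrt (real (k n)) * c n) \<longlonglongrightarrow> lam" for c
    using delta_method[OF der that] by (simp add: algebra_simps)
  have q: "(\<lambda>n. \<delta> (t n * (1 + c n)) / \<delta> (t n)) \<longlonglongrightarrow> 1" if "c \<longlonglongrightarrow> 0" for c
    by (rule delta_moving[OF t]) (use tendsto_add[OF tendsto_const that, of 1] in simp)
  have lim: "(\<lambda>n. sqrt (real (k n)) * (\<xi> * ((1 + c n) powr (1 / \<xi>) - 1)) / (\<delta> (t n * (1 + c n)) / \<delta> (t n))) \<longlonglongrightarrow> lam"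
    if "c \<longlonglongrightarrow> 0" "(\<lambda>n. sqrt (real (k n)) * c n) \<longlonglongrightarrow> lam" for c
    using tendsto_divide[OF up[OF that] q[OF that(1)]] by simp
  have ev: "\<forall>\<^sub>F n in sequentially. 1 + c n > 0 \<and> \<delta> (t n * (1 + c n)) / \<delta> (t n) > 0" if "c \<longlonglongrightarrow> 0" for c
    using order_tendstoD(1)[OF that, of "-1"] order_tendstoD(1)[OF q[OF that], of 0] by (auto elim: eventually_elim2)
  have tz: "\<forall>\<^sub>F n in sequentially. \<delta> (t n) \<noteq> 0" by (rule eventually_compose_filterlim[OF delta_nonzero t])
  have quant: "quantile F (1 - real (k n) / real n) = t n * (1 + a n)" if "0 < k n" "k n < n" for n
    using that C_pos by (simp add: a_def quantile_dev_def t_def threshold_def powr_mult[symmetric])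
  \<comment> \<open>Applied with \<open>c = \<delta> (t * r)\<close>: comparing the scaled tail at
    \<open>t * r\<close> with 1 is the same as comparing \<open>\<delta>\<close> with a smooth
    function of \<open>r\<close>.\<close>
  have pow: "c \<le> \<xi> * (r powr (1/\<xi>) - 1) \<longleftrightarrow> r powr (-1/\<xi>) * (1 + c/\<xi>) \<le> 1" if "r > 0" for r c :: real
    using that xi_pos by (simp add: powr_minus_divide field_simps)
  show ?thesis
  proof (rule tendsto_sandwich[OF _ _ lim[OF b0 sb] lim[OF a0 sa]])
    show "\<forall>\<^sub>F n in sequentially. sqrt (real (k n)) * \<delta> (threshold k n) \<le>
      sqrt (real (k n)) * (\<xi> * ((1 + a n) powr (1 / \<xi>) - 1)) / (\<delta> (t n * (1 + a n)) / \<delta> (t n))"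
      using ev[OF a0] tz kpos klt
    proof eventually_elim
      case (elim n)
      have st: "real n / real (k n) * (1 - F (t n * (1 + a n))) = (1 + a n) powr (- 1 / \<xi>) * (1 + \<delta> (t n * (1 + a n)) / \<xi>)"
        using elim unfolding t_def by (intro scaled_tail) auto
      have "1 - real (k n) / real n \<le> F (t n * (1 + a n))"
        using real_distribution.quantile_cdf(1)[OF N(1), of "1 - real (k n) / real n"] quant[of n] elim
        by (simp add: N(2))
      then have "real n / real (k n) * (1 - F (t n * (1 + a n))) \<le> 1" using elim by (simp add: field_simps)
      then have "\<delta> (t n * (1 + a n)) \<le> \<xi> * ((1 + a n) powr (1/\<xi>) - 1)"
        using pow[of "1 + a n"] elim unfolding st by auto
      then have "sqrt (real (k n)) * \<delta> (t n) * (\<delta> (t n * (1 + a n)) / \<delta> (t n)) \<le> sqrt (real (k n)) * (\<xi> * ((1 + a n) powr (1/\<xi>) - 1))"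
        using elim by (auto intro: mult_left_mono)
      with elim show ?case by (subst pos_le_divide_eq) (auto simp: t_def)
    qed
    show "\<forall>\<^sub>F n in sequentially. sqrt (real (k n)) * (\<xi> * ((1 + b n) powr (1 / \<xi>) - 1)) / (\<delta> (t n * (1 + b n)) / \<delta> (t n)) \<le> sqrt (real (k n)) * \<delta> (threshold k n)"
      using ev[OF b0] ev[OF a0] tz kpos klt
    proof eventually_elim
      case (elim n)
      have st: "real n / real (k n) * (1 - F (t n * (1 + b n))) = (1 + b n) powr (- 1 / \<xi>) * (1 + \<delta> (t n * (1 + b n)) / \<xi>)"
        using elim unfolding t_def by (intro scaled_tail) auto
      have tp: "t n > 0" using elim C_pos by (simp add: t_def threshold_def)
      have "1 + b n = (1 + a n) * (1 - 1 / real (k n))" using elim by (simp add: b_def field_simps)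
      also have "\<dots> < 1 + a n" using elim by (simp add: field_simps)
      finally have "t n * (1 + b n) < quantile F (1 - real (k n) / real n)" using quant[of n] elim tp by simp
      then have "F (t n * (1 + b n)) < 1 - real (k n) / real n"
        using real_distribution.quantile_cdf(2)[OF N(1), of "1 - real (k n) / real n"] elim
        by (simp add: N(2))
      then have "real n / real (k n) * (1 - F (t n * (1 + b n))) > 1" using elim by (simp add: field_simps)
      then have "\<not> \<delta> (t n * (1 + b n)) \<le> \<xi> * ((1 + b n) powr (1/\<xi>) - 1)"
        using pow[of "1 + b n"] elim unfolding st by auto
      then have "sqrt (real (k n)) * (\<xi> * ((1 + b n) powr (1/\<xi>) - 1)) \<le> sqrt (real (k n)) * \<delta> (t n) * (\<delta> (t n * (1 + b n)) / \<delta> (t n))"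
        using elim by (auto intro: mult_left_mono)
      with elim show ?case by (subst pos_divide_le_eq) (auto simp: t_def)
    qed
  qed
qed

section \<open>Convergence in probability as a filter limit\<close>

text \<open>An event holds eventually along \<open>prob_filter M\<close> if its outer probability at index \<open>n\<close> tends
  to one. Limits along this filter are limits in probability, so that the whole limit calculus
  of the library applies to stochastic orders, and no measurability has to be discussed in it.\<close>

definition prob_filter :: "'a measure \<Rightarrow> (nat \<times> 'a) filter" where
  "prob_filter M = Abs_filter (\<lambda>\<Phi>. \<forall>e>0. \<forall>\<^sub>F n in sequentially.
     \<exists>A\<in>sets M. measure M A \<le> e \<and> (\<forall>\<omega>\<in>space M - A. \<Phi> (n, \<omega>)))"

text \<open>Boundedness in probability, phrased so that one may assume \<open>\<bar>W\<bar> \<le> K\<close> for a fixed but arbitrary \<open>K\<close>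
  when proving that an event holds eventually.\<close>

definition tight :: "'a measure \<Rightarrow> (nat \<times> 'a \<Rightarrow> real) \<Rightarrow> bool" where
  "tight M W \<longleftrightarrow> (\<forall>\<Phi>. (\<forall>K. \<forall>\<^sub>F p in prob_filter M. \<bar>W p\<bar> \<le> K \<longrightarrow> \<Phi> p) \<longrightarrow> eventually \<Phi> (prob_filter M))"

context prob_space
begin

lemma eventually_prob_filter:
  "eventually \<Phi> (prob_filter M) \<longleftrightarrow> (\<forall>e>0. \<forall>\<^sub>F n in sequentially.
     \<exists>A\<in>sets M. measure M A \<le> e \<and> (\<forall>\<omega>\<in>space M - A. \<Phi> (n, \<omega>)))"
  unfolding prob_filter_def
proof (rule eventually_Abs_filter, rule is_filter.intro, goal_cases)
  case 1
  show ?case by (auto intro!: always_eventually bexI[of _ "{}"])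
next
  case (2 P Q)
  show ?case
  proof (intro allI impI)
    fix e :: real assume "e > 0"
    then have "e / 2 > 0" by simp
    with 2 have
      "\<forall>\<^sub>F n in sequentially. \<exists>A\<in>sets M. measure M A \<le> e/2 \<and> (\<forall>\<omega>\<in>space M - A. P (n, \<omega>))"
      "\<forall>\<^sub>F n in sequentially. \<exists>A\<in>sets M. measure M A \<le> e/2 \<and> (\<forall>\<omega>\<in>space M - A. Q (n, \<omega>))"
      by blast+
    then show "\<forall>\<^sub>F n in sequentially. \<exists>A\<in>sets M. measure M A \<le> e \<and> (\<forall>\<omega>\<in>space M - A. P (n, \<omega>) \<and> Q (n, \<omega>))"
    proof eventually_elim
      case (elim n)
      then obtain A B where AB: "A \<in> sets M" "measure M A \<le> e/2" "\<forall>\<omega>\<in>space M - A. P (n, \<omega>)"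
        "B \<in> sets M" "measure M B \<le> e/2" "\<forall>\<omega>\<in>space M - B. Q (n, \<omega>)" by blast
      have "measure M (A \<union> B) \<le> e" using measure_Un_le[of A M B] AB by simp
      with AB show ?case by (intro bexI[of _ "A \<union> B"]) auto
    qed
  qed
next
  case (3 P Q)
  show ?case
  proof (intro allI impI)
    fix e :: real assume "e > 0"
    with 3 have "\<forall>\<^sub>F n in sequentially. \<exists>A\<in>sets M. measure M A \<le> e \<and> (\<forall>\<omega>\<in>space M - A. P (n, \<omega>))" by blast
    then show "\<forall>\<^sub>F n in sequentially. \<exists>A\<in>sets M. measure M A \<le> e \<and> (\<forall>\<omega>\<in>space M - A. Q (n, \<omega>))"
      by eventually_elim (use 3 in blast)
  qed
qed

lemma filterlim_fst_prob_filter: "filterlim fst sequentially (prob_filter M)"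
  unfolding filterlim_iff eventually_prob_filter
  by (auto elim!: eventually_mono intro!: bexI[of _ "{}"])

lemma eventually_in_space: "\<forall>\<^sub>F p in prob_filter M. snd p \<in> space M"
  unfolding eventually_prob_filter by (auto intro!: always_eventually bexI[of _ "{}"])

lemmas tendsto_fst_prob = filterlim_compose[OF _ filterlim_fst_prob_filter]
lemmas eventually_fst_prob = eventually_compose_filterlim[OF _ filterlim_fst_prob_filter]

text \<open>For measurable variables the event itself serves as exceptional set, so outer
  probability and probability define the same notion.\<close>

lemma tendsto_prob_filter_iff:
  assumes [measurable]: "\<And>n. Z n \<in> borel_measurable M"
  shows "((\<lambda>p. Z (fst p) (snd p)) \<longlongrightarrow> c) (prob_filter M) \<longleftrightarrow> conv_in_prob M Z c"
proof
  assume L: "((\<lambda>p. Z (fst p) (snd p)) \<longlongrightarrow> c) (prob_filter M)"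
  show "conv_in_prob M Z c" unfolding conv_in_prob_def
  proof (intro allI impI)
    fix e :: real assume "e > 0"
    have ev: "\<forall>\<^sub>F p in prob_filter M. \<bar>Z (fst p) (snd p) - c\<bar> < e"
      using tendstoD[OF L \<open>e > 0\<close>] by (simp add: dist_real_def)
    show "(\<lambda>n. measure M {\<omega> \<in> space M. e < \<bar>Z n \<omega> - c\<bar>}) \<longlonglongrightarrow> 0"
    proof (rule tendstoI)
      fix d :: real assume "d > 0"
      then have "\<forall>\<^sub>F n in sequentially. \<exists>A\<in>sets M. measure M A \<le> d/2 \<and> (\<forall>\<omega>\<in>space M - A. \<bar>Z n \<omega> - c\<bar> < e)"
        using ev[unfolded eventually_prob_filter, rule_format, of "d/2"] by simp
      then show "\<forall>\<^sub>F n in sequentially. dist (measure M {\<omega> \<in> space M. e < \<bar>Z n \<omega> - c\<bar>}) 0 < d"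
      proof eventually_elim
        case (elim n)
        then obtain A where A: "A \<in> sets M" "measure M A \<le> d/2" "\<forall>\<omega>\<in>space M - A. \<bar>Z n \<omega> - c\<bar> < e" by blast
        have "measure M {\<omega> \<in> space M. e < \<bar>Z n \<omega> - c\<bar>} \<le> measure M A"
          using A by (intro finite_measure_mono) force+
        with A \<open>d > 0\<close> show ?case by simp
      qed
    qed
  qed
next
  assume L: "conv_in_prob M Z c"
  show "((\<lambda>p. Z (fst p) (snd p)) \<longlongrightarrow> c) (prob_filter M)"
  proof (rule tendstoI)
    fix e :: real assume "e > 0"
    then have lim: "(\<lambda>n. measure M {\<omega> \<in> space M. e/2 < \<bar>Z n \<omega> - c\<bar>}) \<longlonglongrightarrow> 0"
      using L[unfolded conv_in_prob_def, rule_format, of "e/2"] by simp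
    show "\<forall>\<^sub>F p in prob_filter M. dist (Z (fst p) (snd p)) c < e"
      unfolding eventually_prob_filter
    proof (intro allI impI)
      fix d :: real assume "d > 0"
      from order_tendstoD(2)[OF lim this]
      show "\<forall>\<^sub>F n in sequentially. \<exists>A\<in>sets M. prob A \<le> d \<and> (\<forall>\<omega>\<in>space M - A. dist (Z (fst (n, \<omega>)) (snd (n, \<omega>))) c < e)"
      proof eventually_elim
        case (elim n)
        then show ?case using \<open>e > 0\<close>
          by (intro bexI[of _ "{\<omega> \<in> space M. e/2 < \<bar>Z n \<omega> - c\<bar>}"]) (auto simp: dist_real_def)
      qed
    qed
  qed
qed

lemma tightD:
  "tight M W \<Longrightarrow> (\<And>K. \<forall>\<^sub>F p in prob_filter M. \<bar>W p\<bar> \<le> K \<longrightarrow> \<Phi> p) \<Longrightarrow> eventually \<Phi> (prob_filter M)"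
  by (auto simp: tight_def)

lemma tight_mono:
  assumes "tight M W" "\<forall>\<^sub>F p in prob_filter M. \<bar>W' p\<bar> \<le> \<bar>W p\<bar>"
  shows "tight M W'"
  unfolding tight_def
proof (intro allI impI)
  fix \<Phi> assume *: "\<forall>K. \<forall>\<^sub>F p in prob_filter M. \<bar>W' p\<bar> \<le> K \<longrightarrow> \<Phi> p"
  show "eventually \<Phi> (prob_filter M)"
  proof (rule tightD[OF assms(1)])
    fix K
    show "\<forall>\<^sub>F p in prob_filter M. \<bar>W p\<bar> \<le> K \<longrightarrow> \<Phi> p"
      using *[rule_format, of K] assms(2) by eventually_elim auto
  qed
qed

lemma tight_add:
  assumes "tight M W" "tight M W'"
  shows "tight M (\<lambda>p. W p + W' p)"
  unfolding tight_def
proof (intro allI impI)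
  fix \<Phi> assume *: "\<forall>K. \<forall>\<^sub>F p in prob_filter M. \<bar>W p + W' p\<bar> \<le> K \<longrightarrow> \<Phi> p"
  show "eventually \<Phi> (prob_filter M)"
  proof (rule tightD[OF assms(1)], rule tightD[OF assms(2)])
    fix K K'
    show "\<forall>\<^sub>F p in prob_filter M. \<bar>W' p\<bar> \<le> K' \<longrightarrow> \<bar>W p\<bar> \<le> K \<longrightarrow> \<Phi> p"
      using *[rule_format, of "K + K'"] by eventually_elim auto
  qed
qed

lemma tight_mult:
  assumes "tight M W" "tight M W'"
  shows "tight M (\<lambda>p. W p * W' p)"
  unfolding tight_def
proof (intro allI impI)
  fix \<Phi> assume *: "\<forall>K. \<forall>\<^sub>F p in prob_filter M. \<bar>W p * W' p\<bar> \<le> K \<longrightarrow> \<Phi> p"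
  show "eventually \<Phi> (prob_filter M)"
  proof (rule tightD[OF assms(1)], rule tightD[OF assms(2)])
    fix K K'
    show "\<forall>\<^sub>F p in prob_filter M. \<bar>W' p\<bar> \<le> K' \<longrightarrow> \<bar>W p\<bar> \<le> K \<longrightarrow> \<Phi> p"
      using *[rule_format, of "\<bar>K\<bar> * \<bar>K'\<bar>"]
      by eventually_elim (auto simp: abs_mult intro!: mult_mono)
  qed
qed

lemma tendsto_imp_tight:
  assumes "(W \<longlongrightarrow> c) (prob_filter M)"
  shows "tight M W"
  unfolding tight_def
proof (intro allI impI)
  fix \<Phi> assume *: "\<forall>K. \<forall>\<^sub>F p in prob_filter M. \<bar>W p\<bar> \<le> K \<longrightarrow> \<Phi> p"
  have "\<forall>\<^sub>F p in prob_filter M. dist (W p) c < 1" by (rule tendstoD[OF assms]) simp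
  with *[rule_format, of "\<bar>c\<bar> + 1"] show "eventually \<Phi> (prob_filter M)"
    by eventually_elim (auto simp: dist_real_def)
qed

lemma tight_const: "tight M (\<lambda>_. c)"
  by (rule tendsto_imp_tight[OF tendsto_const])

lemma tight_diff:
  assumes "tight M W" "tight M W'"
  shows "tight M (\<lambda>p. W p - W' p)"
  using tight_add[OF assms(1) tight_mult[OF tight_const[of "-1"] assms(2)]] by simp

text \<open>The rule o_P(1) O_P(1) = o_P(1): where \<open>\<bar>W p\<bar> \<le> K\<close>, it is
  enough that \<open>U\<close> is below \<open>e / (\<bar>K\<bar> + 1)\<close>.\<close>

lemma tendsto_0_mult_tight:
  assumes "(U \<longlongrightarrow> 0) (prob_filter M)" "tight M W"
  shows "((\<lambda>p. U p * W p) \<longlongrightarrow> 0) (prob_filter M)"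
proof (rule tendstoI)
  fix e :: real assume "e > 0"
  show "\<forall>\<^sub>F p in prob_filter M. dist (U p * W p) 0 < e"
  proof (rule tightD[OF assms(2)])
    fix K
    have "\<forall>\<^sub>F p in prob_filter M. dist (U p) 0 < e / (\<bar>K\<bar> + 1)"
      by (rule tendstoD[OF assms(1)]) (use \<open>e > 0\<close> in auto)
    then show "\<forall>\<^sub>F p in prob_filter M. \<bar>W p\<bar> \<le> K \<longrightarrow> dist (U p * W p) 0 < e"
    proof eventually_elim
      case (elim p)
      show ?case
      proof
        assume K: "\<bar>W p\<bar> \<le> K"
        have "\<bar>U p\<bar> * (\<bar>K\<bar> + 1) < e" using elim by (simp add: field_simps)
        moreover have "\<bar>U p\<bar> * \<bar>W p\<bar> \<le> \<bar>U p\<bar> * (\<bar>K\<bar> + 1)" using K by (intro mult_left_mono) auto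
        ultimately show "dist (U p * W p) 0 < e" by (simp add: abs_mult)
      qed
    qed
  qed
qed

lemma tight_close:
  assumes "tight M W" "((\<lambda>p. W' p - W p) \<longlongrightarrow> c) (prob_filter M)"
  shows "tight M W'"
  using tight_add[OF assms(1) tendsto_imp_tight[OF assms(2)]] by simp

lemma Markov_abs:
  assumes [measurable]: "W \<in> borel_measurable M" and "(\<integral>\<^sup>+\<omega>. ennreal \<bar>W \<omega>\<bar> \<partial>M) \<le> ennreal C" "C \<ge> 0" "a > 0"
  shows "measure M {\<omega>\<in>space M. \<bar>W \<omega> :: real\<bar> \<ge> a} \<le> C / a"
proof -
  have "emeasure M {\<omega>\<in>space M. \<bar>W \<omega>\<bar> \<ge> a} = emeasure M {\<omega>\<in>space M. 1 \<le> ennreal (1/a) * ennreal \<bar>W \<omega>\<bar>}"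
    using \<open>a > 0\<close> by (auto simp: ennreal_mult[symmetric] field_simps simp flip: ennreal_1 intro!: arg_cong[where f="emeasure M"])
  also have "\<dots> \<le> ennreal (1/a) * (\<integral>\<^sup>+\<omega>. ennreal \<bar>W \<omega>\<bar> * indicator (space M) \<omega> \<partial>M)"
    by (rule nn_integral_Markov_inequality[where A="space M", simplified Int_def[symmetric]]) auto
  also have "\<dots> = ennreal (1/a) * (\<integral>\<^sup>+\<omega>. ennreal \<bar>W \<omega>\<bar> \<partial>M)"
    by (intro arg_cong[where f="\<lambda>x. _ * x"] nn_integral_cong) auto
  also have "\<dots> \<le> ennreal (1/a) * ennreal C" using assms by (intro mult_left_mono) auto
  also have "\<dots> = ennreal (C / a)" using assms by (simp add: ennreal_mult[symmetric])
  finally show ?thesis using assms by (simp add: emeasure_eq_measure)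
qed

lemma tight_moment:
  assumes W[measurable]: "\<And>n. W n \<in> borel_measurable M"
    and C: "\<forall>\<^sub>F n in sequentially. (\<integral>\<^sup>+\<omega>. ennreal \<bar>W n \<omega>\<bar> \<partial>M) \<le> ennreal C"
  shows "tight M (\<lambda>p. W (fst p) (snd p))"
  unfolding tight_def
proof (intro allI impI)
  fix \<Phi> assume *: "\<forall>K. \<forall>\<^sub>F p in prob_filter M. \<bar>W (fst p) (snd p)\<bar> \<le> K \<longrightarrow> \<Phi> p"
  show "eventually \<Phi> (prob_filter M)"
    unfolding eventually_prob_filter
  proof (intro allI impI)
    fix e :: real assume "e > 0"
    \<comment> \<open>Chosen so that Markov's inequality leaves probability at most
      \<open>e / 2\<close>; \<open>max C 1\<close> makes \<open>K\<close> positive whatever the sign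
      of \<open>C\<close>.\<close>
    define K where "K = 2 * max C 1 / e"
    have K: "K > 0" "max C 1 / K = e / 2" using \<open>e > 0\<close> by (auto simp: K_def)
    have "\<forall>\<^sub>F n in sequentially. \<exists>A\<in>sets M. prob A \<le> e / 2 \<and>
      (\<forall>\<omega>\<in>space M - A. \<bar>W n \<omega>\<bar> \<le> K \<longrightarrow> \<Phi> (n, \<omega>))"
      using *[rule_format, of K, unfolded eventually_prob_filter, rule_format, of "e/2"] \<open>e > 0\<close> by simp
    with C show "\<forall>\<^sub>F n in sequentially. \<exists>A\<in>sets M. prob A \<le> e \<and> (\<forall>\<omega>\<in>space M - A. \<Phi> (n, \<omega>))"
    proof eventually_elim
      case (elim n)
      then obtain A where A: "A \<in> sets M" "prob A \<le> e / 2" "\<forall>\<omega>\<in>space M - A. \<bar>W n \<omega>\<bar> \<le> K \<longrightarrow> \<Phi> (n, \<omega>)" by blast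
      let ?B = "{\<omega>\<in>space M. \<bar>W n \<omega>\<bar> \<ge> K}"
      have "(\<integral>\<^sup>+\<omega>. ennreal \<bar>W n \<omega>\<bar> \<partial>M) \<le> ennreal (max C 1)"
        using elim by (auto elim!: order_trans intro!: ennreal_leI)
      then have "prob ?B \<le> max C 1 / K" using K by (intro Markov_abs) auto
      then have "prob (A \<union> ?B) \<le> e" using measure_Un_le[of A M ?B] A K by simp
      moreover have "\<Phi> (n, \<omega>)" if "\<omega> \<in> space M - (A \<union> ?B)" for \<omega>
      proof -
        have "\<bar>W n \<omega>\<bar> < K" using that by auto
        with A(3) that show ?thesis by auto
      qed
      ultimately show ?case using A(1) by (intro bexI[of _ "A \<union> ?B"]) auto
    qed
  qed
qed

lemma tendsto_prob_moment:
  assumes W[measurable]: "\<And>n. W n \<in> borel_measurable M"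
    and C: "\<forall>\<^sub>F n in sequentially. (\<integral>\<^sup>+\<omega>. ennreal \<bar>W n \<omega>\<bar> \<partial>M) \<le> ennreal (c n)" and c: "c \<longlonglongrightarrow> 0"
  shows "((\<lambda>p. W (fst p) (snd p)) \<longlongrightarrow> 0) (prob_filter M)"
proof (rule tendstoI, unfold eventually_prob_filter, intro allI impI)
  fix e d :: real assume "e > 0" "d > 0"
  have "\<forall>\<^sub>F n in sequentially. c n < d * e"
    using \<open>e > 0\<close> \<open>d > 0\<close> by (intro order_tendstoD(2)[OF c]) auto
  with C show "\<forall>\<^sub>F n in sequentially. \<exists>A\<in>sets M. prob A \<le> d \<and>
     (\<forall>\<omega>\<in>space M - A. dist (W (fst (n, \<omega>)) (snd (n, \<omega>))) 0 < e)"
  proof eventually_elim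
    case (elim n)
    have "(\<integral>\<^sup>+\<omega>. ennreal \<bar>W n \<omega>\<bar> \<partial>M) \<le> ennreal (d * e)"
      using elim by (auto elim!: order_trans intro!: ennreal_leI)
    then have "prob {\<omega>\<in>space M. \<bar>W n \<omega>\<bar> \<ge> e} \<le> d * e / e"
      using \<open>e > 0\<close> \<open>d > 0\<close> by (intro Markov_abs) auto
    with \<open>e > 0\<close> show ?case by (intro bexI[of _ "{\<omega>\<in>space M. \<bar>W n \<omega>\<bar> \<ge> e}"]) auto
  qed
qed

text \<open>Ghosh's device: comparing the two distribution functions at finitely many points is enough.\<close>

lemma tight_level_sets_close:
  assumes W: "tight M W"
    and lev: "\<And>y. (R y \<longlongrightarrow> 0) (prob_filter M)"
      "\<And>y. \<forall>\<^sub>F p in prob_filter M. V p \<le> y \<longleftrightarrow> W p + R y p \<le> y"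
  shows "((\<lambda>p. V p - W p) \<longlongrightarrow> 0) (prob_filter M)"
proof (rule tendstoI)
  fix e :: real assume e: "e > 0"
  show "\<forall>\<^sub>F p in prob_filter M. dist (V p - W p) 0 < e"
  proof (rule tightD[OF W])
    fix K :: real
    \<comment> \<open>A grid of mesh \<open>e / 4\<close> covering
      \<open>\<bar>W p\<bar> \<le> K\<close> with a margin \<open>e\<close>; its finitely many
      level-set comparisons hold simultaneously.\<close>
    define N where "N = nat \<lceil>4 * (\<bar>K\<bar> + e) / e\<rceil> + 1"
    define g where "g i = of_int i * (e / 4)" for i :: int
    have "\<forall>\<^sub>F p in prob_filter M. \<forall>i\<in>{-int N..int N}.
        \<bar>R (g i) p\<bar> < e / 4 \<and> (V p \<le> g i \<longleftrightarrow> W p + R (g i) p \<le> g i)"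
      using lev tendstoD[OF lev(1), of "e/4"] e
      by (intro eventually_ball_finite ballI eventually_conj) (auto simp: dist_real_def)
    then show "\<forall>\<^sub>F p in prob_filter M. \<bar>W p\<bar> \<le> K \<longrightarrow> dist (V p - W p) 0 < e"
    proof eventually_elim
      case (elim p)
      show ?case
      proof
      assume WK: "\<bar>W p\<bar> \<le> K"
      define i where "i = \<lfloor>4 * W p / e\<rfloor>"
      have i: "g i \<le> W p" "W p < g (i + 1)"
        using floor_correct[of "4 * W p / e"] unfolding i_def[symmetric]
        using e by (auto simp: g_def field_simps)
      have N: "real N * (e / 4) \<ge> \<bar>K\<bar> + e"
      proof -
        have "4 * (\<bar>K\<bar> + e) / e \<le> real N" unfolding N_def by linarith
        then show ?thesis using e by (simp add: field_simps)
      qed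
      have rng: "j \<in> {-int N..int N}" if "\<bar>g j\<bar> \<le> \<bar>K\<bar> + e" for j
      proof -
        have "\<bar>g j\<bar> = \<bar>real_of_int j\<bar> * (e / 4)" using e by (simp add: g_def abs_mult)
        then have "\<bar>real_of_int j\<bar> * (e / 4) \<le> real N * (e / 4)" using that N by linarith
        then have "\<bar>real_of_int j\<bar> \<le> real N" by (rule mult_right_le_imp_le) (use e in simp)
        then show ?thesis by auto
      qed
      have gs: "g (j + m) = g j + of_int m * (e / 4)" for j m by (simp add: g_def algebra_simps)
      have up: "g (i + 2) = g i + e/2" "g (i - 1) = g i - e/4" "g (i+1) = g i + e/4"
        using gs[of i 2] gs[of i "-1"] gs[of i 1] by auto
      \<comment> \<open>With \<open>W p\<close> between \<open>g i\<close> and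
        \<open>g (i + 1)\<close>, remainders below \<open>e / 4\<close> force
        \<open>V p \<le> g (i + 2)\<close> and \<open>V p > g (i - 1)\<close>, hence a difference of
        at most \<open>e / 2\<close>.\<close>
      have "i + 2 \<in> {-int N..int N}" "i - 1 \<in> {-int N..int N}"
        by (rule rng, use WK i e up in linarith)+
      with elim have "\<bar>R (g (i + 2)) p\<bar> < e / 4" "V p \<le> g (i + 2) \<longleftrightarrow> W p + R (g (i + 2)) p \<le> g (i + 2)"
        "\<bar>R (g (i - 1)) p\<bar> < e / 4" "V p \<le> g (i - 1) \<longleftrightarrow> W p + R (g (i - 1)) p \<le> g (i - 1)"
        by blast+
      then have "V p \<le> g (i + 2)" "\<not> V p \<le> g (i - 1)" using i up by linarith+
      then show "dist (V p - W p) 0 < e" using i up e by (simp add: dist_real_def)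
      qed
    qed
  qed
qed

end

section \<open>Moments of tails and sums of independent variables\<close>

lemma has_bochner_integral_power_exp:
  fixes a :: real
  assumes "a > 0"
  shows "has_bochner_integral lborel (\<lambda>y. indicator {0..} y * (y ^ i * exp (- a * y))) (fact i / a ^ Suc i)"
proof (rule has_bochner_integral_nn_integral)
  \<comment> \<open>\<open>erlang_density 0 a\<close> is the exponential density; its factor
    \<open>a\<close> is divided out next.\<close>
  have "(\<integral>\<^sup>+ x. ennreal (erlang_density 0 a x * x ^ i) \<partial>lborel) = ennreal (fact i / a ^ i)"
    using nn_integral_erlang_ith_moment[OF assms, of 0 i] by simp
  then have "ennreal (1 / a) * (\<integral>\<^sup>+ x. ennreal (erlang_density 0 a x * x ^ i) \<partial>lborel) = ennreal (1 / a) * ennreal (fact i / a ^ i)"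
    by simp
  also have "\<dots> = ennreal (fact i / a ^ Suc i)" using assms by (simp add: ennreal_mult[symmetric])
  finally show "(\<integral>\<^sup>+ x. ennreal (indicator {0..} x * (x ^ i * exp (- a * x))) \<partial>lborel) = ennreal (fact i / a ^ Suc i)"
    using assms by (subst (asm) nn_integral_cmult[symmetric])
      (auto simp: erlang_density_def ennreal_mult'[symmetric] field_simps split: split_indicator
        intro!: nn_integral_cong elim!: trans[rotated])
qed (use assms in \<open>auto split: split_indicator\<close>)

lemma has_bochner_integral_exp:
  assumes "a > (0::real)"
  shows "has_bochner_integral lborel (\<lambda>y. indicator {0..} y * exp (- a * y)) (1 / a)"
  using has_bochner_integral_power_exp[OF assms, of 0] by simp

text \<open>Layer-cake formula: a function of an excess \<open>z\<close> becomes an integral over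
  the levels \<open>y\<close> below \<open>z\<close>. The end point \<open>y = z\<close> is a null
  set.\<close>

lemma integral_indicator_less_exp:
  fixes z s :: real
  assumes "z \<ge> 0"
  shows "has_bochner_integral lborel (\<lambda>y. indicator {0..} y * (of_bool (y < z) * exp (s * y)))
     (if s = 0 then z else (exp (s * z) - 1) / s)"
proof -
  let ?F = "\<lambda>y. if s = 0 then y else exp (s * y) / s"
  have *: "integral\<^sup>L lborel (\<lambda>x. indicator {0 .. z} x *\<^sub>R exp (s * x)) = ?F z - ?F 0"
    by (rule integral_FTC_atLeastAtMost[OF assms])
      (cases "s = 0"; auto intro!: derivative_eq_intros continuous_intros simp flip: has_real_derivative_iff_has_vector_derivative)+
  have i: "integrable lborel (\<lambda>x. indicator {0 .. z} x *\<^sub>R exp (s * x))"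
    using borel_integrable_atLeastAtMost'[of 0 z "\<lambda>x. exp (s * x)"]
    by (simp add: set_integrable_def continuous_intros del: real_scaleR_def)
  have "has_bochner_integral lborel (\<lambda>x. indicator {0 .. z} x *\<^sub>R exp (s * x)) (?F z - ?F 0)"
    using has_bochner_integral_integrable[OF i] * by simp
  also have "?F z - ?F 0 = (if s = 0 then z else (exp (s * z) - 1) / s)" by (simp add: diff_divide_distrib)
  finally show ?thesis
  proof (rule has_bochner_integral_cong_AE[THEN iffD1, rotated -1])
    have "AE y in lborel. y \<noteq> z" by (rule AE_lborel_singleton)
    then show "AE y in lborel. indicator {0..z} y *\<^sub>R exp (s * y) = indicator {0..} y * (of_bool (y < z) * exp (s * y))"
      by eventually_elim (auto split: split_indicator)
  qed auto
qed

context prob_space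
begin

text \<open>Binomial variance: the centred indicators are independent, so the cross term vanishes
  each time an index is added to the sum.\<close>

lemma count_second_moment:
  fixes X :: "'b \<Rightarrow> 'a \<Rightarrow> real"
  assumes ind: "indep_vars (\<lambda>_. borel) X I" and fin: "finite I" and [measurable]: "B \<in> sets borel"
    and q: "\<And>i. i \<in> I \<Longrightarrow> prob {\<omega>\<in>space M. X i \<omega> \<in> B} = q"
  shows "expectation (\<lambda>\<omega>. ((\<Sum>i\<in>I. indicator B (X i \<omega>)) - real (card I) * q)\<^sup>2) = real (card I) * (q * (1 - q))"
proof -
  define Y where "Y i \<omega> = indicator B (X i \<omega>) - q" for i \<omega>
  have indY: "indep_vars (\<lambda>_. borel) Y I"
    unfolding Y_def by (rule indep_vars_compose2[OF ind]) auto
  have rv: "random_variable borel (X i)" "random_variable borel (Y i)" if "i \<in> I" for i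
    using ind indY that by (auto simp: indep_vars_def2)
  have bd: "\<bar>Y i \<omega>\<bar> \<le> 1 + \<bar>q\<bar>" for i \<omega> by (auto simp: Y_def split: split_indicator)
  have int: "integrable M (Y i)" if "i \<in> I" for i
    by (rule integrable_const_bound[where B="1 + \<bar>q\<bar>"]) (use bd rv[OF that] in auto)
  have e_ind: "expectation (\<lambda>\<omega>. indicator B (X i \<omega>)) = q" if "i \<in> I" for i
  proof -
    have [measurable]: "X i \<in> borel_measurable M" using rv that by blast
    have "expectation (\<lambda>\<omega>. indicator B (X i \<omega>)) = expectation (indicator {\<omega>\<in>space M. X i \<omega> \<in> B})"
      by (intro Bochner_Integration.integral_cong) (auto split: split_indicator)
    also have "\<dots> = prob {\<omega>\<in>space M. X i \<omega> \<in> B}" by (subst Bochner_Integration.integral_indicator) (auto intro: arg_cong[where f=prob])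
    finally show ?thesis using q[OF that] by simp
  qed
  have i_ind: "integrable M (\<lambda>\<omega>. indicator B (X i \<omega>) :: real)" if "i \<in> I" for i
    by (rule integrable_const_bound[where B=1]) (use rv[OF that] in \<open>auto split: split_indicator\<close>)
  have eY: "expectation (Y i) = 0" if "i \<in> I" for i
    using i_ind[OF that] e_ind[OF that] by (simp add: Y_def[abs_def] prob_space)
  have eY2: "expectation (\<lambda>\<omega>. (Y i \<omega>)\<^sup>2) = q * (1 - q)" if "i \<in> I" for i
  proof -
    have "expectation (\<lambda>\<omega>. (Y i \<omega>)\<^sup>2) = expectation (\<lambda>\<omega>. (1 - 2 * q) * indicator B (X i \<omega>) + q\<^sup>2)"
      by (intro Bochner_Integration.integral_cong) (auto simp: Y_def power2_eq_square algebra_simps split: split_indicator)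
    also have "\<dots> = (1 - 2 * q) * q + q\<^sup>2" using i_ind[OF that] e_ind[OF that] by (simp add: prob_space)
    finally show ?thesis by (simp add: power2_eq_square algebra_simps)
  qed
  have "J \<subseteq> I \<Longrightarrow> expectation (\<lambda>\<omega>. (\<Sum>i\<in>J. Y i \<omega>)\<^sup>2) = real (card J) * (q * (1 - q))" if "finite J" for J
    using that
  proof induction
    case (insert j J)
    then have j: "j \<in> I" "J \<subseteq> I" by auto
    have [measurable]: "Y i \<in> borel_measurable M" if "i \<in> insert j J" for i using rv insert that by auto
    have sb: "\<bar>\<Sum>i\<in>J. Y i \<omega>\<bar> \<le> real (card J) * (1 + \<bar>q\<bar>)" for \<omega>
      by (rule order_trans[OF sum_abs]) (use bd sum_bounded_above[of J "\<lambda>i. \<bar>Y i \<omega>\<bar>"] in auto)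
    have iS: "integrable M (\<lambda>\<omega>. \<Sum>i\<in>J. Y i \<omega>)" using int j by (intro Bochner_Integration.integrable_sum) auto
    have iS2: "integrable M (\<lambda>\<omega>. (\<Sum>i\<in>J. Y i \<omega>)\<^sup>2)"
      by (rule integrable_const_bound[where B="(real (card J) * (1 + \<bar>q\<bar>))\<^sup>2"])
        (use sb in \<open>auto intro!: AE_I2 power2_le_iff_abs_le[THEN iffD2]\<close>)
    have iY2: "integrable M (\<lambda>\<omega>. (Y j \<omega>)\<^sup>2)"
      by (rule integrable_const_bound[where B="(1 + \<bar>q\<bar>)\<^sup>2"])
        (use bd in \<open>auto intro!: AE_I2 power2_le_iff_abs_le[THEN iffD2]\<close>)
    have indS: "indep_var borel (Y j) borel (\<lambda>\<omega>. \<Sum>i\<in>J. Y i \<omega>)"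
      using insert by (intro indep_vars_sum indep_vars_subset[OF indY]) auto
    note prod = indep_var_lebesgue_integral[OF indS int[OF j(1)] iS] indep_var_integrable[OF indS int[OF j(1)] iS]
    have "expectation (\<lambda>\<omega>. (\<Sum>i\<in>insert j J. Y i \<omega>)\<^sup>2) =
      expectation (\<lambda>\<omega>. (Y j \<omega>)\<^sup>2 + 2 * (Y j \<omega> * (\<Sum>i\<in>J. Y i \<omega>)) + (\<Sum>i\<in>J. Y i \<omega>)\<^sup>2)"
      using insert by (intro Bochner_Integration.integral_cong) (auto simp: power2_sum)
    also have "\<dots> = q * (1 - q) + real (card J) * (q * (1 - q))"
      using iY2 iS2 prod eY[OF j(1)] eY2[OF j(1)] insert.IH j by simp
    finally show ?case using insert by (simp add: algebra_simps)
  qed simp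
  from this[OF fin order_refl] show ?thesis by (simp add: Y_def sum_subtractf)
qed

text \<open>Integration by parts against the tail, through Fubini for \<open>G\<close>. The factor
  \<open>of_bool (Z \<omega> > 0)\<close> discards the atom that truncation creates at 0, and
  \<open>b < c\<close> makes the double integral absolutely convergent.\<close>

lemma tail_expectation:
  fixes Z :: "'a \<Rightarrow> real"
  assumes Z[measurable]: "Z \<in> borel_measurable M" and Z0: "\<And>\<omega>. Z \<omega> \<ge> 0"
    and der: "\<And>y. (f has_real_derivative f' y) (at y)" and cont: "continuous_on UNIV f'"
    and bnd: "\<And>y. y \<ge> 0 \<Longrightarrow> \<bar>f' y\<bar> \<le> B * exp (b * y)"
    and tail: "\<And>y. y \<ge> 0 \<Longrightarrow> prob {\<omega>\<in>space M. Z \<omega> > y} \<le> A * exp (- c * y)" and bc: "b < c"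
  shows "integrable M (\<lambda>\<omega>. of_bool (Z \<omega> > 0) * f (Z \<omega>))" (is ?I)
    and "expectation (\<lambda>\<omega>. of_bool (Z \<omega> > 0) * f (Z \<omega>)) =
      f 0 * prob {\<omega>\<in>space M. Z \<omega> > 0} + (LINT y|lborel. indicator {0..} y * (f' y * prob {\<omega>\<in>space M. Z \<omega> > y}))" (is ?E)
proof -
  interpret P: pair_sigma_finite M lborel ..
  have [measurable]: "f' \<in> borel_measurable borel" using cont by (rule borel_measurable_continuous_onI)
  have "continuous_on UNIV f" using der by (meson DERIV_isCont continuous_at_imp_continuous_on)
  then have [measurable]: "f \<in> borel_measurable borel" by (rule borel_measurable_continuous_onI)
  define G where "G = (\<lambda>\<omega> y. indicator {0..} y * (of_bool (Z \<omega> > y) * f' y))"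
  have G[measurable]: "case_prod G \<in> borel_measurable (M \<Otimes>\<^sub>M lborel)"
    unfolding G_def by measurable
  have pr: "integrable M (\<lambda>\<omega>. of_bool (Z \<omega> > y) :: real)" "expectation (\<lambda>\<omega>. of_bool (Z \<omega> > y)) = prob {\<omega>\<in>space M. Z \<omega> > y}" for y
  proof -
    show "integrable M (\<lambda>\<omega>. of_bool (Z \<omega> > y) :: real)"
      by (rule integrable_const_bound[where B=1]) auto
    have "expectation (\<lambda>\<omega>. of_bool (Z \<omega> > y)) = expectation (indicator {\<omega>\<in>space M. Z \<omega> > y})"
      by (intro Bochner_Integration.integral_cong) (auto split: split_indicator)
    also have "\<dots> = prob {\<omega>\<in>space M. Z \<omega> > y}"
      by (subst Bochner_Integration.integral_indicator) (auto intro: arg_cong[where f=prob])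
    finally show "expectation (\<lambda>\<omega>. of_bool (Z \<omega> > y)) = prob {\<omega>\<in>space M. Z \<omega> > y}" .
  qed
  have exG: "expectation (\<lambda>\<omega>. G \<omega> y) = indicator {0..} y * (f' y * prob {\<omega>\<in>space M. Z \<omega> > y})" for y
    unfolding G_def by (simp add: pr mult_ac)
  have "integrable (M \<Otimes>\<^sub>M lborel) (case_prod G)"
  proof (rule integrableI_bounded[OF G])
    have "(\<integral>\<^sup>+ x. ennreal (norm (case_prod G x)) \<partial>(M \<Otimes>\<^sub>M lborel)) = (\<integral>\<^sup>+ y. (\<integral>\<^sup>+ \<omega>. ennreal \<bar>G \<omega> y\<bar> \<partial>M) \<partial>lborel)"
      by (subst P.nn_integral_snd[symmetric]) auto
    also have "\<dots> \<le> (\<integral>\<^sup>+ y. ennreal (indicator {0..} y * (B * A * exp (- (c - b) * y))) \<partial>lborel)"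
    proof (rule nn_integral_mono)
      fix y :: real
      have "(\<integral>\<^sup>+ \<omega>. ennreal \<bar>G \<omega> y\<bar> \<partial>M) = (\<integral>\<^sup>+ \<omega>. ennreal (indicator {0..} y * \<bar>f' y\<bar> * of_bool (Z \<omega> > y)) \<partial>M)"
        by (intro nn_integral_cong) (auto simp: G_def abs_mult split: split_indicator)
      also have "\<dots> = ennreal (expectation (\<lambda>\<omega>. indicator {0..} y * \<bar>f' y\<bar> * of_bool (Z \<omega> > y)))"
        by (intro nn_integral_eq_integral) (auto intro!: pr integrable_mult_right)
      also have "\<dots> = ennreal (indicator {0..} y * \<bar>f' y\<bar> * prob {\<omega>\<in>space M. Z \<omega> > y})" by (simp add: pr)
      also have "\<dots> \<le> ennreal (indicator {0..} y * (B * A * exp (- (c - b) * y)))"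
      proof (cases "y \<ge> 0")
        case True
        have "\<bar>f' y\<bar> * prob {\<omega>\<in>space M. Z \<omega> > y} \<le> (B * exp (b * y)) * (A * exp (- c * y))"
          using bnd[OF True] tail[OF True] by (intro mult_mono) (auto intro: order_trans[OF abs_ge_zero])
        also have "\<dots> = B * A * (exp (b * y) * exp (- c * y))" by (simp only: mult_ac)
        also have "exp (b * y) * exp (- c * y) = exp (- (c - b) * y)" by (simp flip: exp_add add: algebra_simps)
        finally show ?thesis using True by (intro ennreal_leI) simp
      qed simp
      finally show "(\<integral>\<^sup>+ \<omega>. ennreal \<bar>G \<omega> y\<bar> \<partial>M) \<le> ennreal (indicator {0..} y * (B * A * exp (- (c - b) * y)))" .
    qed
    also have "\<dots> < \<infinity>"
    proof -
      have "integrable lborel (\<lambda>y. (B * A) * (indicator {0..} y * exp (- (c - b) * y)))"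
        using has_bochner_integral_exp[of "c - b"] bc by (intro integrable_mult_right) (auto simp: has_bochner_integral_iff)
      then have "integrable lborel (\<lambda>y. indicator {0..} y * (B * A * exp (- (c - b) * y)))" by (simp only: mult_ac)
      from integrableD(2)[OF this] show ?thesis by (simp only: top.not_eq_extremum infinity_ennreal_def)
    qed
    finally show "(\<integral>\<^sup>+ x. ennreal (norm (case_prod G x)) \<partial>(M \<Otimes>\<^sub>M lborel)) < \<infinity>" .
  qed
  note fub = P.Fubini_integral[OF this] P.integrable_fst[OF this]
  have inner: "(LINT y|lborel. G \<omega> y) = of_bool (Z \<omega> > 0) * (f (Z \<omega>) - f 0)" for \<omega>
  proof -
    have "(LINT y|lborel. G \<omega> y) = (LINT y|lborel. indicator {0..Z \<omega>} y *\<^sub>R f' y)"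
    proof (rule integral_cong_AE)
      have "AE y in lborel. y \<noteq> Z \<omega>" by (rule AE_lborel_singleton)
      then show "AE y in lborel. G \<omega> y = indicator {0..Z \<omega>} y *\<^sub>R f' y"
        by eventually_elim (auto simp: G_def split: split_indicator)
    qed (auto simp: G_def)
    also have "\<dots> = f (Z \<omega>) - f 0"
      by (rule integral_FTC_atLeastAtMost[OF Z0])
        (auto intro: continuous_on_subset[OF cont] has_field_derivative_at_within der simp flip: has_real_derivative_iff_has_vector_derivative)
    finally show ?thesis using Z0[of \<omega>] by auto
  qed
  have int: "integrable M (\<lambda>\<omega>. of_bool (Z \<omega> > 0) * (f (Z \<omega>) - f 0))" using fub(2) by (simp add: inner)
  have dec: "of_bool (Z \<omega> > 0) * f (Z \<omega>) = of_bool (Z \<omega> > 0) * (f (Z \<omega>) - f 0) + of_bool (Z \<omega> > 0) * f 0" for \<omega>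
    by (simp add: algebra_simps)
  show ?I unfolding dec by (intro Bochner_Integration.integrable_add int integrable_mult_left pr)
  show ?E unfolding dec using int fub(1) by (simp add: inner exG pr)
qed

text \<open>Lyapunov's theorem in raw moments: the means are of order \<open>1 / n\<close>, so
  second moments act as variances. The row sum has characteristic function
  \<open>\<phi> n ^ n\<close>, and the third-order Taylor bound makes
  \<open>n * (\<phi> n - 1)\<close> converge to the exponent.\<close>

lemma triangular_array_char:
  fixes W :: "nat \<Rightarrow> nat \<Rightarrow> 'a \<Rightarrow> real" and V :: "nat \<Rightarrow> 'a \<Rightarrow> real" and m v t :: real
  assumes V[measurable]: "\<And>n. V n \<in> borel_measurable M" and ind: "\<And>n. indep_vars (\<lambda>_. borel) (W n) {1..n}"
    and dist: "\<And>n i. i \<in> {1..n} \<Longrightarrow> distr M borel (W n i) = distr M borel (V n)"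
    and int: "\<forall>\<^sub>F n in sequentially. integrable M (\<lambda>\<omega>. \<bar>V n \<omega>\<bar> ^ 3)"
    and m: "(\<lambda>n. real n * expectation (V n)) \<longlonglongrightarrow> m"
    and v: "(\<lambda>n. real n * expectation (\<lambda>\<omega>. (V n \<omega>)\<^sup>2)) \<longlonglongrightarrow> v"
    and lya: "(\<lambda>n. real n * expectation (\<lambda>\<omega>. \<bar>V n \<omega>\<bar> ^ 3)) \<longlonglongrightarrow> 0"
  shows "(\<lambda>n. char (distr M borel (\<lambda>\<omega>. \<Sum>i=1..n. W n i \<omega>)) t) \<longlonglongrightarrow> exp (\<i> * t * m - t\<^sup>2 * v / 2)"
proof -
  define z where "z = (\<i> * t * m - t\<^sup>2 * v / 2 :: complex)"
  define \<phi> where "\<phi> n = char (distr M borel (V n)) t" for n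
  \<comment> \<open>Gives the exponent a nonpositive real part, so that \<open>exp (z / n)\<close>
    has modulus at most 1 below.\<close>
  have "v \<ge> 0" by (rule tendsto_lowerbound[OF v]) (auto intro!: always_eventually integral_nonneg_AE)
  have c: "char (distr M borel (\<lambda>\<omega>. \<Sum>i=1..n. W n i \<omega>)) t = \<phi> n ^ n" for n
  proof -
    have "char (distr M borel (\<lambda>\<omega>. \<Sum>i=1..n. W n i \<omega>)) t = (\<Prod>i=1..n. char (distr M borel (W n i)) t)"
      by (rule char_distr_sum[OF ind])
    also have "\<dots> = (\<Prod>i=1..n. \<phi> n)"
      by (rule prod.cong[OF refl]) (simp only: \<phi>_def dist)
    finally show ?thesis by simp
  qed
  have app: "\<forall>\<^sub>F n in sequentially. cmod (real n * (\<phi> n - 1) - (\<i> * t * (real n * expectation (V n)) - t\<^sup>2 * (real n * expectation (\<lambda>\<omega>. (V n \<omega>)\<^sup>2)) / 2))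
     \<le> \<bar>t\<bar> ^ 3 * (real n * expectation (\<lambda>\<omega>. \<bar>V n \<omega>\<bar> ^ 3))"
    using int eventually_gt_at_top[of 0]
  proof eventually_elim
    case (elim n)
    interpret D: real_distribution "distr M borel (V n)" by (rule real_distribution_distr) simp
    have i3: "integrable M (\<lambda>\<omega>. \<bar>V n \<omega>\<bar> ^ 3)" by fact
    \<comment> \<open>Integrability of the third absolute power carries over to the lower
      powers.\<close>
    have le: "\<bar>x\<bar> ^ j \<le> 1 + \<bar>x\<bar> ^ 3" if "j \<le> 2" for x :: real and j :: nat
    proof (cases "\<bar>x\<bar> \<le> 1")
      case True then have "\<bar>x\<bar> ^ j \<le> 1" by (simp add: power_le_one)
      then show ?thesis by (simp add: add_increasing2)
    next
      case False then have "\<bar>x\<bar> ^ j \<le> \<bar>x\<bar> ^ 3" using that by (intro power_increasing) auto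
      then show ?thesis by simp
    qed
    have ij: "integrable M (\<lambda>\<omega>. V n \<omega> ^ j)" if "j \<le> 2" for j
      by (rule Bochner_Integration.integrable_bound[of M "\<lambda>\<omega>. 1 + \<bar>V n \<omega>\<bar> ^ 3"])
        (use i3 le[OF that] in \<open>auto simp: power_abs intro!: AE_I2\<close>)
    then have "integrable (distr M borel (V n)) (\<lambda>x. x ^ j)" if "j \<le> 2" for j
      using that by (simp add: integrable_distr_eq)
    from D.char_approx2[of 2 t, OF this]
    have "cmod (\<phi> n - (\<Sum>j\<le>2. ((\<i> * t) ^ j / fact j) * expectation (\<lambda>\<omega>. V n \<omega> ^ j))) \<le>
      (\<bar>t\<bar>\<^sup>2 / fact 3) * expectation (\<lambda>\<omega>. min (2 * \<bar>V n \<omega>\<bar>\<^sup>2 * 3) (\<bar>t\<bar> * \<bar>V n \<omega>\<bar> ^ 3))"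
      unfolding \<phi>_def by (simp add: integral_distr eval_nat_numeral)
    also have "(\<Sum>j\<le>2. ((\<i> * t) ^ j / fact j) * expectation (\<lambda>\<omega>. V n \<omega> ^ j)) =
       1 + \<i> * t * expectation (V n) - t\<^sup>2 * expectation (\<lambda>\<omega>. (V n \<omega>)\<^sup>2) / 2"
      by (simp add: numeral_2_eq_2 prob_space power_mult_distrib)
    also have "(\<bar>t\<bar>\<^sup>2 / fact 3) * expectation (\<lambda>\<omega>. min (2 * \<bar>V n \<omega>\<bar>\<^sup>2 * 3) (\<bar>t\<bar> * \<bar>V n \<omega>\<bar> ^ 3))
      \<le> \<bar>t\<bar>\<^sup>2 * expectation (\<lambda>\<omega>. \<bar>t\<bar> * \<bar>V n \<omega>\<bar> ^ 3)"
    proof (intro mult_mono)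
      show "expectation (\<lambda>\<omega>. min (2 * \<bar>V n \<omega>\<bar>\<^sup>2 * 3) (\<bar>t\<bar> * \<bar>V n \<omega>\<bar> ^ 3)) \<le> expectation (\<lambda>\<omega>. \<bar>t\<bar> * \<bar>V n \<omega>\<bar> ^ 3)"
        by (rule integral_mono_AE') (use i3 in \<open>auto intro!: AE_I2\<close>)
      show "\<bar>t\<bar>\<^sup>2 / fact 3 \<le> \<bar>t\<bar>\<^sup>2" by (simp add: divide_le_eq_1 field_simps eval_nat_numeral)
    qed (auto intro!: integral_nonneg_AE AE_I2)
    also have "\<dots> = \<bar>t\<bar> ^ 3 * expectation (\<lambda>\<omega>. \<bar>V n \<omega>\<bar> ^ 3)" by (simp add: power3_eq_cube power2_eq_square)
    finally have "real n * cmod (\<phi> n - (1 + \<i> * t * expectation (V n) - t\<^sup>2 * expectation (\<lambda>\<omega>. (V n \<omega>)\<^sup>2) / 2))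
      \<le> real n * (\<bar>t\<bar> ^ 3 * expectation (\<lambda>\<omega>. \<bar>V n \<omega>\<bar> ^ 3))" by (intro mult_left_mono) auto
    also have "real n * cmod (\<phi> n - (1 + \<i> * t * expectation (V n) - t\<^sup>2 * expectation (\<lambda>\<omega>. (V n \<omega>)\<^sup>2) / 2))
      = cmod (complex_of_real (real n) * (\<phi> n - (1 + \<i> * t * expectation (V n) - t\<^sup>2 * expectation (\<lambda>\<omega>. (V n \<omega>)\<^sup>2) / 2)))"
      by (simp add: norm_mult)
    also have "complex_of_real (real n) * (\<phi> n - (1 + \<i> * t * expectation (V n) - t\<^sup>2 * expectation (\<lambda>\<omega>. (V n \<omega>)\<^sup>2) / 2)) =
      real n * (\<phi> n - 1) - (\<i> * t * (real n * expectation (V n)) - t\<^sup>2 * (real n * expectation (\<lambda>\<omega>. (V n \<omega>)\<^sup>2)) / 2)"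
      by (simp add: algebra_simps)
    finally show ?case by (simp add: mult_ac)
  qed
  have "(\<lambda>n. \<bar>t\<bar> ^ 3 * (real n * expectation (\<lambda>\<omega>. \<bar>V n \<omega>\<bar> ^ 3))) \<longlonglongrightarrow> 0"
    using tendsto_mult[OF tendsto_const lya, of "\<bar>t\<bar> ^ 3"] by simp
  note lim0 = Lim_null_comparison[OF app this]
  have "(\<lambda>n. \<i> * t * complex_of_real (real n * expectation (V n)) - t\<^sup>2 * complex_of_real (real n * expectation (\<lambda>\<omega>. (V n \<omega>)\<^sup>2)) / 2) \<longlonglongrightarrow> z"
    by (rule tendsto_eq_rhs[OF tendsto_diff[OF tendsto_mult[OF tendsto_const tendsto_of_real[OF m]]
        tendsto_divide[OF tendsto_mult[OF tendsto_const tendsto_of_real[OF v]] tendsto_const]]]) (simp_all add: z_def)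
  from tendsto_add[OF lim0 this]
  have n\<phi>: "(\<lambda>n. real n * (\<phi> n - 1)) \<longlonglongrightarrow> z" by simp
  have der: "((\<lambda>h::complex. exp (z * h)) has_field_derivative z) (at 0)" by (auto intro!: derivative_eq_intros)
  have "(\<lambda>n. real n * (exp (z * (1 / real n)) - 1)) \<longlonglongrightarrow> z"
  proof -
    have "((\<lambda>h::complex. (exp (z * h) - 1) / h) \<longlongrightarrow> z) (at 0)" using der by (simp add: has_field_derivative_iff)
    moreover have "filterlim (\<lambda>n. complex_of_real (1 / real n)) (at 0) sequentially"
    proof (rule filterlim_atI)
      show "(\<lambda>n. complex_of_real (1 / real n)) \<longlonglongrightarrow> 0"
        using tendsto_of_real[OF lim_1_over_n, where 'a=complex] by simp
      show "\<forall>\<^sub>F n in sequentially. complex_of_real (1 / real n) \<noteq> 0"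
        using eventually_gt_at_top[of 0] by eventually_elim simp
    qed
    ultimately have "(\<lambda>n. (exp (z * complex_of_real (1 / real n)) - 1) / complex_of_real (1 / real n)) \<longlonglongrightarrow> z"
      by (rule filterlim_compose)
    then show ?thesis by (simp add: mult.commute)
  qed
  from tendsto_diff[OF n\<phi> this]
  have d0: "(\<lambda>n. cmod (real n * (\<phi> n - exp (z * (1 / real n))))) \<longlonglongrightarrow> 0"
    by (intro tendsto_norm_zero) (simp add: algebra_simps)
  \<comment> \<open>The \<open>n\<close>-th powers of two numbers in the unit disc differ by at most
    \<open>n\<close> times the distance of the numbers; both \<open>n * (\<phi> n - 1)\<close> and
    \<open>n * (exp (z / n) - 1)\<close> tend to \<open>z\<close>.\<close>
  have "(\<lambda>n. \<phi> n ^ n - exp z) \<longlonglongrightarrow> 0"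
  proof (rule Lim_null_comparison[OF _ d0])
    show "\<forall>\<^sub>F n in sequentially. norm (\<phi> n ^ n - exp z) \<le> cmod (real n * (\<phi> n - exp (z * (1 / real n))))"
      using eventually_gt_at_top[of 0]
    proof eventually_elim
      case (elim n)
        interpret D: real_distribution "distr M borel (V n)" by (rule real_distribution_distr) simp
      have e: "exp z = exp (z * (1 / real n)) ^ n" using elim by (simp flip: exp_of_nat_mult)
      have "Re z \<le> 0" using \<open>v \<ge> 0\<close> by (simp add: z_def flip: of_real_power of_real_mult)
      then have "cmod (exp (z * (1 / real n))) \<le> 1" by (simp add: divide_nonpos_nonneg)
      then have "norm (\<phi> n ^ n - exp (z * (1 / real n)) ^ n) \<le> real n * norm (\<phi> n - exp (z * (1 / real n)))"
        unfolding \<phi>_def by (intro norm_power_diff D.cmod_char_le_1)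
      then show ?case unfolding e by (simp add: norm_mult)
    qed
  qed
  then have "(\<lambda>n. \<phi> n ^ n) \<longlonglongrightarrow> exp z" by (rule LIM_zero_cancel)
  then show ?thesis unfolding c z_def .
qed

end

section \<open>Normal limits\<close>

text \<open>Everything is transported from the standard normal law along the affine map with slope
  \<open>sqrt v\<close> and intercept \<open>m\<close>.\<close>

lemma char_normal_law:
  assumes "v > 0"
  shows "real_distribution (normal_law m v)" "char (normal_law m v) t = exp (\<i> * t * m - t\<^sup>2 * v / 2)"
    "integrable (normal_law m v) (\<lambda>z. z\<^sup>2)" "(LINT z|normal_law m v. z\<^sup>2) = m\<^sup>2 + v"
proof -
  interpret N: real_distribution std_normal_distribution by (rule real_dist_normal_dist)
  have s: "sqrt v > 0" using assms by simp
  have "distributed std_normal_distribution lborel (\<lambda>x. x) std_normal_density"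
    by (auto simp: distributed_def distr_id2 cong: distr_cong)
  from N.normal_density_affine[OF this, of "sqrt v" m] s
  have d: "distributed std_normal_distribution lborel (\<lambda>x. m + sqrt v * x) (normal_density m (sqrt v))" by simp
  have "distr std_normal_distribution borel (\<lambda>x. m + sqrt v * x) = distr std_normal_distribution lborel (\<lambda>x. m + sqrt v * x)"
    by (rule distr_cong) auto
  then have L: "normal_law m v = distr std_normal_distribution borel (\<lambda>x. m + sqrt v * x)"
    using d by (simp add: distributed_def normal_law_def)
  show "real_distribution (normal_law m v)" unfolding L by (rule N.real_distribution_distr) simp
  have "char (normal_law m v) t = (CLINT x|std_normal_distribution. iexp (t * (m + sqrt v * x)))"
    unfolding L char_def by (subst integral_distr) auto
  also have "\<dots> = (CLINT x|std_normal_distribution. iexp (t * m) * iexp ((t * sqrt v) * x))"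
    by (intro Bochner_Integration.integral_cong) (auto simp: exp_add[symmetric] algebra_simps)
  also have "\<dots> = iexp (t * m) * char std_normal_distribution (t * sqrt v)"
    unfolding char_def by (intro integral_mult_right_zero)
  also have "\<dots> = exp (\<i> * t * m - t\<^sup>2 * v / 2)"
  proof -
    have "(t * sqrt v)\<^sup>2 = t\<^sup>2 * v" using assms by (simp add: power_mult_distrib)
    then have "char std_normal_distribution (t * sqrt v) = exp (complex_of_real (- (t\<^sup>2 * v) / 2))"
      by (simp only: char_std_normal_distribution exp_of_real)
    also have "iexp (t * m) * \<dots> = exp (\<i> * t * m - t\<^sup>2 * v / 2)"
      unfolding exp_add[symmetric] by (simp add: mult.assoc)
    finally show ?thesis .
  qed
  finally show "char (normal_law m v) t = exp (\<i> * t * m - t\<^sup>2 * v / 2)" .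
  have i: "integrable std_normal_distribution (\<lambda>x. x)" "integrable std_normal_distribution (\<lambda>x. x\<^sup>2)"
    using integrable_std_normal_distribution_moment[of 1] integrable_std_normal_distribution_moment[of 2] by auto
  have sq: "(m + sqrt v * x)\<^sup>2 = m\<^sup>2 + (2 * m * sqrt v) * x + v * x\<^sup>2" for x
    using assms by (simp add: power2_sum power_mult_distrib)
  have ii: "integrable std_normal_distribution (\<lambda>x. m\<^sup>2 + (2 * m * sqrt v) * x + v * x\<^sup>2)"
    by (intro Bochner_Integration.integrable_add integrable_mult_right i N.integrable_const)
  have meas: "(\<lambda>x. m + sqrt v * x) \<in> measurable std_normal_distribution borel" by simp
  show "integrable (normal_law m v) (\<lambda>z. z\<^sup>2)" unfolding L
    by (subst integrable_distr_eq[OF meas]) (simp_all only: sq ii, simp)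
  have "(LINT z|normal_law m v. z\<^sup>2) = (LINT x|std_normal_distribution. m\<^sup>2 + (2 * m * sqrt v) * x + v * x\<^sup>2)"
    unfolding L by (subst integral_distr[OF meas]) (simp_all only: sq, simp)
  also have "\<dots> = m\<^sup>2 + v"
  proof -
    have "(LINT x|std_normal_distribution. x) = 0" "(LINT x|std_normal_distribution. x\<^sup>2) = 1"
      using integral_std_normal_distribution_moment_odd[of 1] std_normal_distribution_even_moments(1)[of 1] by simp_all
    moreover have "(LINT x|std_normal_distribution. m\<^sup>2 + (2 * m * sqrt v) * x + v * x\<^sup>2) =
        (LINT x|std_normal_distribution. m\<^sup>2 + (2 * m * sqrt v) * x) + (LINT x|std_normal_distribution. v * x\<^sup>2)"
      by (rule Bochner_Integration.integral_add)
        (intro Bochner_Integration.integrable_add integrable_mult_right i N.integrable_const)+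
    moreover have "(LINT x|std_normal_distribution. m\<^sup>2 + (2 * m * sqrt v) * x) =
        (LINT x|std_normal_distribution. m\<^sup>2) + (LINT x|std_normal_distribution. (2 * m * sqrt v) * x)"
      by (rule Bochner_Integration.integral_add) (intro integrable_mult_right i N.integrable_const)+
    ultimately show ?thesis
      by (simp only: integral_mult_right_zero lebesgue_integral_const N.prob_space) simp
  qed
  finally show "(LINT z|normal_law m v. z\<^sup>2) = m\<^sup>2 + v" .
qed

text \<open>Slutsky's argument on characteristic functions: \<open>iexp\<close> is bounded and
  Lipschitz, so closeness in probability makes the two characteristic functions close, and Levy's
  continuity theorem concludes.\<close>

lemma (in prob_space) conv_in_distr_normal_of_char:
  assumes S[measurable]: "\<And>n. S n \<in> borel_measurable M" and "v > 0"
    and Z: "\<forall>\<^sub>F n in sequentially. Z n \<in> borel_measurable M"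
    and char: "\<And>t. (\<lambda>n. char (distr M borel (S n)) t) \<longlonglongrightarrow> exp (\<i> * t * m - t\<^sup>2 * v / 2)"
    and close: "((\<lambda>p. Z (fst p) (snd p) - S (fst p) (snd p)) \<longlongrightarrow> 0) (prob_filter M)"
  shows "conv_in_distr M Z (normal_law m v)"
proof -
  \<comment> \<open>\<open>Z n\<close> is known to be measurable only for large \<open>n\<close>;
    the finitely many other terms are replaced by \<open>S n\<close>, which does not affect the
    limit.\<close>
  define Z' where "Z' n = (if Z n \<in> borel_measurable M then Z n else S n)" for n
  have Zm[measurable]: "Z' n \<in> borel_measurable M" for n by (simp add: Z'_def)
  have eq: "\<forall>\<^sub>F n in sequentially. Z' n = Z n" using Z by eventually_elim (simp add: Z'_def)
  have close': "((\<lambda>p. Z' (fst p) (snd p) - S (fst p) (snd p)) \<longlongrightarrow> 0) (prob_filter M)"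
    by (rule Lim_transform_eventually[OF close])
      (rule eventually_mono[OF eventually_fst_prob[OF eq]], simp)
  have "weak_conv_m (\<lambda>n. distr M borel (Z' n)) (normal_law m v)"
  proof (rule levy_continuity)
    fix t :: real
    have d: "(\<lambda>n. char (distr M borel (Z' n)) t - char (distr M borel (S n)) t) \<longlonglongrightarrow> 0"
    proof (rule tendstoI)
      fix e :: real assume "e > 0"
      \<comment> \<open>Off an event of probability \<open>e / 8\<close> the integrand is at most
        \<open>\<bar>t\<bar> * r \<le> e / 4\<close>, and on it at most 2; together at most
        \<open>e / 2\<close>.\<close>
      define r where "r = e / (4 * (\<bar>t\<bar> + 1))"
      have r: "r > 0" "\<bar>t\<bar> * r \<le> e / 4" using \<open>e > 0\<close> by (auto simp: r_def field_simps)
      have "\<forall>\<^sub>F p in prob_filter M. \<bar>Z' (fst p) (snd p) - S (fst p) (snd p)\<bar> < r"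
        using tendstoD[OF close' r(1)] by (simp add: dist_real_def)
      then have "\<forall>\<^sub>F n in sequentially. \<exists>A\<in>sets M. measure M A \<le> e/8 \<and> (\<forall>\<omega>\<in>space M - A. \<bar>Z' n \<omega> - S n \<omega>\<bar> < r)"
        unfolding eventually_prob_filter using \<open>e > 0\<close> by (auto dest!: spec[of _ "e/8"])
      then show "\<forall>\<^sub>F n in sequentially. dist (char (distr M borel (Z' n)) t - char (distr M borel (S n)) t) 0 < e"
      proof eventually_elim
        case (elim n)
        then obtain A where A[measurable]: "A \<in> sets M" and A': "measure M A \<le> e/8" "\<And>\<omega>. \<omega> \<in> space M \<Longrightarrow> \<omega> \<notin> A \<Longrightarrow> \<bar>Z' n \<omega> - S n \<omega>\<bar> < r" by auto
        have ii: "integrable M (\<lambda>\<omega>. iexp (t * Z' n \<omega>))" "integrable M (\<lambda>\<omega>. iexp (t * S n \<omega>))"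
          by (rule integrable_const_bound[where B=1]; simp)+
        have "char (distr M borel (Z' n)) t - char (distr M borel (S n)) t = (CLINT \<omega>|M. iexp (t * Z' n \<omega>) - iexp (t * S n \<omega>))"
          unfolding char_def using ii by (simp add: integral_distr)
        also have "cmod \<dots> \<le> (LINT \<omega>|M. cmod (iexp (t * Z' n \<omega>) - iexp (t * S n \<omega>)))"
          by (rule integral_norm_bound)
        also have "\<dots> \<le> (LINT \<omega>|M. e/4 + 2 * indicator A \<omega>)"
        proof (rule integral_mono)
          show "integrable M (\<lambda>\<omega>. cmod (iexp (t * Z' n \<omega>) - iexp (t * S n \<omega>)))" using ii by auto
          show "integrable M (\<lambda>\<omega>. e/4 + 2 * indicator A \<omega>)" by (auto simp: less_top[symmetric])
          fix \<omega> assume w: "\<omega> \<in> space M"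
          show "cmod (iexp (t * Z' n \<omega>) - iexp (t * S n \<omega>)) \<le> e/4 + 2 * indicator A \<omega>"
          proof (cases "\<omega> \<in> A")
            case True
            have "cmod (iexp (t * Z' n \<omega>) - iexp (t * S n \<omega>)) \<le> 1 + 1"
              by (rule order_trans[OF norm_triangle_ineq4]) simp
            then show ?thesis using True \<open>e > 0\<close> by simp
          next
            case False
            have "iexp (t * Z' n \<omega>) - iexp (t * S n \<omega>) = iexp (t * S n \<omega>) * (iexp (t * (Z' n \<omega> - S n \<omega>)) - 1)"
              by (simp add: algebra_simps flip: exp_add)
            also have "cmod \<dots> = cmod (iexp (t * (Z' n \<omega> - S n \<omega>)) - 1)" by (simp add: norm_mult)
            also have "\<dots> \<le> \<bar>t * (Z' n \<omega> - S n \<omega>)\<bar>" using iexp_approx1[of "t * (Z' n \<omega> - S n \<omega>)" 0] by simp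
            also have "\<dots> \<le> \<bar>t\<bar> * r" unfolding abs_mult using A'(2)[OF w False] by (intro mult_left_mono) auto
            finally show ?thesis using r False by simp
          qed
        qed
        also have "\<dots> = e/4 + 2 * measure M A" by (subst Bochner_Integration.integral_add) (auto simp: prob_space less_top[symmetric])
        also have "\<dots> < e" using A' \<open>e > 0\<close> by simp
        finally show ?case by simp
      qed
    qed
    from tendsto_add[OF d char[of t]]
    show "(\<lambda>n. char (distr M borel (Z' n)) t) \<longlonglongrightarrow> char (normal_law m v) t"
      by (simp add: char_normal_law[OF \<open>v > 0\<close>])
  qed (auto intro: char_normal_law \<open>v > 0\<close>)
  then show ?thesis unfolding conv_in_distr_def weak_conv_m_def weak_conv_def
  proof (intro allI impI)
    fix x assume *: "\<forall>x. isCont (cdf (normal_law m v)) x \<longrightarrow> (\<lambda>n. cdf (distr M borel (Z' n)) x) \<longlonglongrightarrow> cdf (normal_law m v) x"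
      and x: "isCont (cdf (normal_law m v)) x"
    show "(\<lambda>n. cdf (distr M borel (Z n)) x) \<longlonglongrightarrow> cdf (normal_law m v) x"
      by (rule Lim_transform_eventually[OF *[rule_format, OF x]]) (use eq in \<open>eventually_elim, simp\<close>)
  qed
qed

lemma has_asymptotic_mse_normal:
  "conv_in_distr M Z (normal_law m v) \<Longrightarrow> v > 0 \<Longrightarrow> has_asymptotic_mse M Z (m\<^sup>2 + v)"
  unfolding has_asymptotic_mse_def
  by (intro exI[of _ "normal_law m v"]) (simp add: char_normal_law)

section \<open>Order statistics\<close>

text \<open>\<open>g\<close> vanishes at and below the pivot, so the sum over the top ranks extends
  to the whole sample, where sorting no longer matters.\<close>

lemma sum_top_order_stats:
  fixes g :: "real \<Rightarrow> real"
  assumes k: "k < length xs" and g: "\<And>x. x \<le> order_stat xs (length xs - k) \<Longrightarrow> g x = 0"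
  shows "(\<Sum>j=1..k. g (order_stat xs (length xs - j + 1))) = (\<Sum>x\<leftarrow>xs. g x)"
proof -
  define ys where "ys = sort xs"
  let ?n = "length xs"
  have ys: "length ys = ?n" "sorted ys" by (auto simp: ys_def)
  have "(\<Sum>x\<leftarrow>xs. g x) = (\<Sum>x\<leftarrow>ys. g x)"
    unfolding ys_def by (subst (1 2) sum_mset_sum_list[symmetric]) simp
  also have "\<dots> = (\<Sum>i<?n. g (ys ! i))"
    by (simp add: sum_list_sum_nth ys atLeast0LessThan)
  also have "\<dots> = (\<Sum>i\<in>{?n-k..<?n}. g (ys ! i))"
  proof (rule sum.mono_neutral_right)
    show "\<forall>i\<in>{..<?n} - {?n-k..<?n}. g (ys ! i) = 0"
    proof
      fix i assume "i \<in> {..<?n} - {?n-k..<?n}"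
      then have "ys ! i \<le> ys ! (?n - k - 1)" using k by (intro sorted_nth_mono ys) (auto simp: ys)
      then show "g (ys ! i) = 0" by (intro g) (simp add: order_stat_def ys_def)
    qed
  qed auto
  also have "\<dots> = (\<Sum>j=1..k. g (ys ! (?n - j)))"
    by (rule sum.reindex_bij_witness[of _ "\<lambda>j. ?n - j" "\<lambda>i. ?n - i"]) (use k in auto)
  finally show ?thesis using k by (auto simp: order_stat_def ys_def intro!: sum.cong)
qed

text \<open>If entry \<open>i\<close> is at most \<open>c\<close>, only the
  \<open>length ys - 1 - i\<close> later entries can exceed \<open>c\<close>; otherwise entry
  \<open>i\<close> and all later ones do. Positions count from 0.\<close>

lemma length_filter_sorted_gt:
  assumes "sorted ys" "i < length ys"
  shows "length (filter (\<lambda>x. x > c) ys) \<le> length ys - 1 - i \<longleftrightarrow> ys ! i \<le> (c::real)"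
proof
  assume "ys ! i \<le> c"
  then have "filter (\<lambda>x. x > c) ys = filter (\<lambda>x. x > c) (drop (Suc i) ys)"
  proof -
    have "filter (\<lambda>x. x > c) (take (Suc i) ys) = []"
      unfolding filter_empty_conv
    proof
      fix x assume "x \<in> set (take (Suc i) ys)"
      then obtain j where "j < Suc i" "x = ys ! j" by (auto simp: in_set_conv_nth)
      then have "x \<le> ys ! i" using sorted_nth_mono[OF assms(1), of j i] assms(2) by simp
      with \<open>ys ! i \<le> c\<close> show "\<not> x > c" by simp
    qed
    then show ?thesis using filter_append[of _ "take (Suc i) ys" "drop (Suc i) ys"] by simp
  qed
  then show "length (filter (\<lambda>x. x > c) ys) \<le> length ys - 1 - i"
    using length_filter_le[of _ "drop (Suc i) ys"] by simp
next
  assume *: "length (filter (\<lambda>x. x > c) ys) \<le> length ys - 1 - i"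
  show "ys ! i \<le> c"
  proof (rule ccontr)
    assume n: "\<not> ys ! i \<le> c"
    have "filter (\<lambda>x. x > c) (drop i ys) = drop i ys"
      unfolding filter_id_conv
    proof
      fix x assume "x \<in> set (drop i ys)"
      then obtain j where "j < length ys - i" "x = ys ! (i + j)" by (auto simp: in_set_conv_nth)
      then have "ys ! i \<le> x" using sorted_nth_mono[OF assms(1), of i "i + j"] by simp
      with n show "x > c" by simp
    qed
    moreover have "length (filter (\<lambda>x. x > c) (drop i ys)) \<le> length (filter (\<lambda>x. x > c) ys)"
      using arg_cong[OF filter_append[of "\<lambda>x. x > c" "take i ys" "drop i ys"], of length] by simp
    ultimately show False using * assms by simp
  qed
qed

lemma order_stat_le_iff:
  assumes "k < length xs"
  shows "order_stat xs (length xs - k) \<le> c \<longleftrightarrow> length (filter (\<lambda>x. x > c) xs) \<le> k"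
proof -
  have "mset (filter (\<lambda>x. x > c) (sort xs)) = mset (filter (\<lambda>x. x > c) xs)" by (simp add: mset_filter)
  then have "length (filter (\<lambda>x. x > c) (sort xs)) = length (filter (\<lambda>x. x > c) xs)"
    by (metis size_mset)
  \<comment> \<open>Rank \<open>length xs - k\<close> is list position
    \<open>length xs - k - 1\<close>, which leaves exactly \<open>k\<close> later entries.\<close>
  then show ?thesis
    using length_filter_sorted_gt[of "sort xs" "length xs - k - 1" c] assms by (simp add: order_stat_def)
qed

lemma length_filter_map_upt:
  "length (filter P (map f [1..<Suc n])) = card {i\<in>{1..n}. P (f i)}"
proof -
  have "length (filter P (map f [1..<Suc n])) = length (filter (P \<circ> f) [1..<Suc n])" by (simp add: filter_map)
  also have "\<dots> = card (set (filter (P \<circ> f) [1..<Suc n]))" by (intro distinct_card[symmetric]) simp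
  also have "set (filter (P \<circ> f) [1..<Suc n]) = {i\<in>{1..n}. P (f i)}" by auto
  finally show ?thesis .
qed

lemma order_stat_sample:
  assumes "k < n"
  shows "order_stat (map f [1..<Suc n]) (n - k) \<le> c \<longleftrightarrow> card {i\<in>{1..n}. f i > c} \<le> k"
  using order_stat_le_iff[of k "map f [1..<Suc n]" c] assms
  unfolding length_filter_map_upt by simp

lemma card_order_stat:
  assumes "k < n" and V: "V = order_stat (map f [1..<Suc n]) (n - k)"
  shows "card {i\<in>{1..n}. f i > V} \<le> k" "k < card {i\<in>{1..n}. f i \<ge> V}"
proof -
  show "card {i\<in>{1..n}. f i > V} \<le> k" using order_stat_sample[OF assms(1), of f V] V by simp
  show "k < card {i\<in>{1..n}. f i \<ge> V}"
  proof -
    let ?B = "{i\<in>{1..n}. f i < V}"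
    \<comment> \<open>A level below \<open>V\<close> with no observation strictly between: the
      largest sample value below \<open>V\<close>, or \<open>V - 1\<close> if that is larger.
      Exceeding \<open>c\<close> then means reaching \<open>V\<close>.\<close>
    define c where "c = Max (insert (V - 1) (f ` ?B))"
    have "c < V" by (auto simp: c_def)
    moreover have "f i < V \<Longrightarrow> i \<in> {1..n} \<Longrightarrow> f i \<le> c" for i by (auto simp: c_def)
    ultimately have "{i\<in>{1..n}. f i > c} = {i\<in>{1..n}. f i \<ge> V}" by force
    moreover have "\<not> order_stat (map f [1..<Suc n]) (n - k) \<le> c" using \<open>c < V\<close> V by simp
    ultimately show ?thesis using order_stat_sample[OF assms(1), of f c] by simp
  qed
qed

text \<open>Truncation at 1 makes every observation up to the pivot contribute 0, so the excess sum
  runs over all observations and ranks enter only through \<open>V\<close>. Subtracting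
  \<open>g 1\<close> from each term is what achieves this when \<open>g 1 \<noteq> 0\<close>, as for
  powers.\<close>

lemma sum_excess_sample:
  fixes g :: "real \<Rightarrow> real"
  assumes k: "k < n" and V: "V = order_stat (map f [1..<Suc n]) (n - k)" "V > 0"
  shows "(\<Sum>j=1..k. g (rel_excess (map f [1..<Suc n]) k j)) - real k * g 1 = (\<Sum>i=1..n. g (max 1 (f i / V)) - g 1)"
proof -
  let ?xs = "map f [1..<Suc n]"
  have len: "length ?xs = n" by simp
  have Vle: "V \<le> order_stat ?xs (n - j + 1)" if "j \<in> {1..k}" for j
    unfolding V order_stat_def using that k by (intro sorted_nth_mono) auto
  have "(\<Sum>j=1..k. g (rel_excess ?xs k j)) - real k * g 1 = (\<Sum>j=1..k. g (rel_excess ?xs k j) - g 1)"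
    by (simp add: sum_subtractf)
  also have "\<dots> = (\<Sum>j=1..k. (\<lambda>x. g (max 1 (x / V)) - g 1) (order_stat ?xs (length ?xs - j + 1)))"
    unfolding len
  proof (intro sum.cong refl)
    fix j assume "j \<in> {1..k}"
    from Vle[OF this] show "g (rel_excess ?xs k j) - g 1 = (\<lambda>x. g (max 1 (x / V)) - g 1) (order_stat ?xs (n - j + 1))"
      unfolding rel_excess_def len V(1)[symmetric] using V(2) by (simp add: max_def)
  qed
  also have "\<dots> = (\<Sum>x\<leftarrow>?xs. g (max 1 (x / V)) - g 1)"
  proof (rule sum_top_order_stats)
    fix x assume "x \<le> order_stat ?xs (length ?xs - k)"
    then have "x / V \<le> 1" using V unfolding len by simp
    then show "g (max 1 (x / V)) - g 1 = 0" by (simp add: max_def)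
  qed (use k in auto)
  also have "\<dots> = (\<Sum>i=1..n. g (max 1 (f i / V)) - g 1)"
    by (simp add: sum_list_sum_nth del: upt_Suc) (rule sum.reindex_bij_witness[of _ "\<lambda>i. i - 1" Suc], auto simp del: upt_Suc)
  finally show ?thesis .
qed

lemma hill_sample:
  assumes k: "0 < k" "k < n" and V: "V = order_stat (map f [1..<Suc n]) (n - k)" "V > 0"
  shows "hill (map f [1..<Suc n]) k = (\<Sum>i=1..n. ln (max 1 (f i / V))) / real k"
  using sum_excess_sample[OF k(2) V, of ln] k by (simp add: hill_def)

lemma E_stat_sample:
  assumes k: "0 < k" "k < n" and V: "V = order_stat (map f [1..<Suc n]) (n - k)" "V > 0"
  shows "E_stat (map f [1..<Suc n]) k s = 1 + (\<Sum>i=1..n. max 1 (f i / V) powr s - 1) / real k"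
  using sum_excess_sample[OF k(2) V, of "\<lambda>x. x powr s"] k by (simp add: E_stat_def field_simps)

text \<open>Termwise comparison with indicators. At least \<open>k\<close> of the \<open>x i\<close> are \<open>\<ge> V\<close> and at most \<open>k\<close> exceed \<open>V\<close>, so that
  ties at the order statistic \<open>V\<close> do no harm.\<close>

lemma threshold_change:
  fixes \<Phi> x :: "_ \<Rightarrow> real"
  assumes mono: "\<And>a b. 0 < a \<Longrightarrow> a \<le> b \<Longrightarrow> \<Phi> a \<le> \<Phi> b" and V: "V > 0" and fin: "finite I"
    and c: "card {i\<in>I. x i > V} \<le> k" "k \<le> card {i\<in>I. x i \<ge> V}"
  shows "\<bar>(\<Sum>i\<in>I. \<Phi> (max 1 (x i)) - \<Phi> 1) - (\<Sum>i\<in>I. \<Phi> (max V (x i)) - \<Phi> V) - real k * (\<Phi> V - \<Phi> 1)\<bar>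
    \<le> \<bar>real (card {i\<in>I. x i > 1}) - real k\<bar> * \<bar>\<Phi> V - \<Phi> 1\<bar>"
proof -
  let ?d = "\<lambda>i. (\<Phi> (max 1 (x i)) - \<Phi> 1) - (\<Phi> (max V (x i)) - \<Phi> V)"
  have card_sum: "real (card {i\<in>I. P i}) * e = (\<Sum>i\<in>I. if P i then e else 0)" for P e
    using fin by (simp add: sum.If_cases Int_def)
  have D: "(\<Sum>i\<in>I. \<Phi> (max 1 (x i)) - \<Phi> 1) - (\<Sum>i\<in>I. \<Phi> (max V (x i)) - \<Phi> V) = sum ?d I"
    by (simp add: sum_subtractf)
  show ?thesis
  proof (cases "V \<ge> 1")
    case True
    then have d: "\<Phi> V - \<Phi> 1 \<ge> 0" using mono[of 1 V] by simp
    have b: "(if x i \<ge> V then \<Phi> V - \<Phi> 1 else 0) \<le> ?d i \<and> ?d i \<le> (if x i > 1 then \<Phi> V - \<Phi> 1 else 0)" for i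
      using True d mono[of 1 "x i"] mono[of "x i" V] by (auto simp: max_def)
    have "real (card {i\<in>I. x i \<ge> V}) * (\<Phi> V - \<Phi> 1) \<le> sum ?d I"
         "sum ?d I \<le> real (card {i\<in>I. x i > 1}) * (\<Phi> V - \<Phi> 1)"
      unfolding card_sum using b by (auto intro!: sum_mono)
    moreover have "real k * (\<Phi> V - \<Phi> 1) \<le> real (card {i\<in>I. x i \<ge> V}) * (\<Phi> V - \<Phi> 1)"
      using c d by (intro mult_right_mono) auto
    ultimately have "0 \<le> sum ?d I - real k * (\<Phi> V - \<Phi> 1)"
      "sum ?d I - real k * (\<Phi> V - \<Phi> 1) \<le> (real (card {i\<in>I. x i > 1}) - real k) * (\<Phi> V - \<Phi> 1)"
      by (auto simp: algebra_simps)
    then show ?thesis unfolding D abs_mult[symmetric] by linarith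
  next
    case False
    then have d: "\<Phi> 1 - \<Phi> V \<ge> 0" using mono[of V 1] V by simp
    have b: "(if x i > 1 then \<Phi> 1 - \<Phi> V else 0) \<le> - ?d i \<and> - ?d i \<le> (if x i > V then \<Phi> 1 - \<Phi> V else 0)" for i
      using False d V mono[of V "x i"] mono[of "x i" 1] by (auto simp: max_def)
    have "real (card {i\<in>I. x i > 1}) * (\<Phi> 1 - \<Phi> V) \<le> - sum ?d I"
         "- sum ?d I \<le> real (card {i\<in>I. x i > V}) * (\<Phi> 1 - \<Phi> V)"
      unfolding card_sum sum_negf[symmetric] using b by (auto intro!: sum_mono)
    moreover have "real (card {i\<in>I. x i > V}) * (\<Phi> 1 - \<Phi> V) \<le> real k * (\<Phi> 1 - \<Phi> V)"
      using c d by (intro mult_right_mono) auto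
    ultimately have "0 \<le> sum ?d I - real k * (\<Phi> V - \<Phi> 1)"
      "sum ?d I - real k * (\<Phi> V - \<Phi> 1) \<le> (real (card {i\<in>I. x i > 1}) - real k) * (\<Phi> V - \<Phi> 1)"
      by (auto simp: algebra_simps)
    then show ?thesis unfolding D abs_mult[symmetric] by linarith
  qed
qed

section \<open>Exceedances over a deterministic threshold\<close>

text \<open>The integral of \<open>exp (s * y)\<close> over \<open>0 \<le> y \<le> z\<close>, with
  its continuous value at \<open>s = 0\<close>. For a log excess \<open>z\<close>,
  \<open>s = 0\<close> gives the summand of the Hill estimator and \<open>s < 0\<close> that of the
  power mean, so one family covers both.\<close>

definition kap :: "real \<Rightarrow> real \<Rightarrow> real" where
  "kap s z = (if s = 0 then z else (exp (s * z) - 1) / s)"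

text \<open>Factor out the larger exponential, which is at most 1, and use
  \<open>1 - exp (- x) \<le> x\<close>. This is the source of the Lipschitz bound that later admits
  a random exponent.\<close>

lemma exp_diff_bound:
  fixes s s' y :: real
  assumes "s \<le> 0" "s' \<le> 0" "y \<ge> 0"
  shows "\<bar>exp (s * y) - exp (s' * y)\<bar> \<le> \<bar>s - s'\<bar> * y"
proof -
  have *: "\<bar>exp (a * y) - exp (b * y)\<bar> \<le> \<bar>a - b\<bar> * y" if "a \<le> b" "b \<le> 0" for a b
  proof -
    have "exp (b * y) - exp (a * y) = exp (b * y) * (1 - exp ((a - b) * y))"
      by (simp add: algebra_simps flip: exp_add)
    also have "\<dots> \<le> 1 * (1 - exp ((a - b) * y))"
      using that assms(3) by (intro mult_right_mono) (auto simp: mult_nonpos_nonneg)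
    also have "\<dots> \<le> (b - a) * y" using exp_ge_add_one_self[of "(a - b) * y"] by (simp add: algebra_simps)
    finally have "exp (b * y) - exp (a * y) \<le> (b - a) * y" .
    moreover have "exp (a * y) \<le> exp (b * y)" using that assms(3) by (simp add: mult_right_mono)
    ultimately show ?thesis using that by simp
  qed
  show ?thesis
  proof (cases "s \<le> s'")
    case False
    then show ?thesis using *[of s' s] assms by (simp add: abs_minus_commute)
  qed (use *[of s s'] assms in simp)
qed

text \<open>\<open>d n y\<close> is the relative deviation of the scaled tail from its exponential
  limit at the log level \<open>y\<close>. \<open>d_bound\<close> dominates integrals over
  \<open>y \<ge> 0\<close>, \<open>d_lim\<close> yields the bias, and \<open>d_loc\<close> concerns
  levels of order \<open>1 / sqrt k\<close> of either sign, where the random threshold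
  falls.\<close>

locale tail_array = prob_space M for M :: "'a measure" +
  fixes X :: "nat \<Rightarrow> 'a \<Rightarrow> real" and F :: "real \<Rightarrow> real" and \<xi> \<tau> lam K :: real
    and k :: "nat \<Rightarrow> nat" and t :: "nat \<Rightarrow> real" and d :: "nat \<Rightarrow> real \<Rightarrow> real"
  assumes indep: "indep_vars (\<lambda>_. borel) X UNIV"
    and cdf_X: "\<And>i. cdf (distr M borel (X i)) = F"
    and xi_pos: "\<xi> > 0" and tau_neg: "\<tau> < 0"
    and k_top: "filterlim k at_top sequentially"
    and k_less: "\<forall>\<^sub>F n in sequentially. k n < n"
    and t_pos: "\<forall>\<^sub>F n in sequentially. t n > 0"
    and tail: "\<forall>\<^sub>F n in sequentially. \<forall>y. real n / real (k n) * (1 - F (t n * exp y)) = exp (- y / \<xi>) * (1 + d n y)"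
    and d_bound: "\<forall>\<^sub>F n in sequentially. \<forall>y\<ge>0. sqrt (real (k n)) * \<bar>d n y\<bar> \<le> K"
    and d_lim: "\<And>y. y \<ge> 0 \<Longrightarrow> (\<lambda>n. sqrt (real (k n)) * d n y) \<longlonglongrightarrow> lam / \<xi> * exp (\<tau> * y)"
    and d_loc: "\<And>y. (\<lambda>n. sqrt (real (k n)) * d n (y / sqrt (real (k n)))) \<longlonglongrightarrow> lam / \<xi>"
begin

definition N :: "nat \<Rightarrow> real \<Rightarrow> 'a \<Rightarrow> real" where
  "N n y \<omega> = real (card {i\<in>{1..n}. X i \<omega> > t n * exp y})"

text \<open>Tail empirical process, centred at the limiting tail instead of its own mean, so that it
  carries the bias as well as the fluctuation.\<close>

definition T :: "nat \<Rightarrow> real \<Rightarrow> 'a \<Rightarrow> real" where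
  "T n y \<omega> = sqrt (real (k n)) * (N n y \<omega> / real (k n) - exp (- y / \<xi>))"

definition Z :: "nat \<Rightarrow> nat \<Rightarrow> 'a \<Rightarrow> real" where
  "Z n i \<omega> = ln (max 1 (X i \<omega> / t n))"

text \<open>The centring \<open>\<xi> / (1 - \<xi> * s)\<close> is the integral of
  \<open>exp (s * y) * exp (- y / \<xi>)\<close> over \<open>y \<ge> 0\<close>.\<close>

definition \<Theta> :: "nat \<Rightarrow> real \<Rightarrow> 'a \<Rightarrow> real" where
  "\<Theta> n s \<omega> = sqrt (real (k n)) * ((\<Sum>i=1..n. kap s (Z n i \<omega>)) / real (k n) - \<xi> / (1 - \<xi> * s))"

text \<open>One majorant for all exponents \<open>s \<le> 0\<close>: \<open>exp (s * y)\<close> is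
  at most 1 and its dependence on \<open>s\<close> is Lipschitz with constant \<open>y\<close>,
  hence the weight \<open>1 + y\<close>.\<close>

definition R :: "nat \<Rightarrow> 'a \<Rightarrow> real" where
  "R n \<omega> = (LINT y|lborel. indicator {0..} y * (\<bar>T n y \<omega>\<bar> * (1 + y)))"

lemma rv_X[measurable]: "X i \<in> borel_measurable M"
  using indep by (simp add: indep_vars_def2)

lemma k_pos: "\<forall>\<^sub>F n in sequentially. k n > 0"
  by (rule eventually_compose_filterlim[OF eventually_gt_at_top k_top])

lemma sqrt_k_top: "filterlim (\<lambda>n. sqrt (real (k n))) at_top sequentially"
  by (rule sqrt_nat_at_top[OF k_top])

lemma inv_sqrt_k: "(\<lambda>n. 1 / sqrt (real (k n))) \<longlonglongrightarrow> 0"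
  by (rule tendsto_divide_0[OF tendsto_const filterlim_at_top_imp_at_infinity[OF sqrt_k_top]])

lemma prob_greater: "prob {\<omega>\<in>space M. X i \<omega> > c} = 1 - F c"
proof -
  have "F c = prob {\<omega>\<in>space M. X i \<omega> \<le> c}"
    unfolding cdf_X[of i, symmetric] cdf_def by (subst measure_distr) (auto intro!: arg_cong[where f=prob])
  also have "\<dots> = prob (space M - {\<omega>\<in>space M. X i \<omega> > c})" by (rule arg_cong[where f=prob]) auto
  also have "\<dots> = 1 - prob {\<omega>\<in>space M. X i \<omega> > c}" by (rule prob_compl) simp
  finally show ?thesis by simp
qed

lemma prob_Ioc:
  assumes "a \<le> b"
  shows "prob {\<omega>\<in>space M. X i \<omega> \<in> {a<..b}} = F b - F a"
proof -
  have "prob {\<omega>\<in>space M. X i \<omega> > a} = prob ({\<omega>\<in>space M. X i \<omega> \<in> {a<..b}} \<union> {\<omega>\<in>space M. X i \<omega> > b})"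
    using assms by (intro arg_cong[where f=prob]) auto
  also have "\<dots> = prob {\<omega>\<in>space M. X i \<omega> \<in> {a<..b}} + prob {\<omega>\<in>space M. X i \<omega> > b}"
    by (rule finite_measure_Union) auto
  finally show ?thesis by (simp add: prob_greater)
qed

lemma N_sum: "N n y \<omega> = (\<Sum>i=1..n. indicator {t n * exp y<..} (X i \<omega>))"
  by (simp add: N_def indicator_def sum.If_cases Int_def)

lemma N_diff:
  assumes "a \<le> b" "t n > 0"
  shows "N n a \<omega> - N n b \<omega> = (\<Sum>i=1..n. indicator {t n * exp a<..t n * exp b} (X i \<omega>))"
proof -
  have "t n * exp a \<le> t n * exp b" using assms by simp
  then show ?thesis unfolding N_sum sum_subtractf[symmetric]
    by (intro sum.cong) (auto simp: indicator_def)
qed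

lemma N_meas[measurable]: "(\<lambda>(y, \<omega>). N n y \<omega>) \<in> borel_measurable (lborel \<Otimes>\<^sub>M M)"
proof -
  have "N n y \<omega> = (\<Sum>i=1..n. if X i \<omega> > t n * exp y then 1 else 0)" for y \<omega>
    unfolding N_sum by (intro sum.cong) (auto simp: indicator_def)
  then show ?thesis by simp
qed

lemma T_meas[measurable]: "(\<lambda>(y, \<omega>). T n y \<omega>) \<in> borel_measurable (lborel \<Otimes>\<^sub>M M)"
  unfolding T_def by measurable

lemma N_meas2[measurable]: "N n y \<in> borel_measurable M"
  unfolding N_sum[abs_def] by measurable

lemma T_meas2[measurable]: "T n y \<in> borel_measurable M"
  unfolding T_def[abs_def] by measurable

lemma T_meas3[measurable]: "(\<lambda>y. T n y \<omega>) \<in> borel_measurable lborel"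
proof -
  have "N n y \<omega> = (\<Sum>i=1..n. if X i \<omega> > t n * exp y then 1 else 0)" for y
    unfolding N_sum by (intro sum.cong) (auto simp: indicator_def)
  then show ?thesis unfolding T_def by simp
qed

lemma R_meas[measurable]: "R n \<in> borel_measurable M"
proof -
  have [measurable]: "(\<lambda>(\<omega>, y). T n y \<omega>) \<in> borel_measurable (M \<Otimes>\<^sub>M lborel)"
    using measurable_pair_swap[OF T_meas[of n]] by (simp add: case_prod_beta')
  show ?thesis unfolding R_def[abs_def] by measurable
qed

lemma N_bounds: "0 \<le> N n y \<omega>" "N n y \<omega> \<le> real n"
proof -
  have "card {i\<in>{1..n}. X i \<omega> > t n * exp y} \<le> card {1..n}" by (rule card_mono) auto
  then show "0 \<le> N n y \<omega>" "N n y \<omega> \<le> real n" by (auto simp: N_def)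
qed

lemma T_second_moment:
  "\<exists>C>0. \<forall>\<^sub>F n in sequentially. \<forall>y\<ge>0. expectation (\<lambda>\<omega>. (T n y \<omega>)\<^sup>2) \<le> C * exp (- y / \<xi>)"
proof (intro exI conjI)
  \<comment> \<open>\<open>T\<close> splits into a centred count and a bias, and the square of a sum
    costs a factor 2: the variance contributes \<open>1 + \<bar>K\<bar>\<close>, the bias
    \<open>K\<^sup>2\<close>.\<close>
  define C where "C = 2 * (1 + \<bar>K\<bar> + K\<^sup>2)"
  show "C > 0" by (auto simp: C_def intro!: add_pos_nonneg)
  show "\<forall>\<^sub>F n in sequentially. \<forall>y\<ge>0. expectation (\<lambda>\<omega>. (T n y \<omega>)\<^sup>2) \<le> C * exp (- y / \<xi>)"
    using k_pos k_less tail d_bound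
  proof eventually_elim
    case (elim n)
    show ?case
    proof (intro allI impI)
      fix y :: real assume y: "y \<ge> 0"
      define q where "q = 1 - F (t n * exp y)"
      have kp: "real (k n) \<ge> 1" "real n > 0" using elim by auto
      have nq: "real n * q = real (k n) * (exp (- y / \<xi>) * (1 + d n y))"
        using elim(3)[rule_format, of y] kp by (simp add: q_def field_simps)
      have q01: "0 \<le> q" "q \<le> 1" using prob_greater[of "t n * exp y" 0] by (auto simp: q_def[symmetric] measure_nonneg)
      have sd: "sqrt (real (k n)) * \<bar>d n y\<bar> \<le> K" using elim y by blast
      have "1 * \<bar>d n y\<bar> \<le> sqrt (real (k n)) * \<bar>d n y\<bar>" using kp by (intro mult_right_mono) auto
      with sd have dK: "d n y \<le> \<bar>K\<bar>" by simp
      have e1: "exp (- y / \<xi>) \<le> 1" using y xi_pos by simp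
      let ?A = "\<lambda>\<omega>. (N n y \<omega> - real n * q)" and ?b = "exp (- y / \<xi>) * (sqrt (real (k n)) * d n y)"
      have aux: "r * (u / (r * r) - e) = (u - r * r * e) / r" "r * r * e * f / r = e * (r * f)" if "r > 0" for r u e f :: real
        using that by (auto simp: field_simps)
      have Tdec: "T n y \<omega> = ?A \<omega> / sqrt (real (k n)) + ?b" for \<omega>
      proof -
        have "T n y \<omega> = (N n y \<omega> - real (k n) * exp (- y / \<xi>)) / sqrt (real (k n))"
          using aux(1)[of "sqrt (real (k n))" "N n y \<omega>" "exp (- y / \<xi>)"] kp by (simp add: T_def)
        also have "\<dots> = ?A \<omega> / sqrt (real (k n)) + real (k n) * exp (- y / \<xi>) * d n y / sqrt (real (k n))"
          unfolding nq by (simp add: diff_divide_distrib add_divide_distrib algebra_simps)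
        also have "real (k n) * exp (- y / \<xi>) * d n y / sqrt (real (k n)) = ?b"
          using aux(2)[of "sqrt (real (k n))" "exp (- y / \<xi>)" "d n y"] kp by simp
        finally show ?thesis .
      qed
      have intA: "integrable M (\<lambda>\<omega>. (?A \<omega>)\<^sup>2)"
      proof (rule integrable_const_bound[where B="(real n)\<^sup>2"])
        have "0 \<le> real n * q" "real n * q \<le> real n" using q01 by (auto simp: mult_left_le)
        then have "\<bar>?A \<omega>\<bar> \<le> real n" for \<omega>
          using N_bounds[of n y \<omega>] by linarith
        then show "AE \<omega> in M. norm ((?A \<omega>)\<^sup>2) \<le> (real n)\<^sup>2"
          by (auto intro!: AE_I2 power2_le_iff_abs_le[THEN iffD2])
      qed auto
      have eA: "expectation (\<lambda>\<omega>. (?A \<omega>)\<^sup>2) = real n * (q * (1 - q))"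
        using count_second_moment[OF indep_vars_subset[OF indep, of "{1..n}"], where B="{t n * exp y<..}" and q=q] prob_greater
        by (simp add: N_sum q_def)
      have "expectation (\<lambda>\<omega>. (T n y \<omega>)\<^sup>2) \<le> expectation (\<lambda>\<omega>. 2 / real (k n) * (?A \<omega>)\<^sup>2 + 2 * ?b\<^sup>2)"
      proof (rule integral_mono_AE')
        show "AE \<omega> in M. (T n y \<omega>)\<^sup>2 \<le> 2 / real (k n) * (?A \<omega>)\<^sup>2 + 2 * ?b\<^sup>2"
        proof (rule AE_I2)
          fix \<omega>
          have "(u + v)\<^sup>2 \<le> 2 * u\<^sup>2 + 2 * v\<^sup>2" for u v :: real
            using sum_squares_bound[of u v] by (simp add: power2_sum)
          from this[of "?A \<omega> / sqrt (real (k n))" ?b] show "(T n y \<omega>)\<^sup>2 \<le> 2 / real (k n) * (?A \<omega>)\<^sup>2 + 2 * ?b\<^sup>2"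
            unfolding Tdec by (simp add: power_divide)
        qed
        show "integrable M (\<lambda>\<omega>. 2 / real (k n) * (?A \<omega>)\<^sup>2 + 2 * ?b\<^sup>2)"
          by (intro Bochner_Integration.integrable_add integrable_mult_right intA integrable_const)
      qed auto
      also have "\<dots> = 2 / real (k n) * (real n * (q * (1 - q))) + 2 * ?b\<^sup>2"
        using intA by (subst Bochner_Integration.integral_add) (auto simp: eA prob_space)
      also have "\<dots> \<le> 2 * (exp (- y / \<xi>) * (1 + \<bar>K\<bar>)) + 2 * (exp (- y / \<xi>) * K\<^sup>2)"
      proof (intro add_mono mult_left_mono)
        have "real n * (q * (1 - q)) \<le> real n * q" using q01 kp by (simp add: mult_left_le)
        also have "\<dots> \<le> real (k n) * (exp (- y / \<xi>) * (1 + \<bar>K\<bar>))"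
          unfolding nq using dK by (intro mult_left_mono) auto
        finally have "2 / real (k n) * (real n * (q * (1 - q))) \<le> 2 / real (k n) * (real (k n) * (exp (- y / \<xi>) * (1 + \<bar>K\<bar>)))"
          by (intro mult_left_mono) auto
        then show "2 / real (k n) * (real n * (q * (1 - q))) \<le> 2 * (exp (- y / \<xi>) * (1 + \<bar>K\<bar>))"
          using kp by simp
        have "?b\<^sup>2 = (exp (- y / \<xi>))\<^sup>2 * (sqrt (real (k n)) * \<bar>d n y\<bar>)\<^sup>2" by (simp add: power_mult_distrib)
        also have "\<dots> \<le> exp (- y / \<xi>) * K\<^sup>2"
          using sd e1 by (intro mult_mono power_mono) (auto simp: power2_eq_square mult_left_le)
        finally show "?b\<^sup>2 \<le> exp (- y / \<xi>) * K\<^sup>2" .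
      qed auto
      also have "\<dots> = C * exp (- y / \<xi>)" by (simp add: C_def algebra_simps)
      finally show "expectation (\<lambda>\<omega>. (T n y \<omega>)\<^sup>2) \<le> C * exp (- y / \<xi>)" .
    qed
  qed
qed

lemma T_square_integrable: "integrable M (\<lambda>\<omega>. (T n y \<omega>)\<^sup>2)"
proof (rule integrable_const_bound[where B="(sqrt (real (k n)) * (real n / real (k n) + exp (- y / \<xi>)))\<^sup>2"])
  have "\<bar>T n y \<omega>\<bar> \<le> sqrt (real (k n)) * (real n / real (k n) + exp (- y / \<xi>))" for \<omega>
  proof -
    have "0 \<le> N n y \<omega> / real (k n)" "N n y \<omega> / real (k n) \<le> real n / real (k n)"
      using N_bounds[of n y \<omega>] by (auto intro: divide_right_mono)
    then have "\<bar>N n y \<omega> / real (k n) - exp (- y / \<xi>)\<bar> \<le> real n / real (k n) + exp (- y / \<xi>)"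
      using exp_gt_zero[of "- y / \<xi>"] unfolding abs_le_iff by linarith
    then show ?thesis unfolding T_def abs_mult by (simp add: mult_left_mono)
  qed
  then show "AE \<omega> in M. norm ((T n y \<omega>)\<^sup>2) \<le> (sqrt (real (k n)) * (real n / real (k n) + exp (- y / \<xi>)))\<^sup>2"
    by (auto intro!: AE_I2 power2_le_iff_abs_le[THEN iffD2])
qed simp

text \<open>From \<open>\<bar>T\<bar> \<le> T\<^sup>2 / a + a\<close> with
  \<open>a = exp (- y / (2 * \<xi>))\<close>: this choice balances the two terms and keeps an
  exponential rate in \<open>y\<close>, half of the one for the second moment.\<close>

lemma T_abs_moment:
  "\<exists>C>0. \<forall>\<^sub>F n in sequentially. \<forall>y\<ge>0. (\<integral>\<^sup>+\<omega>. ennreal \<bar>T n y \<omega>\<bar> \<partial>M) \<le> ennreal (C * exp (- y / (2 * \<xi>)))"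
proof -
  obtain C where C: "C > 0" "\<forall>\<^sub>F n in sequentially. \<forall>y\<ge>0. expectation (\<lambda>\<omega>. (T n y \<omega>)\<^sup>2) \<le> C * exp (- y / \<xi>)"
    using T_second_moment by blast
  show ?thesis
  proof (intro exI conjI)
    show "C + 1 > 0" using C by simp
    show "\<forall>\<^sub>F n in sequentially. \<forall>y\<ge>0. (\<integral>\<^sup>+\<omega>. ennreal \<bar>T n y \<omega>\<bar> \<partial>M) \<le> ennreal ((C + 1) * exp (- y / (2 * \<xi>)))"
      using C(2)
    proof (eventually_elim, intro allI impI)
      fix n and y :: real assume *: "\<forall>y\<ge>0. expectation (\<lambda>\<omega>. (T n y \<omega>)\<^sup>2) \<le> C * exp (- y / \<xi>)" and y: "y \<ge> 0"
      define a where "a = exp (- y / (2 * \<xi>))"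
      have a: "a > 0" "a * a = exp (- y / \<xi>)" by (auto simp: a_def simp flip: exp_add)
      have "(\<integral>\<^sup>+\<omega>. ennreal \<bar>T n y \<omega>\<bar> \<partial>M) \<le> (\<integral>\<^sup>+\<omega>. ennreal (1 / a * (T n y \<omega>)\<^sup>2 + a) \<partial>M)"
      proof (intro nn_integral_mono ennreal_leI)
        fix \<omega>
        have "2 * \<bar>T n y \<omega>\<bar> * a \<le> (T n y \<omega>)\<^sup>2 + a\<^sup>2" using sum_squares_bound[of "\<bar>T n y \<omega>\<bar>" a] by simp
        moreover have "0 \<le> (T n y \<omega>)\<^sup>2 + a\<^sup>2" by simp
        ultimately have "\<bar>T n y \<omega>\<bar> * a \<le> (T n y \<omega>)\<^sup>2 + a\<^sup>2" by linarith
        then show "\<bar>T n y \<omega>\<bar> \<le> 1 / a * (T n y \<omega>)\<^sup>2 + a" using a by (simp add: field_simps power2_eq_square)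
      qed
      also have "\<dots> = ennreal (expectation (\<lambda>\<omega>. 1 / a * (T n y \<omega>)\<^sup>2 + a))"
        using T_square_integrable[of n y] a
        by (intro nn_integral_eq_integral Bochner_Integration.integrable_add integrable_mult_right) auto
      also have "\<dots> = ennreal (1 / a * expectation (\<lambda>\<omega>. (T n y \<omega>)\<^sup>2) + a)"
        using T_square_integrable[of n y] by (subst Bochner_Integration.integral_add) (auto simp: prob_space)
      also have "\<dots> \<le> ennreal (1 / a * (C * (a * a)) + a)"
        using *[rule_format, OF y] a by (intro ennreal_leI add_mono mult_left_mono) auto
      also have "1 / a * (C * (a * a)) + a = (C + 1) * a" using a by (simp add: field_simps)
      finally show "(\<integral>\<^sup>+\<omega>. ennreal \<bar>T n y \<omega>\<bar> \<partial>M) \<le> ennreal ((C + 1) * exp (- y / (2 * \<xi>)))" by (simp add: a_def)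
    qed
  qed
qed

lemma T0_tight: "tight M (\<lambda>p. T (fst p) 0 (snd p))"
proof -
  obtain C where C: "\<forall>\<^sub>F n in sequentially. \<forall>y\<ge>0. (\<integral>\<^sup>+\<omega>. ennreal \<bar>T n y \<omega>\<bar> \<partial>M) \<le> ennreal (C * exp (- y / (2 * \<xi>)))"
    using T_abs_moment by blast
  show ?thesis
    by (rule tight_moment[where C=C]) (use C in \<open>auto elim!: eventually_mono dest: spec[of _ 0]\<close>)
qed

text \<open>Tonelli moves the expectation inside the level integral, where the exponential rate of
  \<open>T_abs_moment\<close> beats the weight \<open>1 + y\<close>.\<close>

lemma R_tight: "tight M (\<lambda>p. R (fst p) (snd p))"
proof -
  interpret P: pair_sigma_finite lborel M ..
  obtain C where C: "C > 0" "\<forall>\<^sub>F n in sequentially. \<forall>y\<ge>0. (\<integral>\<^sup>+\<omega>. ennreal \<bar>T n y \<omega>\<bar> \<partial>M) \<le> ennreal (C * exp (- y / (2 * \<xi>)))"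
    using T_abs_moment by blast
  have bi: "has_bochner_integral lborel (\<lambda>y. C * (indicator {0..} y * exp (- (1 / (2 * \<xi>)) * y)) + C * (indicator {0..} y * (y ^ 1 * exp (- (1 / (2 * \<xi>)) * y))))
     (C * (1 / (1 / (2 * \<xi>))) + C * (fact 1 / (1 / (2 * \<xi>)) ^ Suc 1))"
    by (intro has_bochner_integral_add has_bochner_integral_mult_right has_bochner_integral_exp has_bochner_integral_power_exp)
      (use xi_pos in auto)
  show ?thesis
  proof (rule tight_moment)
    show "\<forall>\<^sub>F n in sequentially. (\<integral>\<^sup>+\<omega>. ennreal \<bar>R n \<omega>\<bar> \<partial>M) \<le> ennreal (C * (1 / (1 / (2 * \<xi>))) + C * (fact 1 / (1 / (2 * \<xi>)) ^ Suc 1))"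
      using C(2)
    proof eventually_elim
      case (elim n)
      have "(\<integral>\<^sup>+\<omega>. ennreal \<bar>R n \<omega>\<bar> \<partial>M) \<le> (\<integral>\<^sup>+\<omega>. \<integral>\<^sup>+y. ennreal (indicator {0..} y * (\<bar>T n y \<omega>\<bar> * (1 + y))) \<partial>lborel \<partial>M)"
      proof (rule nn_integral_mono)
        fix \<omega>
        show "ennreal \<bar>R n \<omega>\<bar> \<le> (\<integral>\<^sup>+y. ennreal (indicator {0..} y * (\<bar>T n y \<omega>\<bar> * (1 + y))) \<partial>lborel)"
        proof (cases "integrable lborel (\<lambda>y. indicator {0..} y * (\<bar>T n y \<omega>\<bar> * (1 + y)))")
          case True
          have "ennreal \<bar>R n \<omega>\<bar> \<le> (\<integral>\<^sup>+y. ennreal (norm (indicator {0..} y * (\<bar>T n y \<omega>\<bar> * (1 + y)))) \<partial>lborel)"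
            using integral_norm_bound_ennreal[OF True] by (simp add: R_def)
          also have "\<dots> = (\<integral>\<^sup>+y. ennreal (indicator {0..} y * (\<bar>T n y \<omega>\<bar> * (1 + y))) \<partial>lborel)"
            by (intro nn_integral_cong) (auto split: split_indicator)
          finally show ?thesis .
        next
          \<comment> \<open>A non-integrable path gives the Bochner integral \<open>R\<close> its
            default value 0, so the bound is trivial.\<close>
          case False
          then show ?thesis by (simp add: R_def not_integrable_integral_eq)
        qed
      qed
      also have "\<dots> = (\<integral>\<^sup>+y. \<integral>\<^sup>+\<omega>. ennreal (indicator {0..} y * (\<bar>T n y \<omega>\<bar> * (1 + y))) \<partial>M \<partial>lborel)"
        by (rule P.Fubini') measurable
      also have "\<dots> \<le> (\<integral>\<^sup>+y. ennreal (C * (indicator {0..} y * exp (- (1 / (2 * \<xi>)) * y)) + C * (indicator {0..} y * (y ^ 1 * exp (- (1 / (2 * \<xi>)) * y)))) \<partial>lborel)"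
      proof (rule nn_integral_mono)
        fix y :: real
        show "(\<integral>\<^sup>+\<omega>. ennreal (indicator {0..} y * (\<bar>T n y \<omega>\<bar> * (1 + y))) \<partial>M) \<le>
          ennreal (C * (indicator {0..} y * exp (- (1 / (2 * \<xi>)) * y)) + C * (indicator {0..} y * (y ^ 1 * exp (- (1 / (2 * \<xi>)) * y))))"
        proof (cases "y \<ge> 0")
          case True
          then have "(\<integral>\<^sup>+\<omega>. ennreal (indicator {0..} y * (\<bar>T n y \<omega>\<bar> * (1 + y))) \<partial>M) = (\<integral>\<^sup>+\<omega>. ennreal (1 + y) * ennreal \<bar>T n y \<omega>\<bar> \<partial>M)"
            by (intro nn_integral_cong) (simp add: ennreal_mult'[symmetric] mult.commute del: ennreal_plus)
          also have "\<dots> = ennreal (1 + y) * (\<integral>\<^sup>+\<omega>. ennreal \<bar>T n y \<omega>\<bar> \<partial>M)" by (rule nn_integral_cmult) measurable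
          also have "\<dots> \<le> ennreal (1 + y) * ennreal (C * exp (- y / (2 * \<xi>)))" using elim True by (intro mult_left_mono) auto
          also have "\<dots> = ennreal ((1 + y) * (C * exp (- y / (2 * \<xi>))))" using True C by (simp add: ennreal_mult)
          also have "(1 + y) * (C * exp (- y / (2 * \<xi>))) = C * (indicator {0..} y * exp (- (1 / (2 * \<xi>)) * y)) + C * (indicator {0..} y * (y ^ 1 * exp (- (1 / (2 * \<xi>)) * y)))"
            using True by (simp add: algebra_simps)
          finally show ?thesis .
        qed simp
      qed
      also have "\<dots> = ennreal (C * (1 / (1 / (2 * \<xi>))) + C * (fact 1 / (1 / (2 * \<xi>)) ^ Suc 1))"
        using bi C by (subst nn_integral_eq_integral) (auto simp: has_bochner_integral_iff split: split_indicator intro!: AE_I2 add_nonneg_nonneg mult_nonneg_nonneg)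
      finally show ?case .
    qed
  qed simp
qed

lemma N_Z:
  assumes "t n > 0" "y \<ge> 0"
  shows "N n y \<omega> = (\<Sum>i=1..n. of_bool (y < Z n i \<omega>))"
  unfolding N_sum
proof (intro sum.cong refl)
  fix i
  have "exp y \<ge> 1" using assms by simp
  have "y < Z n i \<omega> \<longleftrightarrow> exp y < max 1 (X i \<omega> / t n)" unfolding Z_def
    by (subst exp_less_cancel_iff[symmetric]) (simp add: exp_ln less_max_iff_disj)
  also have "\<dots> \<longleftrightarrow> t n * exp y < X i \<omega>" using \<open>exp y \<ge> 1\<close> assms by (auto simp: less_max_iff_disj field_simps)
  finally show "indicator {t n * exp y<..} (X i \<omega>) = of_bool (y < Z n i \<omega>)" by (auto simp: indicator_def)
qed

lemma N_Z_sum: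
  assumes "t n > 0" "y \<ge> 0"
  shows "(\<Sum>i=1..n. indicator {0..} y * (of_bool (y < Z n i \<omega>) * exp (s * y))) = N n y \<omega> * exp (s * y)"
  unfolding N_Z[OF assms] sum_distrib_right by (rule sum.cong) (use assms in auto)

lemma Z_nonneg: "Z n i \<omega> \<ge> 0"
  by (simp add: Z_def)

text \<open>Layer-cake formula summed over the sample: the sum of
  \<open>kap s (Z n i \<omega>)\<close> is the integral of the count \<open>N n y \<omega>\<close>
  against \<open>exp (s * y)\<close>, and the limiting tail integrates to the centring of
  \<open>\<Theta>\<close>.\<close>

lemma T_integral:
  assumes "t n > 0" "k n > 0" "s \<le> 0"
  shows "has_bochner_integral lborel (\<lambda>y. indicator {0..} y * (T n y \<omega> * exp (s * y))) (\<Theta> n s \<omega>)"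
proof -
  have c: "1 / \<xi> - s > 0" using divide_pos_pos[of 1 \<xi>] xi_pos assms by linarith
  have "has_bochner_integral lborel (\<lambda>y. sqrt (real (k n)) * ((\<Sum>i=1..n. indicator {0..} y * (of_bool (y < Z n i \<omega>) * exp (s * y))) / real (k n) -
      indicator {0..} y * exp (- (1 / \<xi> - s) * y)))
    (sqrt (real (k n)) * ((\<Sum>i=1..n. kap s (Z n i \<omega>)) / real (k n) - 1 / (1 / \<xi> - s)))"
    unfolding kap_def
    by (intro has_bochner_integral_mult_right has_bochner_integral_diff has_bochner_integral_divide
        has_bochner_integral_sum integral_indicator_less_exp has_bochner_integral_exp c Z_nonneg)
  also have "1 / (1 / \<xi> - s) = \<xi> / (1 - \<xi> * s)" using xi_pos by (simp add: field_simps)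
  also have "(\<lambda>y. sqrt (real (k n)) * ((\<Sum>i=1..n. indicator {0..} y * (of_bool (y < Z n i \<omega>) * exp (s * y))) / real (k n) -
      indicator {0..} y * exp (- (1 / \<xi> - s) * y))) = (\<lambda>y. indicator {0..} y * (T n y \<omega> * exp (s * y)))"
  proof
    fix y :: real
    have e: "exp (- (1 / \<xi> - s) * y) = exp (- y / \<xi>) * exp (s * y)" by (simp add: algebra_simps flip: exp_add)
    show "sqrt (real (k n)) * ((\<Sum>i=1..n. indicator {0..} y * (of_bool (y < Z n i \<omega>) * exp (s * y))) / real (k n) -
      indicator {0..} y * exp (- (1 / \<xi> - s) * y)) = indicator {0..} y * (T n y \<omega> * exp (s * y))"
      unfolding e T_def using N_Z_sum[OF assms(1), of y \<omega> s]
      by (cases "y \<ge> 0") (simp_all add: algebra_simps del: sum_of_bool_mult_eq)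
  qed
  finally show ?thesis by (simp add: \<Theta>_def)
qed

lemma R_integrable:
  assumes "t n > 0" "k n > 0"
  shows "integrable lborel (\<lambda>y. indicator {0..} y * (\<bar>T n y \<omega>\<bar> * (1 + y)))"
proof (rule Bochner_Integration.integrable_bound)
  \<comment> \<open>With \<open>1 + y \<le> exp y\<close> the empirical part is dominated by
    finitely many functions of bounded support.\<close>
  let ?g = "\<lambda>y. sqrt (real (k n)) * ((\<Sum>i=1..n. indicator {0..} y * (of_bool (y < Z n i \<omega>) * exp (1 * y))) / real (k n) +
      (indicator {0..} y * exp (- (1 / \<xi>) * y) + indicator {0..} y * (y ^ 1 * exp (- (1 / \<xi>) * y))))"
  show "integrable lborel ?g"
    using has_bochner_integral_exp[of "1 / \<xi>"] has_bochner_integral_power_exp[of "1 / \<xi>" 1] xi_pos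
      integral_indicator_less_exp[OF Z_nonneg, of n _ \<omega> 1]
    by (intro integrable_mult_right Bochner_Integration.integrable_add integrable_divide Bochner_Integration.integrable_sum)
      (auto simp: has_bochner_integral_iff)
  show "(\<lambda>y. indicator {0..} y * (\<bar>T n y \<omega>\<bar> * (1 + y))) \<in> borel_measurable lborel" by measurable
  show "AE y in lborel. norm (indicator {0..} y * (\<bar>T n y \<omega>\<bar> * (1 + y))) \<le> norm (?g y)"
  proof (rule AE_I2)
    fix y :: real
    show "norm (indicator {0..} y * (\<bar>T n y \<omega>\<bar> * (1 + y))) \<le> norm (?g y)"
    proof (cases "y \<ge> 0")
      case True
      have "\<bar>T n y \<omega>\<bar> \<le> sqrt (real (k n)) * (N n y \<omega> / real (k n) + exp (- y / \<xi>))"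
        unfolding T_def abs_mult using N_bounds[of n y \<omega>] exp_gt_zero[of "- y / \<xi>"]
        by (auto intro!: mult_left_mono simp: abs_le_iff add_increasing2 add_increasing)
      then have "\<bar>T n y \<omega>\<bar> * (1 + y) \<le> sqrt (real (k n)) * (N n y \<omega> / real (k n) + exp (- y / \<xi>)) * (1 + y)"
        using True by (intro mult_right_mono) auto
      also have "\<dots> = sqrt (real (k n)) * (N n y \<omega> * (1 + y) / real (k n) + exp (- y / \<xi>) * (1 + y))"
        by (simp add: algebra_simps)
      also have "\<dots> \<le> sqrt (real (k n)) * (N n y \<omega> * exp (1 * y) / real (k n) + exp (- y / \<xi>) * (1 + y))"
        using N_bounds[of n y \<omega>] exp_ge_add_one_self[of y] by (intro mult_left_mono add_mono divide_right_mono) auto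
      also have "\<dots> = ?g y"
        unfolding N_Z_sum[OF assms(1) True] using True by (simp add: algebra_simps)
      finally show ?thesis using True by simp
    qed simp
  qed
qed

lemma Theta_bound:
  assumes "t n > 0" "k n > 0" "s \<le> 0"
  shows "\<bar>\<Theta> n s \<omega>\<bar> \<le> R n \<omega>"
proof -
  have eq: "\<Theta> n s \<omega> = (LINT y|lborel. indicator {0..} y * (T n y \<omega> * exp (s * y)))"
    using T_integral[OF assms, of \<omega>] by (simp add: has_bochner_integral_iff)
  have "\<bar>\<Theta> n s \<omega>\<bar> \<le> (LINT y|lborel. norm (indicator {0..} y * (T n y \<omega> * exp (s * y))))"
    unfolding eq using integral_norm_bound[of lborel "\<lambda>y. indicator {0..} y * (T n y \<omega> * exp (s * y))"] by simp
  also have "\<dots> \<le> R n \<omega>" unfolding R_def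
  proof (rule integral_mono_AE'[OF R_integrable[OF assms(1,2)]])
    show "AE y in lborel. norm (indicator {0..} y * (T n y \<omega> * exp (s * y))) \<le> indicator {0..} y * (\<bar>T n y \<omega>\<bar> * (1 + y))"
    proof (rule AE_I2)
      fix y :: real
      have "exp (s * y) \<le> 1 + y" if "y \<ge> 0" using assms(3) that by (simp add: mult_nonpos_nonneg add_increasing2)
      then show "norm (indicator {0..} y * (T n y \<omega> * exp (s * y))) \<le> indicator {0..} y * (\<bar>T n y \<omega>\<bar> * (1 + y))"
        by (auto split: split_indicator simp: abs_mult intro: mult_left_mono)
    qed
  qed (auto intro!: AE_I2 split: split_indicator)
  finally show ?thesis .
qed

text \<open>The bound holds for every path separately, so the exponents may depend on
  \<open>\<omega>\<close>.\<close>

lemma Theta_Lipschitz: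
  assumes "t n > 0" "k n > 0" "s \<le> 0" "s' \<le> 0"
  shows "\<bar>\<Theta> n s \<omega> - \<Theta> n s' \<omega>\<bar> \<le> \<bar>s - s'\<bar> * R n \<omega>"
proof -
  let ?g = "\<lambda>y. indicator {0..} y * (T n y \<omega> * exp (s * y)) - indicator {0..} y * (T n y \<omega> * exp (s' * y))"
  have eq: "\<Theta> n s \<omega> - \<Theta> n s' \<omega> = (LINT y|lborel. ?g y)"
    using has_bochner_integral_diff[OF T_integral[OF assms(1-3), of \<omega>] T_integral[OF assms(1,2,4), of \<omega>]]
    by (simp add: has_bochner_integral_iff)
  have "\<bar>\<Theta> n s \<omega> - \<Theta> n s' \<omega>\<bar> \<le> (LINT y|lborel. norm (?g y))"
    unfolding eq using integral_norm_bound[of lborel ?g] by simp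
  also have "\<dots> \<le> (LINT y|lborel. \<bar>s - s'\<bar> * (indicator {0..} y * (\<bar>T n y \<omega>\<bar> * (1 + y))))"
  proof (rule integral_mono_AE'[OF integrable_mult_right[OF R_integrable[OF assms(1,2)]]])
    show "AE y in lborel. norm (?g y) \<le> \<bar>s - s'\<bar> * (indicator {0..} y * (\<bar>T n y \<omega>\<bar> * (1 + y)))"
    proof (rule AE_I2)
      fix y :: real
      show "norm (?g y) \<le> \<bar>s - s'\<bar> * (indicator {0..} y * (\<bar>T n y \<omega>\<bar> * (1 + y)))"
      proof (cases "y \<ge> 0")
        case True
        have "norm (?g y) = \<bar>T n y \<omega>\<bar> * \<bar>exp (s * y) - exp (s' * y)\<bar>"
          using True by (simp add: right_diff_distrib[symmetric] abs_mult)
        also have "\<dots> \<le> \<bar>T n y \<omega>\<bar> * (\<bar>s - s'\<bar> * (1 + y))"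
          using exp_diff_bound[OF assms(3,4) True] True
          by (intro mult_left_mono) (auto simp: algebra_simps intro: order_trans)
        finally show ?thesis using True by (simp add: mult_ac)
      qed simp
    qed
  qed (auto intro!: AE_I2 split: split_indicator)
  also have "\<dots> = \<bar>s - s'\<bar> * R n \<omega>" unfolding R_def by (rule integral_mult_right_zero)
  finally show ?thesis .
qed

end

section \<open>The random threshold, and linear expansions of the Hill estimator and the power
  means\<close>

context tail_array
begin

text \<open>Between levels at distance of order \<open>1 / sqrt k\<close> the count has mean and
  variance of order \<open>sqrt k\<close>; after division by \<open>sqrt k\<close> the variance
  vanishes and the mean remains.\<close>

lemma increment_limit:
  assumes "a \<le> b"
  shows "((\<lambda>p. (N (fst p) (a / sqrt (real (k (fst p)))) (snd p) - N (fst p) (b / sqrt (real (k (fst p)))) (snd p)) / sqrt (real (k (fst p))))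
    \<longlongrightarrow> (b - a) / \<xi>) (prob_filter M)"
proof -
  define r where "r n = sqrt (real (k n))" for n
  define q where "q n = F (t n * exp (b / r n)) - F (t n * exp (a / r n))" for n
  define D where "D n \<omega> = (N n (a / r n) \<omega> - N n (b / r n) \<omega>) / r n" for n \<omega>
  have r0: "\<forall>\<^sub>F n in sequentially. r n > 0" using k_pos by eventually_elim (simp add: r_def)
  have ir: "(\<lambda>n. 1 / r n) \<longlonglongrightarrow> 0" using inv_sqrt_k by (simp add: r_def)
  \<comment> \<open>The deviation \<open>d\<close> adds the same \<open>lam / \<xi>\<close> at each
    level \<open>c\<close>, so it cancels in the increment.\<close>
  have ex: "(\<lambda>n. r n * (exp (- c / r n / \<xi>) * (1 + d n (c / r n)) - 1)) \<longlonglongrightarrow> - c / \<xi> + lam / \<xi>" for c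
  proof -
    have z: "(\<lambda>n. - c / \<xi> * (1 / r n)) \<longlonglongrightarrow> 0" using tendsto_mult[OF tendsto_const[of "- c / \<xi>"] ir] by (simp only: mult_zero_right)
    have "\<forall>\<^sub>F n in sequentially. - c / \<xi> = r n * (- c / \<xi> * (1 / r n))"
      using r0 by eventually_elim simp
    then have "(\<lambda>n. r n * (- c / \<xi> * (1 / r n))) \<longlonglongrightarrow> - c / \<xi>"
      by (rule Lim_transform_eventually[OF tendsto_const])
    from delta_method[OF DERIV_exp z this, simplified]
    have "(\<lambda>n. r n * (exp (- c / \<xi> * (1 / r n)) - 1)) \<longlonglongrightarrow> - c / \<xi>" by simp
    moreover have "(\<lambda>n. exp (- c / \<xi> * (1 / r n)) * (r n * d n (c / r n))) \<longlonglongrightarrow> exp 0 * (lam / \<xi>)"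
      using d_loc[of c] by (intro tendsto_mult tendsto_exp z) (simp add: r_def)
    ultimately have "(\<lambda>n. r n * (exp (- c / \<xi> * (1 / r n)) - 1) + exp (- c / \<xi> * (1 / r n)) * (r n * d n (c / r n))) \<longlonglongrightarrow> - c / \<xi> + exp 0 * (lam / \<xi>)"
      by (rule tendsto_add)
    then show ?thesis by (simp add: algebra_simps)
  qed
  have "\<forall>\<^sub>F n in sequentially. r n * (exp (- a / r n / \<xi>) * (1 + d n (a / r n)) - 1) - r n * (exp (- b / r n / \<xi>) * (1 + d n (b / r n)) - 1)
      = real n * q n / r n"
    using k_pos k_less tail
  proof eventually_elim
    case (elim n)
    have "r n * r n = real (k n)" "r n > 0" using elim by (auto simp: r_def)
    then have "real n * q n / r n = r n * (real n / real (k n) * q n)" using elim(1) by (simp add: field_simps)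
    also have "real n / real (k n) * q n = real n / real (k n) * (1 - F (t n * exp (a / r n))) - real n / real (k n) * (1 - F (t n * exp (b / r n)))"
      by (simp add: q_def algebra_simps)
    also have "\<dots> = exp (- (a / r n) / \<xi>) * (1 + d n (a / r n)) - exp (- (b / r n) / \<xi>) * (1 + d n (b / r n))"
      using elim(3) by simp
    finally show ?case by (simp add: algebra_simps)
  qed
  from Lim_transform_eventually[OF tendsto_diff[OF ex[of a] ex[of b]] this]
  have nq: "(\<lambda>n. real n * q n / r n) \<longlonglongrightarrow> (b - a) / \<xi>" by (simp add: diff_divide_distrib)
  \<comment> \<open>This is the bound for the variance of \<open>D n\<close>.\<close>
  have nq2: "(\<lambda>n. real n * q n / r n * (1 / r n)) \<longlonglongrightarrow> 0" using tendsto_mult[OF nq ir] by simp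
  have "((\<lambda>p. (D (fst p) (snd p) - real (fst p) * q (fst p) / r (fst p))\<^sup>2) \<longlongrightarrow> 0) (prob_filter M)"
  proof (rule tendsto_prob_moment[where W="\<lambda>n \<omega>. (D n \<omega> - real n * q n / r n)\<^sup>2", OF _ _ nq2])
    show "(\<lambda>\<omega>. (D n \<omega> - real n * q n / r n)\<^sup>2) \<in> borel_measurable M" for n
      unfolding D_def by measurable
    show "\<forall>\<^sub>F n in sequentially. (\<integral>\<^sup>+\<omega>. ennreal \<bar>(D n \<omega> - real n * q n / r n)\<^sup>2\<bar> \<partial>M) \<le> ennreal (real n * q n / r n * (1 / r n))"
      using t_pos r0
    proof eventually_elim
      case (elim n)
      let ?B = "{t n * exp (a / r n)<..t n * exp (b / r n)}"
      have ab: "a / r n \<le> b / r n" using elim assms by (simp add: divide_right_mono)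
      then have tab: "t n * exp (a / r n) \<le> t n * exp (b / r n)" using elim by simp
      note P = prob_Ioc[OF tab]
      have q01: "0 \<le> q n" "q n \<le> 1" unfolding q_def P[of 0, symmetric] by (rule measure_nonneg, rule prob_le_1)
      have D: "D n \<omega> - real n * q n / r n = ((\<Sum>i=1..n. indicator ?B (X i \<omega>)) - real n * q n) / r n" for \<omega>
        using N_diff[OF ab elim(1), of \<omega>] by (simp add: D_def diff_divide_distrib)
      have e: "expectation (\<lambda>\<omega>. ((\<Sum>i=1..n. indicator ?B (X i \<omega>)) - real n * q n)\<^sup>2) = real n * (q n * (1 - q n))"
        using count_second_moment[OF indep_vars_subset[OF indep, of "{1..n}"], where B="?B" and q="q n"] P
        by (simp add: q_def)
      have int: "integrable M (\<lambda>\<omega>. ((\<Sum>i=1..n. indicator ?B (X i \<omega>)) - real n * q n)\<^sup>2)"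
      proof (rule integrable_const_bound[where B="(real n)\<^sup>2"])
        have "\<bar>(\<Sum>i=1..n. indicator ?B (X i \<omega>)) - real n * q n\<bar> \<le> real n" for \<omega>
        proof -
          have "0 \<le> real n * q n" "real n * q n \<le> real n" using q01 by (auto simp: mult_left_le)
          moreover have "0 \<le> (\<Sum>i=1..n. indicator ?B (X i \<omega>) :: real)" by (intro sum_nonneg) auto
          moreover have "(\<Sum>i=1..n. indicator ?B (X i \<omega>) :: real) \<le> real n"
            using sum_bounded_above[of "{1..n}" "\<lambda>i. indicator ?B (X i \<omega>) :: real" 1] by (auto split: split_indicator)
          ultimately show ?thesis by linarith
        qed
        then show "AE \<omega> in M. norm (((\<Sum>i=1..n. indicator ?B (X i \<omega>)) - real n * q n)\<^sup>2) \<le> (real n)\<^sup>2"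
          by (auto intro!: AE_I2 power2_le_iff_abs_le[THEN iffD2])
      qed measurable
      have "(\<integral>\<^sup>+\<omega>. ennreal \<bar>(D n \<omega> - real n * q n / r n)\<^sup>2\<bar> \<partial>M)
         = (\<integral>\<^sup>+\<omega>. ennreal (1 / (r n)\<^sup>2 * ((\<Sum>i=1..n. indicator ?B (X i \<omega>)) - real n * q n)\<^sup>2) \<partial>M)"
        unfolding D by (intro nn_integral_cong) (simp add: power_divide)
      also have "\<dots> = ennreal (1 / (r n)\<^sup>2 * (real n * (q n * (1 - q n))))"
        using int by (subst nn_integral_eq_integral) (auto simp: e[symmetric])
      also have "\<dots> \<le> ennreal (real n * q n / r n * (1 / r n))"
      proof (rule ennreal_leI)
        have "real n * (q n * (1 - q n)) \<le> real n * q n"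
          using q01 by (intro mult_left_mono) (auto simp: mult_left_le)
        then show "1 / (r n)\<^sup>2 * (real n * (q n * (1 - q n))) \<le> real n * q n / r n * (1 / r n)"
          by (simp add: power2_eq_square divide_right_mono)
      qed
      finally show ?case .
    qed
  qed
  from tendsto_real_sqrt[OF this]
  have "((\<lambda>p. \<bar>D (fst p) (snd p) - real (fst p) * q (fst p) / r (fst p)\<bar>) \<longlongrightarrow> 0) (prob_filter M)" by simp
  then have "((\<lambda>p. D (fst p) (snd p) - real (fst p) * q (fst p) / r (fst p)) \<longlongrightarrow> 0) (prob_filter M)"
    by (rule tendsto_rabs_zero_cancel)
  from tendsto_add[OF this tendsto_fst_prob[OF nq]] show ?thesis by (simp add: D_def r_def)
qed

lemma increment_limit0:
  "((\<lambda>p. (N (fst p) (y / sqrt (real (k (fst p)))) (snd p) - N (fst p) 0 (snd p)) / sqrt (real (k (fst p))))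
    \<longlongrightarrow> - y / \<xi>) (prob_filter M)"
proof (cases "y \<le> 0")
  case True
  from increment_limit[OF True] show ?thesis by simp
next
  case False
  then have "0 \<le> y" by simp
  from tendsto_minus[OF increment_limit[OF this]] show ?thesis by (simp only: minus_divide_left minus_diff_eq diff_0_right div_0)
qed

definition xs :: "nat \<Rightarrow> 'a \<Rightarrow> real list" where
  "xs n \<omega> = map (\<lambda>i. X i \<omega>) [1..<Suc n]"

definition V :: "nat \<Rightarrow> 'a \<Rightarrow> real" where
  "V n \<omega> = order_stat (xs n \<omega>) (n - k n) / t n"

definition U :: "nat \<times> 'a \<Rightarrow> real" where
  "U p = sqrt (real (k (fst p))) * ln (V (fst p) (snd p))"

lemma V_le_iff:
  assumes "k n < n" "t n > 0"
  shows "V n \<omega> \<le> exp y \<longleftrightarrow> N n y \<omega> \<le> real (k n)"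
proof -
  have "V n \<omega> \<le> exp y \<longleftrightarrow> order_stat (xs n \<omega>) (n - k n) \<le> t n * exp y"
    using assms by (simp add: V_def field_simps)
  also have "\<dots> \<longleftrightarrow> N n y \<omega> \<le> real (k n)"
    using order_stat_sample[OF assms(1), of "\<lambda>i. X i \<omega>"] by (simp add: xs_def N_def)
  finally show ?thesis .
qed

lemma eventually_good:
  "\<forall>\<^sub>F p in prob_filter M. k (fst p) > 0 \<and> k (fst p) < fst p \<and> t (fst p) > 0"
  using eventually_fst_prob[OF k_pos] eventually_fst_prob[OF k_less] eventually_fst_prob[OF t_pos]
  by eventually_elim simp

lemma N_T0:
  assumes "k n > 0"
  shows "(N n y \<omega> \<le> real (k n)) \<longleftrightarrow> T n 0 \<omega> + (N n y \<omega> - N n 0 \<omega>) / sqrt (real (k n)) \<le> 0"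
proof -
  have aux: "r * (u / (r * r) - 1) = (u - r * r) / r" if "r > 0" for r u :: real using that by (auto simp: field_simps)
  have "T n 0 \<omega> = (N n 0 \<omega> - real (k n)) / sqrt (real (k n))"
    using aux[of "sqrt (real (k n))" "N n 0 \<omega>"] assms by (simp add: T_def)
  then have "T n 0 \<omega> + (N n y \<omega> - N n 0 \<omega>) / sqrt (real (k n)) = (N n y \<omega> - real (k n)) / sqrt (real (k n))"
    by (simp add: diff_divide_distrib)
  then show ?thesis using assms by (simp add: divide_le_0_iff)
qed

text \<open>The observations may be negative, so the order statistic is positive only with
  probability tending to 1. At a level \<open>- c / sqrt k\<close> with \<open>c\<close> large, the
  count exceeds \<open>k\<close> as long as \<open>T n 0\<close> stays bounded.\<close>

lemma V_pos: "\<forall>\<^sub>F p in prob_filter M. V (fst p) (snd p) > 0"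
proof (rule tightD[OF T0_tight])
  fix L :: real
  \<comment> \<open>The increment from level 0 down to \<open>y / sqrt k\<close> tends to
    \<open>\<bar>L\<bar> + 1\<close>, which outweighs any value of \<open>T n 0\<close> in the range
    considered.\<close>
  define y where "y = - (\<bar>L\<bar> + 1) * \<xi>"
  have "\<forall>\<^sub>F p in prob_filter M. (N (fst p) (y / sqrt (real (k (fst p)))) (snd p) - N (fst p) 0 (snd p)) / sqrt (real (k (fst p))) > \<bar>L\<bar>"
    by (rule order_tendstoD(1)[OF increment_limit0]) (use xi_pos in \<open>simp add: y_def\<close>)
  then show "\<forall>\<^sub>F p in prob_filter M. \<bar>T (fst p) 0 (snd p)\<bar> \<le> L \<longrightarrow> V (fst p) (snd p) > 0"
    using eventually_good
  proof eventually_elim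
    case (elim p)
    show ?case
    proof
      assume L: "\<bar>T (fst p) 0 (snd p)\<bar> \<le> L"
      then have "\<not> N (fst p) (y / sqrt (real (k (fst p)))) (snd p) \<le> real (k (fst p))"
        using elim by (subst N_T0) auto
      then have "\<not> V (fst p) (snd p) \<le> exp (y / sqrt (real (k (fst p))))"
        using V_le_iff elim by blast
      then show "V (fst p) (snd p) > 0" using exp_gt_zero[of "y / sqrt (real (k (fst p)))"] by linarith
    qed
  qed
qed

text \<open>\<open>U \<le> y\<close> says that at most \<open>k\<close> observations exceed log
  level \<open>y / sqrt k\<close>, that is, \<open>T n 0\<close> plus a local increment is at most
  0. The increment tends to \<open>- y / \<xi>\<close>, so the event is
  \<open>\<xi> * T n 0 \<le> y\<close> up to a vanishing remainder \<open>Q y\<close>, and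
  \<open>tight_level_sets_close\<close> applies.\<close>

lemma Bahadur: "((\<lambda>p. U p - \<xi> * T (fst p) 0 (snd p)) \<longlongrightarrow> 0) (prob_filter M)"
proof (rule tight_level_sets_close)
  define Q where "Q y p = \<xi> * ((N (fst p) (y / sqrt (real (k (fst p)))) (snd p) - N (fst p) 0 (snd p)) / sqrt (real (k (fst p)))) + y" for y p
  show "tight M (\<lambda>p. \<xi> * T (fst p) 0 (snd p))" by (intro tight_mult tight_const T0_tight)
  fix y
  show "(Q y \<longlongrightarrow> 0) (prob_filter M)"
    unfolding Q_def using tendsto_add[OF tendsto_mult[OF tendsto_const[of \<xi>] increment_limit0[of y]] tendsto_const[of y]] xi_pos by simp
  show "\<forall>\<^sub>F p in prob_filter M. U p \<le> y \<longleftrightarrow> \<xi> * T (fst p) 0 (snd p) + Q y p \<le> y"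
    using eventually_good V_pos
  proof eventually_elim
    case (elim p)
    let ?r = "sqrt (real (k (fst p)))"
    have r: "?r > 0" using elim by simp
    have "U p \<le> y \<longleftrightarrow> ln (V (fst p) (snd p)) \<le> y / ?r" using r by (simp add: U_def field_simps)
    also have "\<dots> \<longleftrightarrow> V (fst p) (snd p) \<le> exp (y / ?r)" using elim by (metis exp_le_cancel_iff exp_ln)
    also have "\<dots> \<longleftrightarrow> T (fst p) 0 (snd p) + (N (fst p) (y / ?r) (snd p) - N (fst p) 0 (snd p)) / ?r \<le> 0"
      using V_le_iff N_T0 elim by blast
    also have "\<dots> \<longleftrightarrow> \<xi> * (T (fst p) 0 (snd p) + (N (fst p) (y / ?r) (snd p) - N (fst p) 0 (snd p)) / ?r) \<le> 0"
      using xi_pos by (simp add: mult_le_0_iff)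
    finally show ?case by (simp add: Q_def distrib_left)
  qed
qed

lemma U_tight: "tight M U"
  by (rule tight_close[OF _ Bahadur]) (intro tight_mult tight_const T0_tight)

lemma ln_V: "((\<lambda>p. ln (V (fst p) (snd p))) \<longlongrightarrow> 0) (prob_filter M)"
proof -
  have "((\<lambda>p. 1 / sqrt (real (k (fst p))) * U p) \<longlongrightarrow> 0) (prob_filter M)"
    by (rule tendsto_0_mult_tight[OF tendsto_fst_prob[OF inv_sqrt_k] U_tight])
  moreover have "\<forall>\<^sub>F p in prob_filter M. 1 / sqrt (real (k (fst p))) * U p = ln (V (fst p) (snd p))"
    using eventually_good by eventually_elim (simp add: U_def)
  ultimately show ?thesis by (rule Lim_transform_eventually)
qed

text \<open>The error is the product of \<open>\<bar>N n 0 \<omega> - k n\<bar> = sqrt k * \<bar>T n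
  0 \<omega>\<bar>\<close> and the variation of \<open>\<Phi>\<close> between 1 and
  \<open>V\<close>. After division by \<open>sqrt k\<close> it is a tight factor times a vanishing
  one.\<close>

lemma excess_sum_change:
  fixes \<Phi> :: "real \<Rightarrow> real"
  assumes g: "k n > 0" "k n < n" "t n > 0" and V: "V n \<omega> > 0"
    and mono: "\<And>a b. 0 < a \<Longrightarrow> a \<le> b \<Longrightarrow> \<Phi> a \<le> \<Phi> b"
  shows "\<bar>(\<Sum>i=1..n. \<Phi> (max 1 (X i \<omega> / t n)) - \<Phi> 1) - (\<Sum>i=1..n. \<Phi> (max (V n \<omega>) (X i \<omega> / t n)) - \<Phi> (V n \<omega>))
      - real (k n) * (\<Phi> (V n \<omega>) - \<Phi> 1)\<bar> \<le> sqrt (real (k n)) * \<bar>T n 0 \<omega>\<bar> * \<bar>\<Phi> (V n \<omega>) - \<Phi> 1\<bar>"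
proof -
  have os: "order_stat (map (\<lambda>i. X i \<omega>) [1..<Suc n]) (n - k n) = t n * V n \<omega>"
    using g by (simp add: V_def xs_def)
  have "card {i\<in>{1..n}. X i \<omega> / t n > V n \<omega>} \<le> k n" "k n \<le> card {i\<in>{1..n}. X i \<omega> / t n \<ge> V n \<omega>}"
    using card_order_stat[OF g(2) refl, of "\<lambda>i. X i \<omega>", unfolded os] g by (simp_all add: field_simps)
  from threshold_change[of \<Phi>, OF mono V _ this]
  have "\<bar>(\<Sum>i=1..n. \<Phi> (max 1 (X i \<omega> / t n)) - \<Phi> 1) - (\<Sum>i=1..n. \<Phi> (max (V n \<omega>) (X i \<omega> / t n)) - \<Phi> (V n \<omega>))
      - real (k n) * (\<Phi> (V n \<omega>) - \<Phi> 1)\<bar> \<le> \<bar>real (card {i\<in>{1..n}. X i \<omega> / t n > 1}) - real (k n)\<bar> * \<bar>\<Phi> (V n \<omega>) - \<Phi> 1\<bar>"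
    by simp
  also have "{i\<in>{1..n}. X i \<omega> / t n > 1} = {i\<in>{1..n}. X i \<omega> > t n * exp 0}" using g by (auto simp: field_simps)
  also have "\<bar>real (card {i\<in>{1..n}. X i \<omega> > t n * exp 0}) - real (k n)\<bar> = sqrt (real (k n)) * \<bar>T n 0 \<omega>\<bar>"
  proof -
    have aux: "u - r * r = r * (r * (u / (r * r) - 1))" if "r > 0" for r u :: real using that by (auto simp: field_simps)
    have "N n 0 \<omega> - real (k n) = sqrt (real (k n)) * T n 0 \<omega>"
      using aux[of "sqrt (real (k n))" "N n 0 \<omega>"] g by (simp add: T_def)
    then show ?thesis unfolding N_def by (simp only: abs_mult) simp
  qed
  finally show ?thesis .
qed

text \<open>The case \<open>\<Phi> = ln\<close>: moving the threshold from \<open>t\<close> to the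
  order statistic costs \<open>ln V\<close>, and \<open>U = sqrt k * ln V\<close> is replaced by
  \<open>\<xi> * T n 0\<close> through \<open>Bahadur\<close>.\<close>

lemma hill_expansion:
  "((\<lambda>p. sqrt (real (k (fst p))) * (hill (xs (fst p) (snd p)) (k (fst p)) - \<xi>)
      - (\<Theta> (fst p) 0 (snd p) - \<xi> * T (fst p) 0 (snd p))) \<longlongrightarrow> 0) (prob_filter M)"
proof -
  define A where "A p = sqrt (real (k (fst p))) * (hill (xs (fst p) (snd p)) (k (fst p)) - \<xi>) - \<Theta> (fst p) 0 (snd p) + U p" for p
  have "((\<lambda>p. \<bar>ln (V (fst p) (snd p))\<bar> * \<bar>T (fst p) 0 (snd p)\<bar>) \<longlongrightarrow> 0) (prob_filter M)"
    by (rule tendsto_0_mult_tight) (auto intro: tendsto_rabs_zero ln_V tight_mono[OF T0_tight])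
  then have "(A \<longlongrightarrow> 0) (prob_filter M)"
  proof (rule Lim_null_comparison[rotated])
    show "\<forall>\<^sub>F p in prob_filter M. norm (A p) \<le> \<bar>ln (V (fst p) (snd p))\<bar> * \<bar>T (fst p) 0 (snd p)\<bar>"
      using eventually_good V_pos
    proof eventually_elim
      case (elim p)
      obtain n \<omega> where p: "p = (n, \<omega>)" by (cases p)
      have g: "k n > 0" "k n < n" "t n > 0" "V n \<omega> > 0" using elim by (auto simp: p)
      let ?S = "\<Sum>i=1..n. Z n i \<omega>" and ?r = "sqrt (real (k n))"
      have os: "t n * V n \<omega> = order_stat (map (\<lambda>i. X i \<omega>) [1..<Suc n]) (n - k n)" "t n * V n \<omega> > 0"
        using g by (simp_all only: mult_pos_pos, simp add: V_def xs_def del: upt_Suc)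
      have "hill (xs n \<omega>) (k n) = (\<Sum>i=1..n. ln (max 1 (X i \<omega> / (t n * V n \<omega>)))) / real (k n)"
        unfolding xs_def by (rule hill_sample[OF g(1,2) os])
      also have "(\<Sum>i=1..n. ln (max 1 (X i \<omega> / (t n * V n \<omega>)))) = (\<Sum>i=1..n. ln (max (V n \<omega>) (X i \<omega> / t n)) - ln (V n \<omega>))"
      proof (intro sum.cong refl)
        fix i
        have "max 1 (X i \<omega> / (t n * V n \<omega>)) = max (V n \<omega>) (X i \<omega> / t n) / V n \<omega>" using g by (auto simp: max_def field_simps)
        then show "ln (max 1 (X i \<omega> / (t n * V n \<omega>))) = ln (max (V n \<omega>) (X i \<omega> / t n)) - ln (V n \<omega>)"
          using g by (simp add: ln_div less_max_iff_disj)
      qed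
      finally have h: "(\<Sum>i=1..n. ln (max (V n \<omega>) (X i \<omega> / t n)) - ln (V n \<omega>)) = real (k n) * hill (xs n \<omega>) (k n)" using g by simp
      have "\<bar>?S - real (k n) * hill (xs n \<omega>) (k n) - real (k n) * ln (V n \<omega>)\<bar> \<le> ?r * \<bar>T n 0 \<omega>\<bar> * \<bar>ln (V n \<omega>)\<bar>"
        using excess_sum_change[OF g, of ln] unfolding h by (simp add: Z_def)
      also have "?S - real (k n) * hill (xs n \<omega>) (k n) - real (k n) * ln (V n \<omega>) = - ?r * A p"
      proof -
        have aux: "S - r * r * h - r * r * v = - r * (r * (h - x) - r * (S / (r * r) - x) + r * v)" if "r > 0" for r S h v x :: real
          using that by (simp add: field_simps)
        show ?thesis
          using aux[of ?r ?S "hill (xs n \<omega>) (k n)" "ln (V n \<omega>)" \<xi>] g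
          by (simp add: A_def p U_def \<Theta>_def kap_def)
      qed
      finally have "?r * \<bar>A p\<bar> \<le> ?r * (\<bar>T n 0 \<omega>\<bar> * \<bar>ln (V n \<omega>)\<bar>)" by (simp add: abs_mult mult.assoc)
      then have "\<bar>A p\<bar> \<le> \<bar>T n 0 \<omega>\<bar> * \<bar>ln (V n \<omega>)\<bar>" by (rule mult_left_le_imp_le) (use g in simp)
      then show ?case by (simp add: p mult.commute)
    qed
  qed
  from tendsto_diff[OF this Bahadur] show ?thesis by (simp add: A_def algebra_simps)
qed

text \<open>Centring at the random \<open>S p\<close> itself separates the sampling error from the
  error of the exponent, so consistency of \<open>S\<close> suffices. Coefficients then move to
  their values at \<open>s\<close>; for \<open>\<Theta>\<close> this is the Lipschitz bound with the
  tight factor \<open>R\<close>.\<close>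

lemma E_stat_expansion:
  assumes S: "(S \<longlongrightarrow> s) (prob_filter M)" and s: "s < 0"
  shows "((\<lambda>p. sqrt (real (k (fst p))) * (E_stat (xs (fst p) (snd p)) (k (fst p)) (S p) - 1 / (1 - \<xi> * S p))
      - (s * \<Theta> (fst p) s (snd p) - \<xi> * s / (1 - \<xi> * s) * T (fst p) 0 (snd p))) \<longlongrightarrow> 0) (prob_filter M)"
proof -
  \<comment> \<open>\<open>g\<close> is the continuous difference quotient of \<open>exp\<close> at
    0; it expresses \<open>V powr (- S p) - 1\<close> exactly through \<open>U\<close>.\<close>
  obtain g where g: "\<And>z. exp z - 1 = g z * z" "isCont g 0" "g (0::real) = 1"
    using DERIV_exp[of "0::real"] unfolding CARAT_DERIV by auto
  define L where "L p = ln (V (fst p) (snd p))" for p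
  define A where "A p = sqrt (real (k (fst p))) * (E_stat (xs (fst p) (snd p)) (k (fst p)) (S p) - 1 / (1 - \<xi> * S p))" for p
  \<comment> \<open>The first term is the effect of the random threshold, the second the excess sum
    over \<open>t\<close>, rescaled to that threshold.\<close>
  define B where "B p = g (- S p * L p) * (- S p) / (1 - \<xi> * S p) * U p + S p * exp (- S p * L p) * \<Theta> (fst p) (S p) (snd p)" for p
  have L0: "(L \<longlongrightarrow> 0) (prob_filter M)" unfolding L_def by (rule ln_V)
  have SL: "((\<lambda>p. - S p * L p) \<longlongrightarrow> 0) (prob_filter M)"
    using tendsto_mult[OF tendsto_minus[OF S] L0] by simp
  have Sneg: "\<forall>\<^sub>F p in prob_filter M. S p < 0" by (rule order_tendstoD(2)[OF S s])
  have den: "1 - \<xi> * s > 0" using xi_pos s by (simp add: mult_pos_neg add_pos_pos less_diff_eq) (meson less_trans mult_pos_neg zero_less_one)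
  have eSL: "((\<lambda>p. exp (- S p * L p)) \<longlongrightarrow> 1) (prob_filter M)" using tendsto_exp[OF SL] by simp
  have "((\<lambda>p. \<bar>1 - exp (- S p * L p)\<bar> * \<bar>T (fst p) 0 (snd p)\<bar>) \<longlongrightarrow> 0) (prob_filter M)"
    by (rule tendsto_0_mult_tight)
      (use tendsto_rabs_zero[OF tendsto_diff[OF tendsto_const[of 1] eSL, simplified]] in \<open>auto intro: tight_mono[OF T0_tight]\<close>)
  then have AB: "((\<lambda>p. A p - B p) \<longlongrightarrow> 0) (prob_filter M)"
  proof (rule Lim_null_comparison[rotated])
    show "\<forall>\<^sub>F p in prob_filter M. norm (A p - B p) \<le> \<bar>1 - exp (- S p * L p)\<bar> * \<bar>T (fst p) 0 (snd p)\<bar>"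
      using eventually_good V_pos Sneg
    proof eventually_elim
      case (elim p)
      obtain n \<omega> where p: "p = (n, \<omega>)" by (cases p)
      define s' where "s' = S p"
      define v where "v = V n \<omega>"
      have g': "k n > 0" "k n < n" "t n > 0" "V n \<omega> > 0" and s': "s' < 0" using elim by (auto simp: p s'_def)
      define r where "r = sqrt (real (k n))"
      have r: "r > 0" "r * r = real (k n)" using g' by (auto simp: r_def)
      \<comment> \<open>The power is decreasing for negative \<open>s'\<close>; division by
        \<open>s'\<close> makes \<open>?\<Phi>\<close> increasing, as
        \<open>excess_sum_change\<close> requires.\<close>
      let ?\<Phi> = "\<lambda>x. x powr s' / s'"
      define G where "G = (\<Sum>i=1..n. kap s' (Z n i \<omega>))"
      define H where "H = (\<Sum>i=1..n. ?\<Phi> (max (V n \<omega>) (X i \<omega> / t n)) - ?\<Phi> (V n \<omega>))"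
      have os: "t n * V n \<omega> = order_stat (map (\<lambda>i. X i \<omega>) [1..<Suc n]) (n - k n)" "t n * V n \<omega> > 0"
        using g' by (simp_all only: mult_pos_pos, simp add: V_def xs_def del: upt_Suc)
      have vp: "v > 0" using g' by (simp add: v_def)
      have ve: "exp (- s' * L p) = v powr (- s')" "v powr s' = inverse (v powr (- s'))"
        using vp by (auto simp: L_def p v_def[symmetric] powr_def exp_minus)
      \<comment> \<open>Excesses in \<open>E_stat\<close> are relative to \<open>t * V\<close>,
        those in \<open>H\<close> to \<open>t\<close>; \<open>w\<close> is the factor between the
        two scales.\<close>
      define w where "w = v powr (- s')"
      have wp: "w > 0" using vp by (simp add: w_def)
      have E: "E_stat (xs n \<omega>) (k n) s' = 1 + (\<Sum>i=1..n. max 1 (X i \<omega> / (t n * V n \<omega>)) powr s' - 1) / real (k n)"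
        unfolding xs_def by (rule E_stat_sample[OF g'(1,2) os])
      have "(\<Sum>i=1..n. max 1 (X i \<omega> / (t n * V n \<omega>)) powr s' - 1) = (\<Sum>i=1..n. s' * w * (?\<Phi> (max v (X i \<omega> / t n)) - ?\<Phi> v))"
      proof (intro sum.cong refl)
        fix i
        have "max 1 (X i \<omega> / (t n * V n \<omega>)) = max v (X i \<omega> / t n) / v" using g' by (auto simp: max_def field_simps v_def)
        then have "max 1 (X i \<omega> / (t n * V n \<omega>)) powr s' = (max v (X i \<omega> / t n) / v) powr s'" by (simp only:)
        also have "\<dots> = max v (X i \<omega> / t n) powr s' / v powr s'" by (rule powr_divide)
        also have "\<dots> = max v (X i \<omega> / t n) powr s' * w" by (simp add: ve(2) w_def divide_inverse)
        finally have "max 1 (X i \<omega> / (t n * V n \<omega>)) powr s' = max v (X i \<omega> / t n) powr s' * w" .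
        moreover have "v powr s' * w = 1" using wp ve(2) by (simp add: w_def)
        ultimately show "max 1 (X i \<omega> / (t n * V n \<omega>)) powr s' - 1 = s' * w * (?\<Phi> (max v (X i \<omega> / t n)) - ?\<Phi> v)"
          using s' by (simp add: algebra_simps)
      qed
      also have "\<dots> = s' * w * H" by (simp add: H_def v_def sum_distrib_left)
      finally have E: "E_stat (xs n \<omega>) (k n) s' = 1 + s' * w * H / real (k n)" using E by simp
      have mono: "?\<Phi> a \<le> ?\<Phi> b" if "0 < a" "a \<le> b" for a b
        using that s' by (intro divide_right_mono_neg powr_mono2') auto
      have kapZ: "kap s' (Z n i \<omega>) = ?\<Phi> (max 1 (X i \<omega> / t n)) - ?\<Phi> 1" for i
        using s' by (simp add: kap_def Z_def powr_def less_max_iff_disj diff_divide_distrib)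
      have P: "?\<Phi> v - ?\<Phi> 1 = (1 / w - 1) / s'" using ve(2) s' by (simp add: w_def diff_divide_distrib inverse_eq_divide)
      have bnd: "\<bar>G - H - r * r * ((1 / w - 1) / s')\<bar> \<le> r * \<bar>T n 0 \<omega>\<bar> * \<bar>(1 / w - 1) / s'\<bar>"
      proof -
        note excess_sum_change[OF g', of ?\<Phi>]
        then show ?thesis using mono unfolding G_def H_def kapZ r(2) P[symmetric] v_def unfolding r_def by blast
      qed
      have J: "1 - \<xi> * s' > 0" using xi_pos s' by (meson diff_gt_0_iff_gt less_trans mult_pos_neg zero_less_one)
      have A: "A p = r * (1 + s' * w * H / (r * r) - 1 / (1 - \<xi> * s'))"
        by (simp add: A_def p s'_def[symmetric, unfolded p] E r r_def[symmetric])
      have Th: "\<Theta> n s' \<omega> = r * (G / (r * r) - \<xi> / (1 - \<xi> * s'))" by (simp add: \<Theta>_def G_def r r_def[symmetric])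
      have gw: "g (- s' * L p) * (- s') * U p = r * (w - 1)"
      proof -
        have "g (- s' * L p) * (- s') * U p = r * (g (- s' * L p) * (- s' * L p))"
          by (simp add: U_def L_def p r_def)
        also have "\<dots> = r * (w - 1)" unfolding g(1)[symmetric] ve(1) w_def ..
        finally show ?thesis .
      qed
      have "B p = (g (- s' * L p) * (- s') * U p) / (1 - \<xi> * s') + s' * w * \<Theta> n s' \<omega>"
        using ve(1) by (simp add: B_def p s'_def w_def)
      then have B: "B p = r * (w - 1) / (1 - \<xi> * s') + s' * w * \<Theta> n s' \<omega>" unfolding gw .
      have "A p - B p = - (s' * w / r) * (G - H - r * r * ((1 / w - 1) / s'))"
      proof -
        define c where "c = 1 / (1 - \<xi> * s')"
        \<comment> \<open>This relation between the centrings of \<open>E_stat\<close> and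
          \<open>\<Theta>\<close> makes the terms of order \<open>sqrt k\<close> in
          \<open>A p - B p\<close> match the threshold term of
          \<open>excess_sum_change\<close>.\<close>
        have c: "s' * (\<xi> * c) = c - 1" using J by (simp add: c_def field_simps)
        have "\<xi> / (1 - \<xi> * s') = \<xi> * c" by (simp add: c_def)
        then have e1: "s' * w * \<Theta> n s' \<omega> = s' * w * G / r - w * r * (s' * (\<xi> * c))"
          unfolding Th using r(1) by (simp add: field_simps)
        have e2: "A p = r + s' * w * H / r - r * c"
          unfolding A c_def[symmetric] using r(1) by (simp add: algebra_simps)
        have e3: "- (s' * w / r) * (G - H - r * r * ((1 / w - 1) / s')) = - (s' * w * G / r) + s' * w * H / r + r - r * w"
          using r(1) wp s' by (simp add: field_simps)
        have e4: "B p = r * (w - 1) * c + s' * w * \<Theta> n s' \<omega>" unfolding B by (simp add: c_def)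
        show ?thesis unfolding e3 unfolding e2 e4 e1 c by (simp add: algebra_simps)
      qed
      then have "\<bar>A p - B p\<bar> = \<bar>s'\<bar> * w / r * \<bar>G - H - r * r * ((1 / w - 1) / s')\<bar>"
        using r wp by (simp add: abs_mult)
      also have "\<dots> \<le> \<bar>s'\<bar> * w / r * (r * \<bar>T n 0 \<omega>\<bar> * \<bar>(1 / w - 1) / s'\<bar>)"
        using bnd r wp by (intro mult_left_mono) auto
      also have "\<dots> = \<bar>T n 0 \<omega>\<bar> * \<bar>w * (1 / w - 1)\<bar>" using r wp s' by (simp add: abs_mult)
      also have "w * (1 / w - 1) = 1 - w" using wp by (simp add: field_simps)
      finally show ?case using ve(1) by (simp add: p s'_def[symmetric, unfolded p] w_def mult.commute)
    qed
  qed
  \<comment> \<open>From here on each random coefficient is replaced by its limit; every replacement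
    error is a vanishing factor times a tight one.\<close>
  have "((\<lambda>p. g (- S p * L p) * (- S p) / (1 - \<xi> * S p) - (- s / (1 - \<xi> * s))) \<longlongrightarrow> g 0 * (- s) / (1 - \<xi> * s) - (- s / (1 - \<xi> * s))) (prob_filter M)"
    using den by (intro tendsto_intros isCont_tendsto_compose[OF g(2) SL] S) auto
  then have c1: "((\<lambda>p. (g (- S p * L p) * (- S p) / (1 - \<xi> * S p) - (- s / (1 - \<xi> * s))) * U p) \<longlongrightarrow> 0) (prob_filter M)"
    by (intro tendsto_0_mult_tight U_tight) (simp add: g)
  have c2: "((\<lambda>p. (- s / (1 - \<xi> * s)) * (U p - \<xi> * T (fst p) 0 (snd p))) \<longlongrightarrow> 0) (prob_filter M)"
    using tendsto_mult[OF tendsto_const[of "- s / (1 - \<xi> * s)"] Bahadur] by (simp only: mult_zero_right)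
  have Rt: "tight M (\<lambda>p. \<bar>R (fst p) (snd p)\<bar>)" by (rule tight_mono[OF R_tight]) simp
  have tTh: "tight M (\<lambda>p. \<Theta> (fst p) (S p) (snd p))"
    by (rule tight_mono[OF R_tight])
      (use eventually_good Sneg in \<open>eventually_elim, auto intro: order_trans[OF Theta_bound abs_ge_self]\<close>)
  have "((\<lambda>p. S p * exp (- S p * L p) - s) \<longlongrightarrow> s * 1 - s) (prob_filter M)" by (intro tendsto_intros S eSL)
  then have c3: "((\<lambda>p. (S p * exp (- S p * L p) - s) * \<Theta> (fst p) (S p) (snd p)) \<longlongrightarrow> 0) (prob_filter M)"
    by (intro tendsto_0_mult_tight tTh) simp
  have "((\<lambda>p. \<bar>S p - s\<bar>) \<longlongrightarrow> 0) (prob_filter M)"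
    using tendsto_rabs_zero[OF tendsto_diff[OF S tendsto_const[of s], simplified]] .
  from tendsto_0_mult_tight[OF this Rt]
  have "((\<lambda>p. \<Theta> (fst p) (S p) (snd p) - \<Theta> (fst p) s (snd p)) \<longlongrightarrow> 0) (prob_filter M)"
  proof (rule Lim_null_comparison[rotated])
    show "\<forall>\<^sub>F p in prob_filter M. norm (\<Theta> (fst p) (S p) (snd p) - \<Theta> (fst p) s (snd p)) \<le> \<bar>S p - s\<bar> * \<bar>R (fst p) (snd p)\<bar>"
      using eventually_good Sneg
    proof eventually_elim
      case (elim p)
      have "\<bar>\<Theta> (fst p) (S p) (snd p) - \<Theta> (fst p) s (snd p)\<bar> \<le> \<bar>S p - s\<bar> * R (fst p) (snd p)"
        by (rule Theta_Lipschitz) (use elim s in auto)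
      also have "\<dots> \<le> \<bar>S p - s\<bar> * \<bar>R (fst p) (snd p)\<bar>" by (intro mult_left_mono) auto
      finally show ?case by simp
    qed
  qed
  from tendsto_mult[OF tendsto_const[of s] this]
  have c4: "((\<lambda>p. s * (\<Theta> (fst p) (S p) (snd p) - \<Theta> (fst p) s (snd p))) \<longlongrightarrow> 0) (prob_filter M)" by simp
  have "((\<lambda>p. (A p - B p) + (g (- S p * L p) * (- S p) / (1 - \<xi> * S p) - (- s / (1 - \<xi> * s))) * U p
     + (- s / (1 - \<xi> * s)) * (U p - \<xi> * T (fst p) 0 (snd p)) + (S p * exp (- S p * L p) - s) * \<Theta> (fst p) (S p) (snd p)
     + s * (\<Theta> (fst p) (S p) (snd p) - \<Theta> (fst p) s (snd p))) \<longlongrightarrow> 0 + 0 + 0 + 0 + 0) (prob_filter M)"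
    by (intro tendsto_add AB c1 c2 c3 c4)
  then show ?thesis by (simp add: A_def B_def algebra_simps)
qed

end

lemma one_plus_le_exp:
  fixes y \<eta> :: real
  assumes "\<eta> > 0" "y \<ge> 0"
  shows "1 + y \<le> (1 + 1 / \<eta>) * exp (\<eta> * y)"
proof -
  have "1 + y \<le> (1 + 1 / \<eta>) * (1 + \<eta> * y)" using assms by (simp add: field_simps)
  also have "\<dots> \<le> (1 + 1 / \<eta>) * exp (\<eta> * y)" using assms by (intro mult_left_mono exp_ge_add_one_self) (auto simp: add_pos_pos)
  finally show ?thesis .
qed

section \<open>Limit law of the linear score sums\<close>

context tail_array
begin

lemma F_mono: "mono F"
proof (rule monoI)
  fix a b :: real assume "a \<le> b"
  interpret D: real_distribution "distr M borel (X 0)" by (rule real_distribution_distr) simp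
  show "F a \<le> F b" using D.cdf_nondecreasing[OF \<open>a \<le> b\<close>] by (simp add: cdf_X)
qed

lemma F_meas[measurable]: "F \<in> borel_measurable borel"
  by (rule borel_measurable_mono[OF F_mono])

lemma prob_Z:
  assumes "t n > 0" "y \<ge> 0"
  shows "prob {\<omega>\<in>space M. Z n i \<omega> > y} = 1 - F (t n * exp y)"
proof -
  have "exp y \<ge> 1" using assms by simp
  have "y < Z n i \<omega> \<longleftrightarrow> t n * exp y < X i \<omega>" for \<omega>
  proof -
    have "y < Z n i \<omega> \<longleftrightarrow> exp y < max 1 (X i \<omega> / t n)" unfolding Z_def
      by (subst exp_less_cancel_iff[symmetric]) (simp add: exp_ln less_max_iff_disj)
    also have "\<dots> \<longleftrightarrow> t n * exp y < X i \<omega>" using \<open>exp y \<ge> 1\<close> assms by (auto simp: less_max_iff_disj field_simps)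
    finally show ?thesis .
  qed
  then show ?thesis using prob_greater[of "t n * exp y" i] by simp
qed

lemma Z_meas[measurable]: "Z n i \<in> borel_measurable M"
  unfolding Z_def[abs_def] by measurable

text \<open>\<open>tail_expectation\<close> writes the scaled moment as an integral of
  \<open>f'\<close> against the scaled tail. The exponential part of the tail gives the constant,
  and the deviation, multiplied by \<open>sqrt k\<close>, converges by dominated
  convergence.\<close>

lemma moment_limit:
  fixes f f' :: "real \<Rightarrow> real"
  assumes der: "\<And>y. (f has_real_derivative f' y) (at y)" and cont: "continuous_on UNIV f'"
    and bnd: "\<And>y. y \<ge> 0 \<Longrightarrow> \<bar>f' y\<bar> \<le> B * exp (b * y)" and b: "b < 1 / \<xi>"
  shows "\<forall>\<^sub>F n in sequentially. integrable M (\<lambda>\<omega>. of_bool (Z n i \<omega> > 0) * f (Z n i \<omega>))" (is ?I)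
    and "(\<lambda>n. sqrt (real (k n)) * (real n / real (k n) * expectation (\<lambda>\<omega>. of_bool (Z n i \<omega> > 0) * f (Z n i \<omega>))
        - (f 0 + (LINT y|lborel. indicator {0..} y * (f' y * exp (- y / \<xi>))))))
      \<longlonglongrightarrow> lam / \<xi> * (f 0 + (LINT y|lborel. indicator {0..} y * (f' y * exp (\<tau> * y) * exp (- y / \<xi>))))" (is ?L)
proof -
  have [measurable]: "f' \<in> borel_measurable borel" using cont by (rule borel_measurable_continuous_onI)
  have B: "B \<ge> 0" using bnd[of 0] by simp
  \<comment> \<open>A measurable stand-in for \<open>d n\<close>, whose measurability in
    \<open>y\<close> is not assumed; the two agree for large \<open>n\<close>.\<close>
  define D where "D n y = real n / real (k n) * (1 - F (t n * exp y)) * exp (y / \<xi>) - 1" for n y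
  have [measurable]: "D n \<in> borel_measurable borel" for n unfolding D_def[abs_def] by measurable
  define G where "G n y = indicator {0..} y * (f' y * exp (- y / \<xi>) * (sqrt (real (k n)) * D n y))" for n y
  let ?w = "\<lambda>y. B * \<bar>K\<bar> * (indicator {0..} y * exp (- (1 / \<xi> - b) * y))"
  have w: "integrable lborel ?w"
    using has_bochner_integral_exp[of "1 / \<xi> - b"] b by (intro integrable_mult_right) (auto simp: has_bochner_integral_iff)
  have good: "\<forall>\<^sub>F n in sequentially. k n > 0 \<and> k n < n \<and> t n > 0 \<and> (\<forall>y. D n y = d n y)
      \<and> (\<forall>y\<ge>0. sqrt (real (k n)) * \<bar>d n y\<bar> \<le> K)"
    using k_pos k_less t_pos tail d_bound
  proof eventually_elim
    case (elim n)
    have "D n y = d n y" for y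
    proof -
      have "D n y = (exp (- y / \<xi>) * exp (y / \<xi>)) * (1 + d n y) - 1"
        unfolding D_def elim(4)[rule_format, of y] by (simp only: mult_ac)
      also have "exp (- y / \<xi>) * exp (y / \<xi>) = 1" by (simp flip: exp_add)
      finally show ?thesis by simp
    qed
    then show ?case using elim by blast
  qed
  then obtain n0 where n0: "\<And>n. n \<ge> n0 \<Longrightarrow> k n > 0 \<and> k n < n \<and> t n > 0 \<and> (\<forall>y. D n y = d n y)
      \<and> (\<forall>y\<ge>0. sqrt (real (k n)) * \<bar>d n y\<bar> \<le> K)" by (auto simp: eventually_sequentially)
  have Gw: "norm (G n y) \<le> ?w y" if "n \<ge> n0" for n y
  proof (cases "y \<ge> 0")
    case True
    have "norm (G n y) = (\<bar>f' y\<bar> * exp (- y / \<xi>)) * (sqrt (real (k n)) * \<bar>d n y\<bar>)"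
      using n0[OF that] True by (simp add: G_def abs_mult)
    also have "\<dots> \<le> ((B * exp (b * y)) * exp (- y / \<xi>)) * \<bar>K\<bar>"
      using n0[OF that] True bnd[OF True] B by (intro mult_mono) (auto intro: order_trans[OF _ abs_ge_self])
    also have "\<dots> = B * \<bar>K\<bar> * (exp (b * y) * exp (- y / \<xi>))" by (simp only: mult_ac)
    also have "exp (b * y) * exp (- y / \<xi>) = exp (- (1 / \<xi> - b) * y)" by (simp add: algebra_simps flip: exp_add)
    finally show ?thesis using True by simp
  qed (simp add: G_def)
  have Glim: "(\<lambda>n. G n y) \<longlonglongrightarrow> indicator {0..} y * (f' y * exp (- y / \<xi>) * (lam / \<xi> * exp (\<tau> * y)))" for y
  proof (cases "y \<ge> 0")
    case True
    have "\<forall>\<^sub>F n in sequentially. sqrt (real (k n)) * d n y = sqrt (real (k n)) * D n y"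
      using good by eventually_elim simp
    then have "(\<lambda>n. sqrt (real (k n)) * D n y) \<longlonglongrightarrow> lam / \<xi> * exp (\<tau> * y)"
      by (rule Lim_transform_eventually[OF d_lim[OF True]])
    from tendsto_mult[OF tendsto_const tendsto_mult[OF tendsto_const this]] show ?thesis unfolding G_def .
  qed (simp add: G_def)
  \<comment> \<open>The dominating function is valid from \<open>n0\<close> on, hence the shifted
    sequence.\<close>
  have "(\<lambda>n. LINT y|lborel. G (n + n0) y) \<longlonglongrightarrow> (LINT y|lborel. indicator {0..} y * (f' y * exp (- y / \<xi>) * (lam / \<xi> * exp (\<tau> * y))))"
  proof (rule integral_dominated_convergence[where w="?w"])
    show "AE y in lborel. (\<lambda>n. G (n + n0) y) \<longlonglongrightarrow> indicator {0..} y * (f' y * exp (- y / \<xi>) * (lam / \<xi> * exp (\<tau> * y)))"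
      using LIMSEQ_ignore_initial_segment[OF Glim] by (intro AE_I2)
    show "AE y in lborel. norm (G (n + n0) y) \<le> ?w y" for n by (intro AE_I2 Gw) simp
  qed (use w in \<open>auto simp: G_def\<close>)
  then have L1: "(\<lambda>n. LINT y|lborel. G n y) \<longlonglongrightarrow> (LINT y|lborel. indicator {0..} y * (f' y * exp (- y / \<xi>) * (lam / \<xi> * exp (\<tau> * y))))"
    by (rule LIMSEQ_offset)
  have i0: "integrable lborel (\<lambda>y. indicator {0..} y * (f' y * exp (- y / \<xi>)))"
  proof (rule Bochner_Integration.integrable_bound)
    show "integrable lborel (\<lambda>y. B * (indicator {0..} y * exp (- (1 / \<xi> - b) * y)))"
      using has_bochner_integral_exp[of "1 / \<xi> - b"] b by (intro integrable_mult_right) (auto simp: has_bochner_integral_iff)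
    show "AE y in lborel. norm (indicator {0..} y * (f' y * exp (- y / \<xi>))) \<le> norm (B * (indicator {0..} y * exp (- (1 / \<xi> - b) * y)))"
    proof (rule AE_I2)
      fix y :: real
      show "norm (indicator {0..} y * (f' y * exp (- y / \<xi>))) \<le> norm (B * (indicator {0..} y * exp (- (1 / \<xi> - b) * y)))"
      proof (cases "y \<ge> 0")
        case True
        have "\<bar>f' y\<bar> * exp (- y / \<xi>) \<le> (B * exp (b * y)) * exp (- y / \<xi>)" by (intro mult_right_mono bnd True) auto
        also have "\<dots> = B * (exp (b * y) * exp (- y / \<xi>))" by (simp only: mult_ac)
        also have "exp (b * y) * exp (- y / \<xi>) = exp (- (1 / \<xi> - b) * y)" by (simp add: algebra_simps flip: exp_add)
        finally show ?thesis using True B by (simp add: abs_mult)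
      qed simp
    qed
  qed measurable
  have main: "integrable M (\<lambda>\<omega>. of_bool (Z n i \<omega> > 0) * f (Z n i \<omega>)) \<and>
      sqrt (real (k n)) * (real n / real (k n) * expectation (\<lambda>\<omega>. of_bool (Z n i \<omega> > 0) * f (Z n i \<omega>))
        - (f 0 + (LINT y|lborel. indicator {0..} y * (f' y * exp (- y / \<xi>)))))
      = f 0 * (sqrt (real (k n)) * d n 0) + (LINT y|lborel. G n y)" if n: "n \<ge> n0" for n
  proof -
    have kp: "real (k n) \<ge> 1" "real n > 0" "t n > 0" using n0[OF n] by auto
    have pr: "prob {\<omega>\<in>space M. Z n i \<omega> > y} = real (k n) / real n * (exp (- y / \<xi>) * (1 + D n y))" if "y \<ge> 0" for y
      unfolding prob_Z[OF kp(3) that] D_def using kp by (simp add: exp_minus field_simps)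
    have dK: "\<bar>d n y\<bar> \<le> \<bar>K\<bar>" if "y \<ge> 0" for y
    proof -
      have "1 * \<bar>d n y\<bar> \<le> sqrt (real (k n)) * \<bar>d n y\<bar>" using kp by (intro mult_right_mono) auto
      then show ?thesis using n0[OF n] that by fastforce
    qed
    have tl: "prob {\<omega>\<in>space M. Z n i \<omega> > y} \<le> (real (k n) / real n * (1 + \<bar>K\<bar>)) * exp (- (1 / \<xi>) * y)" if "y \<ge> 0" for y
    proof -
      have "prob {\<omega>\<in>space M. Z n i \<omega> > y} \<le> real (k n) / real n * (exp (- y / \<xi>) * (1 + \<bar>K\<bar>))"
        unfolding pr[OF that] using dK[OF that] n0[OF n] by (intro mult_left_mono) auto
      then show ?thesis by (simp add: mult_ac)
    qed
    note TE = tail_expectation[OF Z_meas Z_nonneg der cont bnd tl b]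
    have iG: "integrable lborel (G n)"
    proof (rule Bochner_Integration.integrable_bound[OF w])
      show "G n \<in> borel_measurable lborel" unfolding G_def[abs_def] by measurable
      have "norm (G n y) \<le> norm (?w y)" for y
        using Gw[OF n, of y] abs_ge_self[of "?w y"] unfolding real_norm_def by linarith
      then show "AE y in lborel. norm (G n y) \<le> norm (?w y)" by (rule AE_I2)
    qed
    have "expectation (\<lambda>\<omega>. of_bool (Z n i \<omega> > 0) * f (Z n i \<omega>)) = f 0 * (real (k n) / real n * (1 + d n 0)) +
      (LINT y|lborel. real (k n) / real n * (indicator {0..} y * (f' y * exp (- y / \<xi>)) + G n y / sqrt (real (k n))))"
    proof -
      have "(LINT y|lborel. indicator {0..} y * (f' y * prob {\<omega>\<in>space M. Z n i \<omega> > y})) =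
        (LINT y|lborel. real (k n) / real n * (indicator {0..} y * (f' y * exp (- y / \<xi>)) + G n y / sqrt (real (k n))))"
      proof (intro Bochner_Integration.integral_cong refl)
        fix y :: real
        show "indicator {0..} y * (f' y * prob {\<omega>\<in>space M. Z n i \<omega> > y}) =
          real (k n) / real n * (indicator {0..} y * (f' y * exp (- y / \<xi>)) + G n y / sqrt (real (k n)))"
          using pr[of y] kp by (cases "y \<ge> 0") (simp_all add: G_def algebra_simps)
      qed
      then show ?thesis using TE(2) pr[of 0] n0[OF n] by simp
    qed
    also have "(LINT y|lborel. real (k n) / real n * (indicator {0..} y * (f' y * exp (- y / \<xi>)) + G n y / sqrt (real (k n))))
      = real (k n) / real n * ((LINT y|lborel. indicator {0..} y * (f' y * exp (- y / \<xi>))) + (LINT y|lborel. G n y) / sqrt (real (k n)))"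
      using i0 iG by (simp add: Bochner_Integration.integral_add)
    finally have e: "expectation (\<lambda>\<omega>. of_bool (Z n i \<omega> > 0) * f (Z n i \<omega>)) = real (k n) / real n *
       (f 0 * (1 + d n 0) + (LINT y|lborel. indicator {0..} y * (f' y * exp (- y / \<xi>))) + (LINT y|lborel. G n y) / sqrt (real (k n)))"
      by (simp add: algebra_simps add_divide_distrib)
    show ?thesis unfolding e using TE(1) kp by (simp add: algebra_simps)
  qed
  show ?I using main by (auto simp: eventually_sequentially)
  have eq: "(LINT y|lborel. indicator {0..} y * (f' y * exp (- y / \<xi>) * (lam / \<xi> * exp (\<tau> * y)))) =
     lam / \<xi> * (LINT y|lborel. indicator {0..} y * (f' y * exp (\<tau> * y) * exp (- y / \<xi>)))"
    by (subst integral_mult_right_zero[symmetric]) (intro Bochner_Integration.integral_cong refl, simp)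
  have "(\<lambda>n. f 0 * (sqrt (real (k n)) * d n 0) + (LINT y|lborel. G n y)) \<longlonglongrightarrow> f 0 * (lam / \<xi>)
      + lam / \<xi> * (LINT y|lborel. indicator {0..} y * (f' y * exp (\<tau> * y) * exp (- y / \<xi>)))"
    using d_lim[of 0] L1 unfolding eq by (intro tendsto_add tendsto_mult tendsto_const) auto
  moreover have "f 0 * (lam / \<xi>) + lam / \<xi> * (LINT y|lborel. indicator {0..} y * (f' y * exp (\<tau> * y) * exp (- y / \<xi>)))
      = lam / \<xi> * (f 0 + (LINT y|lborel. indicator {0..} y * (f' y * exp (\<tau> * y) * exp (- y / \<xi>))))"
    by (simp only: distrib_left mult.commute)
  ultimately have lim: "(\<lambda>n. f 0 * (sqrt (real (k n)) * d n 0) + (LINT y|lborel. G n y)) \<longlonglongrightarrow>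
      lam / \<xi> * (f 0 + (LINT y|lborel. indicator {0..} y * (f' y * exp (\<tau> * y) * exp (- y / \<xi>))))"
    by (simp only:)
  show ?L
    by (rule Lim_transform_eventually[OF lim], rule eventually_sequentiallyI[of n0]) (use main in simp)
qed

text \<open>Both parts are centred under the exponential law with mean \<open>\<xi>\<close>, the
  limit law of a log excess.\<close>

definition score :: "real \<Rightarrow> real \<Rightarrow> real \<Rightarrow> real" where
  "score \<alpha> \<beta> y = \<alpha> * (y - \<xi>) - \<beta> * (exp (\<tau> * y) - 1 / (1 - \<xi> * \<tau>))"

text \<open>Since \<open>score \<alpha> \<beta> 0\<close> is nonzero in general, the indicator
  matters: observations below the threshold contribute nothing, and each exceedance brings its own
  centring.\<close>

definition score_sum :: "real \<Rightarrow> real \<Rightarrow> nat \<Rightarrow> 'a \<Rightarrow> real" where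
  "score_sum \<alpha> \<beta> n \<omega> = (\<Sum>i=1..n. of_bool (Z n i \<omega> > 0) * score \<alpha> \<beta> (Z n i \<omega>) / sqrt (real (k n)))"

lemma score_sum_meas[measurable]: "score_sum \<alpha> \<beta> n \<in> borel_measurable M"
  unfolding score_sum_def[abs_def] score_def by measurable

lemma rho_less: "1 - \<xi> * \<tau> > 0" "1 - 2 * (\<xi> * \<tau>) > 0"
  using mult_pos_neg[OF xi_pos tau_neg] by auto

text \<open>Centring once per exceedance, that is \<open>N n 0\<close> times instead of
  \<open>k n\<close> times, produces the terms in \<open>T n 0\<close>. They are exactly the
  threshold corrections in \<open>hill_expansion\<close> and
  \<open>E_stat_expansion\<close>.\<close>

lemma score_sum_eq:
  assumes "k n > 0" "t n > 0"
  shows "score_sum \<alpha> \<beta> n \<omega> = \<alpha> * (\<Theta> n 0 \<omega> - \<xi> * T n 0 \<omega>) - \<beta> * (\<tau> * \<Theta> n \<tau> \<omega> - \<xi> * \<tau> / (1 - \<xi> * \<tau>) * T n 0 \<omega>)"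
proof -
  define r where "r = sqrt (real (k n))"
  have r: "r > 0" "real (k n) = r * r" using assms by (auto simp: r_def)
  define q where "q = 1 / (1 - \<xi> * \<tau>)"
  have q: "\<xi> * \<tau> / (1 - \<xi> * \<tau>) = q - 1" using rho_less by (simp add: q_def field_simps)
  define c where "c i = (of_bool (0 < Z n i \<omega>) :: real)" for i
  have NN: "N n 0 \<omega> = (\<Sum>i=1..n. c i)" using N_Z[OF assms(2), of 0 \<omega>] by (simp add: c_def)
  define A where "A = (\<Sum>i=1..n. Z n i \<omega>)"
  define b where "b i = exp (\<tau> * Z n i \<omega>) - 1" for i
  define B where "B = (\<Sum>i=1..n. b i)"
  have "of_bool (Z n i \<omega> > 0) * score \<alpha> \<beta> (Z n i \<omega>) = \<alpha> * (Z n i \<omega>) - \<alpha> * \<xi> * c i - \<beta> * b i + \<beta> * (q - 1) * c i" for i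
    unfolding score_def q_def[symmetric] c_def b_def
    using Z_nonneg[of n i \<omega>] by (cases "Z n i \<omega> = 0") (auto simp: algebra_simps)
  then have "score_sum \<alpha> \<beta> n \<omega> = (\<Sum>i=1..n. \<alpha> * (Z n i \<omega>) - \<alpha> * \<xi> * c i - \<beta> * b i + \<beta> * (q - 1) * c i) / r"
    by (simp add: score_sum_def r_def sum_divide_distrib)
  also have "(\<Sum>i=1..n. \<alpha> * (Z n i \<omega>) - \<alpha> * \<xi> * c i - \<beta> * b i + \<beta> * (q - 1) * c i)
     = \<alpha> * A - \<alpha> * \<xi> * N n 0 \<omega> - \<beta> * B + \<beta> * (q - 1) * N n 0 \<omega>"
    unfolding A_def B_def NN by (simp only: sum.distrib sum_subtractf sum_distrib_left)
  finally have S: "score_sum \<alpha> \<beta> n \<omega> = (\<alpha> * A - \<alpha> * \<xi> * N n 0 \<omega> - \<beta> * B + \<beta> * (q - 1) * N n 0 \<omega>) / r" .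
  have T0: "T n 0 \<omega> = N n 0 \<omega> / r - r" using r by (simp add: T_def r_def[symmetric] field_simps)
  have Th0: "\<Theta> n 0 \<omega> = A / r - r * \<xi>" using r by (simp add: \<Theta>_def kap_def A_def r_def[symmetric] field_simps)
  have Tht: "\<tau> * \<Theta> n \<tau> \<omega> = B / r - r * (q - 1)"
  proof -
    have "(\<Sum>i=1..n. kap \<tau> (Z n i \<omega>)) = B / \<tau>" using tau_neg by (simp add: kap_def B_def b_def sum_divide_distrib)
    then have "\<tau> * \<Theta> n \<tau> \<omega> = \<tau> * (r * (B / \<tau> / (r * r) - \<xi> / (1 - \<xi> * \<tau>)))"
      unfolding \<Theta>_def r_def[symmetric] unfolding r(2) by simp
    also have "\<dots> = B / r - r * (\<xi> * \<tau> / (1 - \<xi> * \<tau>))" using r(1) tau_neg by (simp add: algebra_simps)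
    finally show ?thesis unfolding q .
  qed
  show ?thesis unfolding S T0 Th0 Tht q using r(1) by (simp add: field_simps)
qed

text \<open>The powers 1 and 2 serve the mean and the variance; 2 and 4 together bound the third
  absolute moment in Lyapunov's condition while staying polynomial in the score.\<close>

lemma score_power_moment:
  fixes \<alpha> \<beta> :: real and i j :: nat
  assumes "j \<in> {1, 2, 4}"
  defines "f \<equiv> \<lambda>y. score \<alpha> \<beta> y ^ j" and "f' \<equiv> \<lambda>y. real j * score \<alpha> \<beta> y ^ (j - 1) * (\<alpha> - \<beta> * \<tau> * exp (\<tau> * y))"
  shows "\<forall>\<^sub>F n in sequentially. integrable M (\<lambda>\<omega>. of_bool (Z n i \<omega> > 0) * f (Z n i \<omega>))"
    and "(\<lambda>n. sqrt (real (k n)) * (real n / real (k n) * expectation (\<lambda>\<omega>. of_bool (Z n i \<omega> > 0) * f (Z n i \<omega>))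
        - (f 0 + (LINT y|lborel. indicator {0..} y * (f' y * exp (- y / \<xi>))))))
      \<longlonglongrightarrow> lam / \<xi> * (f 0 + (LINT y|lborel. indicator {0..} y * (f' y * exp (\<tau> * y) * exp (- y / \<xi>))))"
proof -
  \<comment> \<open>The score grows linearly, hence is dominated by a multiple of
    \<open>exp (\<eta> * y)\<close>. The derivative of its fourth power contains its cube, and
    \<open>3 * \<eta> < 1 / \<xi>\<close> keeps this below the decay of the tail.\<close>
  define \<eta> where "\<eta> = 1 / (4 * \<xi>)"
  have \<eta>: "\<eta> > 0" using xi_pos by (simp add: \<eta>_def)
  define q where "q = 1 / (1 - \<xi> * \<tau>)"
  define C where "C = 1 + \<bar>\<alpha>\<bar> * (1 + \<xi>) + \<bar>\<beta>\<bar> * (1 + \<bar>q\<bar>)"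
  define C3 where "C3 = C * (1 + 1 / \<eta>)"
  define C2 where "C2 = \<bar>\<alpha>\<bar> + \<bar>\<beta>\<bar> * \<bar>\<tau>\<bar>"
  have C1: "C \<ge> 1" using xi_pos by (auto simp: C_def intro!: add_nonneg_nonneg)
  then have C31: "C3 \<ge> 1" unfolding C3_def using \<eta> mult_mono[of 1 C 1 "1 + 1 / \<eta>"] by simp
  have sc: "\<bar>score \<alpha> \<beta> y\<bar> \<le> C3 * exp (\<eta> * y)" if y: "y \<ge> 0" for y
  proof -
    have e: "exp (\<tau> * y) \<le> 1" using tau_neg y by (simp add: mult_nonpos_nonneg)
    have "\<bar>score \<alpha> \<beta> y\<bar> \<le> \<bar>\<alpha>\<bar> * \<bar>y - \<xi>\<bar> + \<bar>\<beta>\<bar> * \<bar>exp (\<tau> * y) - q\<bar>"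
      unfolding score_def q_def[symmetric] by (rule order_trans[OF abs_triangle_ineq4]) (simp add: abs_mult)
    also have "\<dots> \<le> \<bar>\<alpha>\<bar> * ((1 + \<xi>) * (1 + y)) + \<bar>\<beta>\<bar> * ((1 + \<bar>q\<bar>) * (1 + y))"
    proof (intro add_mono mult_left_mono)
      have "0 \<le> \<xi> * y" using xi_pos y by simp
      then show "\<bar>y - \<xi>\<bar> \<le> (1 + \<xi>) * (1 + y)" using xi_pos y by (simp add: algebra_simps abs_le_iff)
      have "\<bar>exp (\<tau> * y) - q\<bar> \<le> 1 + \<bar>q\<bar>" unfolding abs_le_iff using e exp_gt_zero[of "\<tau> * y"] by linarith
      also have "\<dots> \<le> (1 + \<bar>q\<bar>) * (1 + y)" using y by (simp add: mult_left_mono algebra_simps)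
      finally show "\<bar>exp (\<tau> * y) - q\<bar> \<le> (1 + \<bar>q\<bar>) * (1 + y)" .
    qed auto
    also have "\<dots> \<le> C * (1 + y)" using y by (simp add: C_def algebra_simps)
    also have "\<dots> \<le> C * ((1 + 1 / \<eta>) * exp (\<eta> * y))" using C1 by (intro mult_left_mono one_plus_le_exp \<eta> y) auto
    finally show ?thesis by (simp add: C3_def mult.assoc)
  qed
  have derf: "(f has_real_derivative f' y) (at y)" for y
    unfolding f_def f'_def score_def by (auto intro!: derivative_eq_intros simp: algebra_simps)
  have contf: "continuous_on UNIV f'"
    unfolding f'_def score_def by (auto intro!: continuous_intros)
  have bndf: "\<bar>f' y\<bar> \<le> (4 * C3 ^ 3 * C2) * exp (3 * \<eta> * y)" if y: "y \<ge> 0" for y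
  proof -
    have e: "exp (\<tau> * y) \<le> 1" using tau_neg y by (simp add: mult_nonpos_nonneg)
    have g1: "C3 * exp (\<eta> * y) \<ge> 1" using C31 \<eta> y mult_mono[of 1 C3 1 "exp (\<eta> * y)"] by simp
    have j: "j - 1 \<le> 3" "real j \<le> 4" using assms(1) by auto
    have "\<bar>score \<alpha> \<beta> y ^ (j - 1)\<bar> \<le> (C3 * exp (\<eta> * y)) ^ (j - 1)"
      unfolding power_abs by (intro power_mono sc y) auto
    also have "\<dots> \<le> (C3 * exp (\<eta> * y)) ^ 3" by (rule power_increasing[OF j(1) g1])
    also have "\<dots> = C3 ^ 3 * exp (3 * \<eta> * y)" by (simp add: power_mult_distrib mult.assoc flip: exp_of_nat_mult)
    finally have a: "\<bar>score \<alpha> \<beta> y ^ (j - 1)\<bar> \<le> C3 ^ 3 * exp (3 * \<eta> * y)" .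
    have "\<bar>\<alpha> - \<beta> * \<tau> * exp (\<tau> * y)\<bar> \<le> \<bar>\<alpha>\<bar> + \<bar>\<beta>\<bar> * \<bar>\<tau>\<bar> * exp (\<tau> * y)"
      by (rule order_trans[OF abs_triangle_ineq4]) (simp add: abs_mult)
    also have "\<dots> \<le> C2" unfolding C2_def using e by (intro add_left_mono mult_left_le) auto
    finally have b: "\<bar>\<alpha> - \<beta> * \<tau> * exp (\<tau> * y)\<bar> \<le> C2" .
    have "\<bar>f' y\<bar> = real j * \<bar>score \<alpha> \<beta> y ^ (j - 1)\<bar> * \<bar>\<alpha> - \<beta> * \<tau> * exp (\<tau> * y)\<bar>"
      by (simp add: f'_def abs_mult)
    also have "\<dots> \<le> 4 * (C3 ^ 3 * exp (3 * \<eta> * y)) * C2"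
      using C31 by (intro mult_mono a b j(2)) auto
    finally show ?thesis by (simp add: mult_ac)
  qed
  have b: "3 * \<eta> < 1 / \<xi>" using xi_pos by (simp add: \<eta>_def field_simps)
  show "\<forall>\<^sub>F n in sequentially. integrable M (\<lambda>\<omega>. of_bool (Z n i \<omega> > 0) * f (Z n i \<omega>))"
    "(\<lambda>n. sqrt (real (k n)) * (real n / real (k n) * expectation (\<lambda>\<omega>. of_bool (Z n i \<omega> > 0) * f (Z n i \<omega>))
        - (f 0 + (LINT y|lborel. indicator {0..} y * (f' y * exp (- y / \<xi>))))))
      \<longlonglongrightarrow> lam / \<xi> * (f 0 + (LINT y|lborel. indicator {0..} y * (f' y * exp (\<tau> * y) * exp (- y / \<xi>))))"
    by (rule moment_limit[OF derf contf bndf b]; assumption)+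
qed

lemma score_power_limit:
  assumes "j \<in> {1, 2, 4}"
  shows "(\<lambda>n. real n / real (k n) * expectation (\<lambda>\<omega>. of_bool (Z n i \<omega> > 0) * score \<alpha> \<beta> (Z n i \<omega>) ^ j))
   \<longlonglongrightarrow> score \<alpha> \<beta> 0 ^ j + (LINT y|lborel. indicator {0..} y * (real j * score \<alpha> \<beta> y ^ (j - 1) * (\<alpha> - \<beta> * \<tau> * exp (\<tau> * y)) * exp (- y / \<xi>)))"
  using tendsto_0_of_scaled[OF score_power_moment(2)[OF assms] sqrt_k_top] by (rule LIM_zero_cancel)

text \<open>The score is centred, so the constant in \<open>moment_limit\<close> vanishes and
  \<open>sqrt k\<close> times the scaled mean has a finite limit.\<close>

lemma score_integral_1:
  "score \<alpha> \<beta> 0 ^ 1 + (LINT y|lborel. indicator {0..} y * (real 1 * score \<alpha> \<beta> y ^ (1 - 1) * (\<alpha> - \<beta> * \<tau> * exp (\<tau> * y)) * exp (- y / \<xi>))) = 0"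
proof -
  have p: "1 / \<xi> > 0" "1 / \<xi> - \<tau> > 0" using xi_pos tau_neg by (auto simp: less_trans[of \<tau> 0])
  have "has_bochner_integral lborel (\<lambda>y. \<alpha> * (indicator {0..} y * exp (- (1 / \<xi>) * y)) - \<beta> * \<tau> * (indicator {0..} y * exp (- (1 / \<xi> - \<tau>) * y)))
    (\<alpha> * (1 / (1 / \<xi>)) - \<beta> * \<tau> * (1 / (1 / \<xi> - \<tau>)))"
    by (intro has_bochner_integral_diff has_bochner_integral_mult_right has_bochner_integral_exp p)
  also have "(\<lambda>y. \<alpha> * (indicator {0..} y * exp (- (1 / \<xi>) * y)) - \<beta> * \<tau> * (indicator {0..} y * exp (- (1 / \<xi> - \<tau>) * y)))
     = (\<lambda>y. indicator {0..} y * (real 1 * score \<alpha> \<beta> y ^ (1 - 1) * (\<alpha> - \<beta> * \<tau> * exp (\<tau> * y)) * exp (- y / \<xi>)))"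
    by (rule ext) (simp add: algebra_simps flip: exp_add)
  finally have "(LINT y|lborel. indicator {0..} y * (real 1 * score \<alpha> \<beta> y ^ (1 - 1) * (\<alpha> - \<beta> * \<tau> * exp (\<tau> * y)) * exp (- y / \<xi>)))
     = \<alpha> * (1 / (1 / \<xi>)) - \<beta> * \<tau> * (1 / (1 / \<xi> - \<tau>))" by (rule has_bochner_integral_integral_eq)
  then show ?thesis using xi_pos rho_less by (simp add: score_def field_simps)
qed

text \<open>That limit up to the factor \<open>lam / \<xi>\<close>; the weight
  \<open>exp (\<tau> * y)\<close> is the shape of the second-order term of the tail.\<close>

lemma score_bias_integral:
  "score \<alpha> \<beta> 0 ^ 1 + (LINT y|lborel. indicator {0..} y * (real 1 * score \<alpha> \<beta> y ^ (1 - 1) * (\<alpha> - \<beta> * \<tau> * exp (\<tau> * y)) * exp (\<tau> * y) * exp (- y / \<xi>)))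
   = \<alpha> * \<xi> * (\<xi> * \<tau>) / (1 - \<xi> * \<tau>) - \<beta> * (\<xi> * \<tau>)\<^sup>2 / ((1 - 2 * (\<xi> * \<tau>)) * (1 - \<xi> * \<tau>))"
proof -
  have p: "1 / \<xi> - \<tau> > 0" "1 / \<xi> - 2 * \<tau> > 0" using xi_pos tau_neg divide_pos_pos[of 1 \<xi>] by linarith+
  have "has_bochner_integral lborel (\<lambda>y. \<alpha> * (indicator {0..} y * exp (- (1 / \<xi> - \<tau>) * y)) - \<beta> * \<tau> * (indicator {0..} y * exp (- (1 / \<xi> - 2 * \<tau>) * y)))
    (\<alpha> * (1 / (1 / \<xi> - \<tau>)) - \<beta> * \<tau> * (1 / (1 / \<xi> - 2 * \<tau>)))"
    by (intro has_bochner_integral_diff has_bochner_integral_mult_right has_bochner_integral_exp p)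
  also have "(\<lambda>y. \<alpha> * (indicator {0..} y * exp (- (1 / \<xi> - \<tau>) * y)) - \<beta> * \<tau> * (indicator {0..} y * exp (- (1 / \<xi> - 2 * \<tau>) * y)))
     = (\<lambda>y. indicator {0..} y * (real 1 * score \<alpha> \<beta> y ^ (1 - 1) * (\<alpha> - \<beta> * \<tau> * exp (\<tau> * y)) * exp (\<tau> * y) * exp (- y / \<xi>)))"
    by (rule ext) (simp add: algebra_simps flip: exp_add)
  finally have "(LINT y|lborel. indicator {0..} y * (real 1 * score \<alpha> \<beta> y ^ (1 - 1) * (\<alpha> - \<beta> * \<tau> * exp (\<tau> * y)) * exp (\<tau> * y) * exp (- y / \<xi>)))
     = \<alpha> * (1 / (1 / \<xi> - \<tau>)) - \<beta> * \<tau> * (1 / (1 / \<xi> - 2 * \<tau>))" by (rule has_bochner_integral_integral_eq)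
  also have "\<dots> = \<alpha> * (\<xi> / (1 - \<xi> * \<tau>)) - \<beta> * (\<xi> * \<tau> / (1 - 2 * (\<xi> * \<tau>)))"
    using xi_pos rho_less p by (simp add: field_simps)
  finally have e: "(LINT y|lborel. indicator {0..} y * (real 1 * score \<alpha> \<beta> y ^ (1 - 1) * (\<alpha> - \<beta> * \<tau> * exp (\<tau> * y)) * exp (\<tau> * y) * exp (- y / \<xi>)))
     = \<alpha> * (\<xi> / (1 - \<xi> * \<tau>)) - \<beta> * (\<xi> * \<tau> / (1 - 2 * (\<xi> * \<tau>)))" .
  define \<rho> where "\<rho> = \<xi> * \<tau>"
  have r: "1 - \<rho> \<noteq> 0" "1 - 2 * \<rho> \<noteq> 0" using rho_less by (auto simp: \<rho>_def)
  define q where "q = 1 / (1 - \<rho>)"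
  define u where "u = 1 / (1 - 2 * \<rho>)"
  have rq: "\<rho> * q = q - 1" using r by (simp add: q_def field_simps)
  have uq: "u - q = \<rho> * (u * q)" using r by (simp add: u_def q_def diff_frac_eq)
  have "\<beta> * \<rho>\<^sup>2 / ((1 - 2 * \<rho>) * (1 - \<rho>)) = \<beta> * \<rho> * (\<rho> * (u * q))" by (simp add: u_def q_def power2_eq_square)
  also have "\<dots> = \<beta> * \<rho> * u - \<beta> * (\<rho> * q)" unfolding uq[symmetric] by (simp add: algebra_simps)
  finally have 1: "\<beta> * \<rho>\<^sup>2 / ((1 - 2 * \<rho>) * (1 - \<rho>)) = \<beta> * \<rho> * u - \<beta> * (q - 1)" unfolding rq .
  have "\<alpha> * \<xi> * \<rho> / (1 - \<rho>) = \<alpha> * \<xi> * (\<rho> * q)" by (simp add: q_def)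
  then have 2: "\<alpha> * \<xi> * \<rho> / (1 - \<rho>) = \<alpha> * \<xi> * (q - 1)" unfolding rq .
  have 3: "\<alpha> * (\<xi> / (1 - \<rho>)) - \<beta> * (\<rho> / (1 - 2 * \<rho>)) = \<alpha> * \<xi> * q - \<beta> * \<rho> * u" by (simp add: u_def q_def)
  show ?thesis unfolding e unfolding power_one_right score_def \<rho>_def[symmetric] 1 2 3 q_def[symmetric]
    by (simp add: algebra_simps)
qed

text \<open>The variance of the score under the exponential law with mean \<open>\<xi>\<close>: the
  three terms are the variance of \<open>y\<close>, its covariance with
  \<open>exp (\<tau> * y)\<close>, and the variance of the latter.\<close>

lemma score_integral_2:
  "score \<alpha> \<beta> 0 ^ 2 + (LINT y|lborel. indicator {0..} y * (real 2 * score \<alpha> \<beta> y ^ (2 - 1) * (\<alpha> - \<beta> * \<tau> * exp (\<tau> * y)) * exp (- y / \<xi>)))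
   = \<alpha>\<^sup>2 * \<xi>\<^sup>2 - 2 * \<alpha> * \<beta> * \<xi> * (\<xi> * \<tau>) / (1 - \<xi> * \<tau>)\<^sup>2 + \<beta>\<^sup>2 * (\<xi> * \<tau>)\<^sup>2 / ((1 - 2 * (\<xi> * \<tau>)) * (1 - \<xi> * \<tau>)\<^sup>2)"
proof -
  define q where "q = 1 / (1 - \<xi> * \<tau>)"
  \<comment> \<open>\<open>u\<close> collects the constants, so that the score is
    \<open>u + \<alpha> * y - \<beta> * exp (\<tau> * y)\<close>.\<close>
  define u where "u = \<beta> * q - \<alpha> * \<xi>"
  have p: "1 / \<xi> > 0" "1 / \<xi> - \<tau> > 0" "1 / \<xi> - 2 * \<tau> > 0" using xi_pos tau_neg divide_pos_pos[of 1 \<xi>] by linarith+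
  have "has_bochner_integral lborel (\<lambda>y. 2 * u * \<alpha> * (indicator {0..} y * exp (- (1 / \<xi>) * y)) + 2 * \<alpha>\<^sup>2 * (indicator {0..} y * (y ^ 1 * exp (- (1 / \<xi>) * y)))
       - 2 * \<beta> * (\<alpha> + u * \<tau>) * (indicator {0..} y * exp (- (1 / \<xi> - \<tau>) * y)) - 2 * \<alpha> * \<beta> * \<tau> * (indicator {0..} y * (y ^ 1 * exp (- (1 / \<xi> - \<tau>) * y)))
       + 2 * \<beta>\<^sup>2 * \<tau> * (indicator {0..} y * exp (- (1 / \<xi> - 2 * \<tau>) * y)))
    (2 * u * \<alpha> * (1 / (1 / \<xi>)) + 2 * \<alpha>\<^sup>2 * (fact 1 / (1 / \<xi>) ^ Suc 1) - 2 * \<beta> * (\<alpha> + u * \<tau>) * (1 / (1 / \<xi> - \<tau>))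
      - 2 * \<alpha> * \<beta> * \<tau> * (fact 1 / (1 / \<xi> - \<tau>) ^ Suc 1) + 2 * \<beta>\<^sup>2 * \<tau> * (1 / (1 / \<xi> - 2 * \<tau>)))"
    by (intro has_bochner_integral_diff has_bochner_integral_add has_bochner_integral_mult_right has_bochner_integral_exp has_bochner_integral_power_exp p)
  also have "(\<lambda>y. 2 * u * \<alpha> * (indicator {0..} y * exp (- (1 / \<xi>) * y)) + 2 * \<alpha>\<^sup>2 * (indicator {0..} y * (y ^ 1 * exp (- (1 / \<xi>) * y)))
       - 2 * \<beta> * (\<alpha> + u * \<tau>) * (indicator {0..} y * exp (- (1 / \<xi> - \<tau>) * y)) - 2 * \<alpha> * \<beta> * \<tau> * (indicator {0..} y * (y ^ 1 * exp (- (1 / \<xi> - \<tau>) * y)))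
       + 2 * \<beta>\<^sup>2 * \<tau> * (indicator {0..} y * exp (- (1 / \<xi> - 2 * \<tau>) * y)))
     = (\<lambda>y. indicator {0..} y * (real 2 * score \<alpha> \<beta> y ^ (2 - 1) * (\<alpha> - \<beta> * \<tau> * exp (\<tau> * y)) * exp (- y / \<xi>)))"
  proof
    fix y :: real
    define E where "E = exp (\<tau> * y)"
    define G where "G = exp (- y / \<xi>)"
    have e: "exp (- (1 / \<xi>) * y) = G" "exp (- (1 / \<xi> - \<tau>) * y) = G * E" "exp (- (1 / \<xi> - 2 * \<tau>) * y) = G * E * E"
      by (simp_all add: E_def G_def algebra_simps flip: exp_add)
    have s: "score \<alpha> \<beta> y = u + \<alpha> * y - \<beta> * E" by (simp add: score_def u_def q_def E_def algebra_simps)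
    show "2 * u * \<alpha> * (indicator {0..} y * exp (- (1 / \<xi>) * y)) + 2 * \<alpha>\<^sup>2 * (indicator {0..} y * (y ^ 1 * exp (- (1 / \<xi>) * y)))
       - 2 * \<beta> * (\<alpha> + u * \<tau>) * (indicator {0..} y * exp (- (1 / \<xi> - \<tau>) * y)) - 2 * \<alpha> * \<beta> * \<tau> * (indicator {0..} y * (y ^ 1 * exp (- (1 / \<xi> - \<tau>) * y)))
       + 2 * \<beta>\<^sup>2 * \<tau> * (indicator {0..} y * exp (- (1 / \<xi> - 2 * \<tau>) * y)) =
      indicator {0..} y * (real 2 * score \<alpha> \<beta> y ^ (2 - 1) * (\<alpha> - \<beta> * \<tau> * exp (\<tau> * y)) * exp (- y / \<xi>))"
      unfolding e s E_def[symmetric] G_def[symmetric] by (simp add: algebra_simps power2_eq_square)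
  qed
  finally have I: "(LINT y|lborel. indicator {0..} y * (real 2 * score \<alpha> \<beta> y ^ (2 - 1) * (\<alpha> - \<beta> * \<tau> * exp (\<tau> * y)) * exp (- y / \<xi>)))
     = 2 * u * \<alpha> * (1 / (1 / \<xi>)) + 2 * \<alpha>\<^sup>2 * (fact 1 / (1 / \<xi>) ^ Suc 1) - 2 * \<beta> * (\<alpha> + u * \<tau>) * (1 / (1 / \<xi> - \<tau>))
      - 2 * \<alpha> * \<beta> * \<tau> * (fact 1 / (1 / \<xi> - \<tau>) ^ Suc 1) + 2 * \<beta>\<^sup>2 * \<tau> * (1 / (1 / \<xi> - 2 * \<tau>))"
    by (rule has_bochner_integral_integral_eq)
  define \<rho> where "\<rho> = \<xi> * \<tau>"
  have r: "1 - \<rho> \<noteq> 0" "1 - 2 * \<rho> \<noteq> 0" using rho_less by (auto simp: \<rho>_def)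
  have i: "1 / (1 / \<xi> - \<tau>) = \<xi> * q" using xi_pos rho_less p by (simp add: q_def field_simps)
  have i1: "fact 1 / (1 / \<xi> - \<tau>) ^ Suc 1 = (\<xi> * q)\<^sup>2" unfolding i[symmetric] by (simp add: power2_eq_square)
  have i2: "\<tau> * (1 / (1 / \<xi> - 2 * \<tau>)) = \<rho> / (1 - 2 * \<rho>)"
    using xi_pos rho_less p by (simp add: \<rho>_def field_simps)
  have i0: "1 / (1 / \<xi>) = \<xi>" "fact 1 / (1 / \<xi>) ^ Suc 1 = \<xi>\<^sup>2" by (simp_all add: power2_eq_square)
  have q: "q = 1 / (1 - \<rho>)" by (simp add: q_def \<rho>_def)
  have s0: "score \<alpha> \<beta> 0 = u - \<beta>" by (simp add: score_def u_def q_def algebra_simps)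
  have "score \<alpha> \<beta> 0 ^ 2 + (LINT y|lborel. indicator {0..} y * (real 2 * score \<alpha> \<beta> y ^ (2 - 1) * (\<alpha> - \<beta> * \<tau> * exp (\<tau> * y)) * exp (- y / \<xi>)))
    = (u - \<beta>)\<^sup>2 + 2 * u * \<alpha> * \<xi> + 2 * \<alpha>\<^sup>2 * \<xi>\<^sup>2 - 2 * \<beta> * (\<alpha> * \<xi> + u * \<rho>) * q - 2 * (\<alpha> * \<xi>) * \<beta> * \<rho> * q\<^sup>2 + 2 * \<beta>\<^sup>2 * (\<rho> / (1 - 2 * \<rho>))"
    unfolding I s0 i i0 i1 i2[symmetric] by (simp add: \<rho>_def algebra_simps power2_eq_square)
  also have "\<dots> = \<alpha>\<^sup>2 * \<xi>\<^sup>2 - 2 * \<alpha> * \<beta> * \<xi> * \<rho> / (1 - \<rho>)\<^sup>2 + \<beta>\<^sup>2 * \<rho>\<^sup>2 / ((1 - 2 * \<rho>) * (1 - \<rho>)\<^sup>2)"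
  proof -
    have rq: "\<rho> * q = q - 1" using r by (simp add: q field_simps)
    define a where "a = \<alpha> * \<xi>"
    have l: "(u - \<beta>)\<^sup>2 + 2 * u * \<alpha> * \<xi> + 2 * \<alpha>\<^sup>2 * \<xi>\<^sup>2 - 2 * \<beta> * (\<alpha> * \<xi> + u * \<rho>) * q - 2 * (\<alpha> * \<xi>) * \<beta> * \<rho> * q\<^sup>2 + 2 * \<beta>\<^sup>2 * (\<rho> / (1 - 2 * \<rho>))
      = (u - \<beta>)\<^sup>2 + 2 * u * a + 2 * a\<^sup>2 - 2 * \<beta> * a * q - 2 * \<beta> * u * (\<rho> * q) - 2 * a * \<beta> * q * (\<rho> * q) + 2 * \<beta>\<^sup>2 * (\<rho> / (1 - 2 * \<rho>))"
      by (simp add: a_def algebra_simps power2_eq_square)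
    have fin: "\<dots> = a\<^sup>2 - 2 * a * \<beta> * q * (\<rho> * q) + \<beta>\<^sup>2 * ((2 * \<rho> / (1 - 2 * \<rho>) + 1) - q\<^sup>2)"
      unfolding rq unfolding u_def a_def by (simp add: algebra_simps power2_eq_square)
    have t4: "(2 * \<rho> / (1 - 2 * \<rho>) + 1) - q\<^sup>2 = \<rho>\<^sup>2 / ((1 - 2 * \<rho>) * (1 - \<rho>)\<^sup>2)"
    proof -
      have "2 * \<rho> / (1 - 2 * \<rho>) + 1 = 1 / (1 - 2 * \<rho>)" using r by (simp add: field_simps)
      moreover have "1 / (1 - 2 * \<rho>) - 1 / (1 - \<rho>)\<^sup>2 = ((1 - \<rho>)\<^sup>2 - (1 - 2 * \<rho>)) / ((1 - 2 * \<rho>) * (1 - \<rho>)\<^sup>2)"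
        using r by (simp add: diff_frac_eq)
      moreover have "(1 - \<rho>)\<^sup>2 - (1 - 2 * \<rho>) = \<rho>\<^sup>2" by (simp add: power2_eq_square algebra_simps)
      ultimately show ?thesis by (simp add: q power_divide)
    qed
    have t3: "2 * a * \<beta> * q * (\<rho> * q) = 2 * \<alpha> * \<beta> * \<xi> * \<rho> / (1 - \<rho>)\<^sup>2" by (simp add: a_def q power2_eq_square mult_ac)
    show ?thesis unfolding l unfolding fin unfolding t3 t4 by (simp add: a_def power_mult_distrib)
  qed
  finally show ?thesis by (simp add: \<rho>_def)
qed

text \<open>The summands of a row are one function of the \<open>X i\<close>, which passes on
  independence and the common law. Lyapunov's condition uses that \<open>\<bar>x\<bar> ^ 3\<close>
  is at most the average of \<open>x\<^sup>2\<close> and \<open>x ^ 4\<close>.\<close>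

theorem score_sum_char:
  defines "\<rho> \<equiv> \<xi> * \<tau>"
  shows "(\<lambda>n. char (distr M borel (score_sum \<alpha> \<beta> n)) s) \<longlonglongrightarrow>
    exp (\<i> * s * (lam * (\<alpha> * \<rho> / (1 - \<rho>) - \<beta> * \<tau> * \<rho> / ((1 - 2 * \<rho>) * (1 - \<rho>)))) -
      s\<^sup>2 * (\<alpha>\<^sup>2 * \<xi>\<^sup>2 - 2 * \<alpha> * \<beta> * \<xi> * \<rho> / (1 - \<rho>)\<^sup>2 + \<beta>\<^sup>2 * \<rho>\<^sup>2 / ((1 - 2 * \<rho>) * (1 - \<rho>)\<^sup>2)) / 2)"
proof -
  define W where "W n i \<omega> = of_bool (Z n i \<omega> > 0) * score \<alpha> \<beta> (Z n i \<omega>) / sqrt (real (k n))" for n i \<omega>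
  define \<phi> where "\<phi> n x = of_bool (ln (max 1 (x / t n)) > 0) * score \<alpha> \<beta> (ln (max 1 (x / t n))) / sqrt (real (k n))" for n x
  have \<phi>m[measurable]: "\<phi> n \<in> borel_measurable borel" for n unfolding \<phi>_def[abs_def] score_def by measurable
  have W\<phi>: "W n i = (\<lambda>\<omega>. \<phi> n (X i \<omega>))" for n i by (rule ext) (simp add: W_def \<phi>_def Z_def)
  have dX: "distr M borel (X i) = distr M borel (X j)" for i j
    by (rule cdf_unique) (auto intro: real_distribution_distr simp: cdf_X)
  have dW: "distr M borel (W n i) = distr M borel (W n j)" for n i j
  proof -
    have "distr M borel (W n i) = distr (distr M borel (X i)) borel (\<phi> n)" for i
      unfolding W\<phi> by (subst distr_distr) (auto simp: comp_def)
    then show ?thesis using dX by metis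
  qed
  let ?s = "\<lambda>n. real n / real (k n)"
  note L = score_power_moment[where i=1 and \<alpha>=\<alpha> and \<beta>=\<beta>] score_power_limit[where i=1 and \<alpha>=\<alpha> and \<beta>=\<beta>]
  have ob: "(of_bool b * x) ^ j = of_bool b * x ^ j" if "j > 0" for b and x :: real and j using that by (cases b) auto
  have intj: "\<forall>\<^sub>F n in sequentially. integrable M (\<lambda>\<omega>. of_bool (Z n 1 \<omega> > 0) * score \<alpha> \<beta> (Z n 1 \<omega>) ^ j)" if "j \<in> {1, 2, 4}" for j
    by (rule L(1)[OF that])
  have c3: "\<bar>x\<bar> ^ 3 \<le> (x ^ 2 + x ^ 4) / 2" for x :: real
  proof -
    have "0 \<le> (x\<^sup>2 - \<bar>x\<bar>)\<^sup>2" by simp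
    then show ?thesis by (simp add: power2_eq_square power3_eq_cube power4_eq_xxxx algebra_simps abs_mult_self_eq) 
  qed
  \<comment> \<open>The bound for \<open>n\<close> times the third absolute moment: convergent
    scaled moments times \<open>1 / sqrt k\<close>.\<close>
  have k4: "(\<lambda>n. (1 / sqrt (real (k n))) * ((?s n * expectation (\<lambda>\<omega>. of_bool (Z n 1 \<omega> > 0) * score \<alpha> \<beta> (Z n 1 \<omega>) ^ 2) +
      ?s n * expectation (\<lambda>\<omega>. of_bool (Z n 1 \<omega> > 0) * score \<alpha> \<beta> (Z n 1 \<omega>) ^ 4)) / 2)) \<longlonglongrightarrow> 0"
  proof -
    have m: "2 \<in> {1, 2, 4::nat}" "4 \<in> {1, 2, 4::nat}" by auto
    from tendsto_mult[OF inv_sqrt_k tendsto_divide[OF tendsto_add[OF L(3)[OF m(1)] L(3)[OF m(2)]] tendsto_const[of 2]]]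
    show ?thesis by simp
  qed
  have "(\<lambda>n. char (distr M borel (\<lambda>\<omega>. \<Sum>i=1..n. W n i \<omega>)) s) \<longlonglongrightarrow>
    exp (\<i> * s * (lam * (\<alpha> * \<rho> / (1 - \<rho>) - \<beta> * \<tau> * \<rho> / ((1 - 2 * \<rho>) * (1 - \<rho>)))) -
      s\<^sup>2 * (\<alpha>\<^sup>2 * \<xi>\<^sup>2 - 2 * \<alpha> * \<beta> * \<xi> * \<rho> / (1 - \<rho>)\<^sup>2 + \<beta>\<^sup>2 * \<rho>\<^sup>2 / ((1 - 2 * \<rho>) * (1 - \<rho>)\<^sup>2)) / 2)"
  proof (rule triangular_array_char[where V="\<lambda>n. W n 1"])
    show "W n 1 \<in> borel_measurable M" for n unfolding W\<phi> by measurable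
    show "indep_vars (\<lambda>_. borel) (W n) {1..n}" for n
      unfolding W\<phi> by (rule indep_vars_compose2[OF indep_vars_subset[OF indep]]) auto
    show "distr M borel (W n i) = distr M borel (W n 1)" for n i by (rule dW)
    have i3: "\<forall>\<^sub>F n in sequentially. integrable M (\<lambda>\<omega>. \<bar>W n 1 \<omega>\<bar> ^ 3) \<and>
        real n * expectation (\<lambda>\<omega>. \<bar>W n 1 \<omega>\<bar> ^ 3) \<le> (1 / sqrt (real (k n))) * ((?s n * expectation (\<lambda>\<omega>. of_bool (Z n 1 \<omega> > 0) * score \<alpha> \<beta> (Z n 1 \<omega>) ^ 2) +
      ?s n * expectation (\<lambda>\<omega>. of_bool (Z n 1 \<omega> > 0) * score \<alpha> \<beta> (Z n 1 \<omega>) ^ 4)) / 2)"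
      using intj[of 2, simplified] intj[of 4, simplified] k_pos
    proof eventually_elim
      case (elim n)
      define r where "r = sqrt (real (k n))"
      have r: "r > 0" "real (k n) = r * r" using elim by (auto simp: r_def)
      let ?h = "\<lambda>\<omega>. of_bool (Z n 1 \<omega> > 0) * score \<alpha> \<beta> (Z n 1 \<omega>) :: real"
      let ?g = "\<lambda>\<omega>. 1 / (2 * r ^ 3) * (of_bool (Z n 1 \<omega> > 0) * score \<alpha> \<beta> (Z n 1 \<omega>) ^ 2 + of_bool (Z n 1 \<omega> > 0) * score \<alpha> \<beta> (Z n 1 \<omega>) ^ 4)"
      have ig: "integrable M ?g" using elim by (intro integrable_mult_right Bochner_Integration.integrable_add) auto
      have le: "\<bar>W n 1 \<omega>\<bar> ^ 3 \<le> ?g \<omega>" for \<omega>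
      proof -
        have "\<bar>W n 1 \<omega>\<bar> ^ 3 = \<bar>?h \<omega>\<bar> ^ 3 / r ^ 3" using r by (simp add: W_def r_def[symmetric] power_divide)
        also have "\<dots> \<le> ((?h \<omega> ^ 2 + ?h \<omega> ^ 4) / 2) / r ^ 3" using r by (intro divide_right_mono c3) auto
        also have "\<dots> = ?g \<omega>" by (simp add: ob)
        finally show ?thesis .
      qed
      have Wm: "W n 1 \<in> borel_measurable M" unfolding W\<phi> by measurable
      have "integrable M (\<lambda>\<omega>. \<bar>W n 1 \<omega>\<bar> ^ 3)"
      proof (rule Bochner_Integration.integrable_bound[OF ig])
        show "(\<lambda>\<omega>. \<bar>W n 1 \<omega>\<bar> ^ 3) \<in> borel_measurable M" using Wm by measurable
        have "norm (\<bar>W n 1 \<omega>\<bar> ^ 3) \<le> norm (?g \<omega>)" for \<omega>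
        proof -
          have "norm (\<bar>W n 1 \<omega>\<bar> ^ 3) = \<bar>W n 1 \<omega>\<bar> ^ 3" by simp
          then show ?thesis using le[of \<omega>] abs_ge_self[of "?g \<omega>"] unfolding real_norm_def by linarith
        qed
        then show "AE \<omega> in M. norm (\<bar>W n 1 \<omega>\<bar> ^ 3) \<le> norm (?g \<omega>)" by (rule AE_I2)
      qed
      moreover have "real n * expectation (\<lambda>\<omega>. \<bar>W n 1 \<omega>\<bar> ^ 3) \<le> real n * expectation ?g"
      proof (intro mult_left_mono integral_mono_AE'[OF ig] AE_I2 le)
        show "0 \<le> ?g \<omega>" for \<omega> using order_trans[OF _ le[of \<omega>]] by simp
      qed simp
      moreover have "real n * expectation ?g = (1 / r) * ((?s n * expectation (\<lambda>\<omega>. of_bool (Z n 1 \<omega> > 0) * score \<alpha> \<beta> (Z n 1 \<omega>) ^ 2) +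
        ?s n * expectation (\<lambda>\<omega>. of_bool (Z n 1 \<omega> > 0) * score \<alpha> \<beta> (Z n 1 \<omega>) ^ 4)) / 2)"
        using elim r(1) unfolding r(2) by (subst integral_mult_right_zero, subst Bochner_Integration.integral_add) (auto simp: field_simps power3_eq_cube)
      ultimately show ?case by (simp add: r_def)
    qed
    then show "\<forall>\<^sub>F n in sequentially. integrable M (\<lambda>\<omega>. \<bar>W n 1 \<omega>\<bar> ^ 3)" by eventually_elim simp
    show "(\<lambda>n. real n * expectation (\<lambda>\<omega>. \<bar>W n 1 \<omega>\<bar> ^ 3)) \<longlonglongrightarrow> 0"
    proof (rule tendsto_sandwich[OF _ _ tendsto_const k4])
      show "\<forall>\<^sub>F n in sequentially. 0 \<le> real n * expectation (\<lambda>\<omega>. \<bar>W n 1 \<omega>\<bar> ^ 3)"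
        by (intro always_eventually allI mult_nonneg_nonneg integral_nonneg_AE AE_I2) auto
    qed (rule eventually_mono[OF i3], erule conjunct2)
    have "lam / \<xi> * (\<alpha> * \<xi> * \<rho> / (1 - \<rho>) - \<beta> * \<rho>\<^sup>2 / ((1 - 2 * \<rho>) * (1 - \<rho>))) =
       lam * (\<alpha> * \<rho> / (1 - \<rho>) - \<beta> * \<tau> * \<rho> / ((1 - 2 * \<rho>) * (1 - \<rho>)))"
    proof -
      have "\<rho>\<^sup>2 = \<xi> * (\<tau> * \<rho>)" by (simp add: \<rho>_def power2_eq_square)
      then show ?thesis using xi_pos by (simp add: algebra_simps)
    qed
    then have "(\<lambda>n. sqrt (real (k n)) * (?s n * expectation (\<lambda>\<omega>. of_bool (Z n 1 \<omega> > 0) * score \<alpha> \<beta> (Z n 1 \<omega>) ^ 1)))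
      \<longlonglongrightarrow> lam * (\<alpha> * \<rho> / (1 - \<rho>) - \<beta> * \<tau> * \<rho> / ((1 - 2 * \<rho>) * (1 - \<rho>)))"
      using L(2)[of 1] unfolding score_integral_1 score_bias_integral \<rho>_def[symmetric] by simp
    moreover have "\<forall>\<^sub>F n in sequentially. sqrt (real (k n)) * (?s n * expectation (\<lambda>\<omega>. of_bool (Z n 1 \<omega> > 0) * score \<alpha> \<beta> (Z n 1 \<omega>) ^ 1)) = real n * expectation (W n 1)"
      using k_pos
    proof eventually_elim
      case (elim n)
      define r where "r = sqrt (real (k n))"
      have r: "r > 0" "real (k n) = r * r" using elim by (auto simp: r_def)
      then show ?case by (simp add: W_def[abs_def] r_def[symmetric])
    qed
    ultimately show "(\<lambda>n. real n * expectation (W n 1)) \<longlonglongrightarrow> lam * (\<alpha> * \<rho> / (1 - \<rho>) - \<beta> * \<tau> * \<rho> / ((1 - 2 * \<rho>) * (1 - \<rho>)))"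
      by (rule Lim_transform_eventually)
    have "(\<lambda>n. ?s n * expectation (\<lambda>\<omega>. of_bool (Z n 1 \<omega> > 0) * score \<alpha> \<beta> (Z n 1 \<omega>) ^ 2))
      \<longlonglongrightarrow> \<alpha>\<^sup>2 * \<xi>\<^sup>2 - 2 * \<alpha> * \<beta> * \<xi> * \<rho> / (1 - \<rho>)\<^sup>2 + \<beta>\<^sup>2 * \<rho>\<^sup>2 / ((1 - 2 * \<rho>) * (1 - \<rho>)\<^sup>2)"
      using L(3)[of 2] unfolding score_integral_2 \<rho>_def[symmetric] by simp
    moreover have "\<forall>\<^sub>F n in sequentially. ?s n * expectation (\<lambda>\<omega>. of_bool (Z n 1 \<omega> > 0) * score \<alpha> \<beta> (Z n 1 \<omega>) ^ 2) = real n * expectation (\<lambda>\<omega>. (W n 1 \<omega>)\<^sup>2)"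
      using k_pos
    proof eventually_elim
      case (elim n)
      then show ?case by (simp add: W_def power_divide ob)
    qed
    ultimately show "(\<lambda>n. real n * expectation (\<lambda>\<omega>. (W n 1 \<omega>)\<^sup>2)) \<longlonglongrightarrow>
       \<alpha>\<^sup>2 * \<xi>\<^sup>2 - 2 * \<alpha> * \<beta> * \<xi> * \<rho> / (1 - \<rho>)\<^sup>2 + \<beta>\<^sup>2 * \<rho>\<^sup>2 / ((1 - 2 * \<rho>) * (1 - \<rho>)\<^sup>2)"
      by (rule Lim_transform_eventually)
  qed
  then show ?thesis by (simp add: W_def score_sum_def[abs_def])
qed

end

section \<open>The Bayesian estimators\<close>

text \<open>On \<open>\<bar>x\<bar> \<le> 2 * \<bar>c\<bar> / D\<close> the smallness condition
  keeps \<open>D + q * x\<close> at least \<open>D / 2\<close>, so \<open>x * (D + q * x)\<close>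
  passes from at most \<open>- \<bar>c\<bar>\<close> to at least \<open>\<bar>c\<bar>\<close>, and
  the intermediate value theorem gives the root.\<close>

lemma small_quadratic_root:
  fixes D q c :: real
  assumes "D > 0" and small: "4 * \<bar>q\<bar> * \<bar>c\<bar> \<le> D\<^sup>2"
  shows "\<exists>\<delta>. \<bar>\<delta>\<bar> \<le> 2 * \<bar>c\<bar> / D \<and> \<delta> * (D + q * \<delta>) = c \<and> D + q * \<delta> > 0"
proof -
  define b where "b = 2 * \<bar>c\<bar> / D"
  have b: "b \<ge> 0" "b * D = 2 * \<bar>c\<bar>" using assms(1) by (auto simp: b_def)
  have qb: "\<bar>q\<bar> * b \<le> D / 2"
    using assms(1) small by (simp add: b_def field_simps power2_eq_square)
  have low: "D / 2 \<le> D + q * x" if "\<bar>x\<bar> \<le> b" for x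
  proof -
    have "\<bar>q * x\<bar> \<le> \<bar>q\<bar> * b" unfolding abs_mult using that by (intro mult_left_mono) auto
    then show ?thesis using qb by linarith
  qed
  have "c \<le> b * (D + q * b)"
  proof -
    have "\<bar>c\<bar> = b * (D / 2)" using b by simp
    also have "\<dots> \<le> b * (D + q * b)" using b low[of b] by (intro mult_left_mono) auto
    finally show ?thesis by simp
  qed
  moreover have "- b * (D + q * (- b)) \<le> c"
  proof -
    have "\<bar>c\<bar> = b * (D / 2)" using b by simp
    also have "\<dots> \<le> b * (D + q * (- b))" using b low[of "- b"] by (intro mult_left_mono) auto
    finally show ?thesis by simp
  qed
  moreover have "continuous_on {- b..b} (\<lambda>x. x * (D + q * x))" by (intro continuous_intros)
  ultimately obtain x where x: "- b \<le> x" "x \<le> b" "x * (D + q * x) = c"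
    using IVT'[of "\<lambda>x. x * (D + q * x)" "- b" c b] b by (metis dual_order.trans neg_le_0_iff_le)
  then have "D + q * x > 0" using low[of x] assms(1) by (simp add: abs_le_iff)
  with x show ?thesis by (intro exI[of _ x]) (auto simp: b_def)
qed

text \<open>\<open>D_bayes\<close> is affine in \<open>\<xi>\<close>, so inserting the first
  equation of the system makes it \<open>D + q * \<delta>\<close>, and the second equation reads
  \<open>\<delta> * (D + q * \<delta>) = c\<close>. The minimality in \<open>bayes_estimate\<close>
  passes the bound for the small root on to the estimate.\<close>

lemma bayes_estimate_small:
  fixes ys :: "real list" and k :: nat and s2 \<tau> :: real
  defines "H \<equiv> hill ys k" and "E \<equiv> E_stat ys k \<tau>"
  defines "c \<equiv> (1 - H * \<tau>) * (E - 1 / (1 - H * \<tau>))"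
  defines "q \<equiv> (1 - E) * (1 / (real k * s2) - 2 * \<tau> * E + 2 * \<tau> * E_stat ys k (2 * \<tau>) + \<tau>\<^sup>2 * E_stat ys k (2 * \<tau>))"
  defines "D \<equiv> D_bayes ys k s2 \<tau> H"
  assumes "D > 0" "4 * \<bar>q\<bar> * \<bar>c\<bar> \<le> D\<^sup>2"
  shows "\<exists>\<xi>' \<delta>'. bayes_system ys k s2 \<tau> \<xi>' \<delta>'"
    and "bayes_estimate ys k s2 \<tau> \<xi> \<delta> \<Longrightarrow> \<bar>\<delta>\<bar> \<le> 2 * \<bar>c\<bar> / D"
    and "D_bayes ys k s2 \<tau> (H + \<delta> * (1 - E)) = D + q * \<delta>"
proof -
  show aff: "D_bayes ys k s2 \<tau> (H + \<delta> * (1 - E)) = D + q * \<delta>" for \<delta>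
    unfolding D_def D_bayes_def q_def E_def[symmetric] by (simp add: algebra_simps add_divide_distrib diff_divide_distrib)
  obtain \<delta>0 where d0: "\<bar>\<delta>0\<bar> \<le> 2 * \<bar>c\<bar> / D" "\<delta>0 * (D + q * \<delta>0) = c" "D + q * \<delta>0 > 0"
    using small_quadratic_root[OF assms(6,7)] by blast
  have sys: "bayes_system ys k s2 \<tau> (H + \<delta>0 * (1 - E)) \<delta>0"
    unfolding bayes_system_def aff H_def[symmetric] E_def[symmetric]
    using d0 by (auto simp: c_def field_simps)
  then show "\<exists>\<xi>' \<delta>'. bayes_system ys k s2 \<tau> \<xi>' \<delta>'" by blast
  assume "bayes_estimate ys k s2 \<tau> \<xi> \<delta>"
  then have "\<bar>\<delta>\<bar> \<le> \<bar>\<delta>0\<bar>" using sys unfolding bayes_estimate_def by blast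
  with d0 show "\<bar>\<delta>\<bar> \<le> 2 * \<bar>c\<bar> / D" by simp
qed

lemma abs_ln_one_plus_le:
  fixes w :: real
  assumes "\<bar>w\<bar> \<le> 1 / 2"
  shows "\<bar>ln (1 + w)\<bar> \<le> 2 * \<bar>w\<bar>"
proof -
  have "\<bar>ln (1 + w) - w\<bar> \<le> 2 * w\<^sup>2" by (rule abs_ln_one_plus_x_minus_x_bound[OF assms])
  moreover have "2 * w\<^sup>2 \<le> \<bar>w\<bar>"
  proof -
    have "2 * w\<^sup>2 = (2 * \<bar>w\<bar>) * \<bar>w\<bar>" by (simp add: power2_eq_square)
    also have "\<dots> \<le> 1 * \<bar>w\<bar>" using assms by (intro mult_right_mono) auto
    finally show ?thesis by simp
  qed
  ultimately show ?thesis by linarith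
qed

lemma (in prob_space) tendsto_of_tight_scaled:
  assumes "tight M (\<lambda>p. s p * W p)" "filterlim s at_top (prob_filter M)"
  shows "(W \<longlongrightarrow> 0) (prob_filter M)"
proof -
  have "((\<lambda>p. 1 / s p) \<longlongrightarrow> 0) (prob_filter M)"
    by (rule tendsto_divide_0[OF tendsto_const filterlim_at_top_imp_at_infinity[OF assms(2)]])
  from tendsto_0_mult_tight[OF this assms(1)]
  have "((\<lambda>p. 1 / s p * (s p * W p)) \<longlongrightarrow> 0) (prob_filter M)" .
  moreover have "\<forall>\<^sub>F p in prob_filter M. 1 / s p * (s p * W p) = W p"
    using assms(2)[unfolded filterlim_at_top_dense, rule_format, of 0] by eventually_elim simp
  ultimately show ?thesis by (rule Lim_transform_eventually)
qed

section \<open>Asymptotic linearity of the tail index and tail probability estimators\<close>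

context tail_array
begin

lemma sqrt_k_prob: "filterlim (\<lambda>p. sqrt (real (k (fst p)))) at_top (prob_filter M)"
  by (rule filterlim_compose[OF sqrt_k_top filterlim_fst_prob_filter])

lemma hill_score_tight: "tight M (\<lambda>p. \<Theta> (fst p) 0 (snd p) - \<xi> * T (fst p) 0 (snd p))"
proof -
  have "tight M (\<lambda>p. \<Theta> (fst p) 0 (snd p))"
    by (rule tight_mono[OF R_tight])
      (use eventually_good in \<open>eventually_elim, auto intro: order_trans[OF Theta_bound abs_ge_self]\<close>)
  then show ?thesis by (intro tight_diff tight_mult tight_const T0_tight)
qed

lemma E_score_tight:
  assumes "s < 0"
  shows "tight M (\<lambda>p. s * \<Theta> (fst p) s (snd p) - \<xi> * s / (1 - \<xi> * s) * T (fst p) 0 (snd p))"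
proof -
  have "tight M (\<lambda>p. \<Theta> (fst p) s (snd p))"
  proof (rule tight_mono[OF R_tight])
    show "\<forall>\<^sub>F p in prob_filter M. \<bar>\<Theta> (fst p) s (snd p)\<bar> \<le> \<bar>R (fst p) (snd p)\<bar>"
      using eventually_good
      by eventually_elim (use assms in \<open>auto intro: order_trans[OF Theta_bound abs_ge_self]\<close>)
  qed
  then show ?thesis by (intro tight_diff tight_mult tight_const T0_tight)
qed

lemma E_stat_consistent:
  assumes S: "(S \<longlongrightarrow> s) (prob_filter M)" and s: "s < 0"
  shows "((\<lambda>p. E_stat (xs (fst p) (snd p)) (k (fst p)) (S p)) \<longlongrightarrow> 1 / (1 - \<xi> * s)) (prob_filter M)"
proof -
  have den: "1 - \<xi> * s \<noteq> 0" using mult_pos_neg[OF xi_pos s] by simp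
  have "tight M (\<lambda>p. sqrt (real (k (fst p))) * (E_stat (xs (fst p) (snd p)) (k (fst p)) (S p) - 1 / (1 - \<xi> * S p)))"
    by (rule tight_close[OF E_score_tight[OF s] E_stat_expansion[OF S s]])
  from tendsto_of_tight_scaled[OF this sqrt_k_prob]
  have "((\<lambda>p. E_stat (xs (fst p) (snd p)) (k (fst p)) (S p) - 1 / (1 - \<xi> * S p)) \<longlongrightarrow> 0) (prob_filter M)" .
  moreover have "((\<lambda>p. 1 / (1 - \<xi> * S p)) \<longlongrightarrow> 1 / (1 - \<xi> * s)) (prob_filter M)"
    using den by (intro tendsto_intros S) auto
  ultimately have "((\<lambda>p. (E_stat (xs (fst p) (snd p)) (k (fst p)) (S p) - 1 / (1 - \<xi> * S p)) + 1 / (1 - \<xi> * S p)) \<longlongrightarrow> 0 + 1 / (1 - \<xi> * s)) (prob_filter M)"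
    by (rule tendsto_add)
  then show ?thesis by simp
qed

lemma hill_consistent: "((\<lambda>p. hill (xs (fst p) (snd p)) (k (fst p))) \<longlongrightarrow> \<xi>) (prob_filter M)"
  by (rule LIM_zero_cancel, rule tendsto_of_tight_scaled[OF tight_close[OF hill_score_tight hill_expansion] sqrt_k_prob])

text \<open>\<open>A\<close> and \<open>B\<close> are the linear parts of the Hill estimator and of
  the power mean, \<open>D\<^sub>0\<close> is the limit of \<open>D_bayes\<close>. The system makes
  \<open>sqrt k * dh\<close> a multiple of \<open>W\<close>, which is close to
  \<open>B - \<kappa> * A\<close>, and \<open>xh - H = (1 - E) * dh\<close> adds
  \<open>- \<beta> * W\<close> to \<open>A\<close>. Collecting terms gives the two weights of
  \<open>score_sum\<close>.\<close>

theorem bayes_expansion: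
  fixes s2 :: "nat \<Rightarrow> real" and rh th xh dh :: "nat \<times> 'a \<Rightarrow> real" and \<mu> :: real
  defines "\<rho> \<equiv> \<xi> * \<tau>"
  defines "D\<^sub>0 \<equiv> \<xi> / \<mu> + \<tau> * \<rho> ^ 3 / ((1 - 2 * \<rho>) * (1 - \<rho>)\<^sup>2)"
  defines "\<beta> \<equiv> \<rho> / D\<^sub>0"
  assumes s2: "(\<lambda>n. real (k n) * s2 n) \<longlonglongrightarrow> \<mu>" and mu: "\<mu> > 0"
    and rh: "(rh \<longlongrightarrow> \<rho>) (prob_filter M)"
    and th: "\<And>p. th p = rh p / hill (xs (fst p) (snd p)) (k (fst p))"
    and est: "\<forall>\<^sub>F p in prob_filter M. (\<exists>\<xi>' \<delta>'. bayes_system (xs (fst p) (snd p)) (k (fst p)) (s2 (fst p)) (th p) \<xi>' \<delta>') \<longrightarrow>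
        bayes_estimate (xs (fst p) (snd p)) (k (fst p)) (s2 (fst p)) (th p) (xh p) (dh p)"
  shows "D\<^sub>0 > 0"
    and "((\<lambda>p. sqrt (real (k (fst p))) * (xh p - \<xi>) - score_sum (1 + \<beta> * \<tau> / (1 - \<rho>)\<^sup>2) \<beta> (fst p) (snd p)) \<longlongrightarrow> 0) (prob_filter M)"
    and "tight M (\<lambda>p. sqrt (real (k (fst p))) * (xh p - \<xi>))"
    and "tight M (\<lambda>p. sqrt (real (k (fst p))) * dh p)"
    and "(th \<longlongrightarrow> \<tau>) (prob_filter M)"
proof -
  define r where "r p = sqrt (real (k (fst p)))" for p :: "nat \<times> 'a"
  define H where "H p = hill (xs (fst p) (snd p)) (k (fst p))" for p
  define E where "E p = E_stat (xs (fst p) (snd p)) (k (fst p)) (th p)" for p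
  define E2 where "E2 p = E_stat (xs (fst p) (snd p)) (k (fst p)) (2 * th p)" for p
  define A where "A p = \<Theta> (fst p) 0 (snd p) - \<xi> * T (fst p) 0 (snd p)" for p
  define B where "B p = \<tau> * \<Theta> (fst p) \<tau> (snd p) - \<xi> * \<tau> / (1 - \<xi> * \<tau>) * T (fst p) 0 (snd p)" for p
  define ks where "ks p = real (k (fst p)) * s2 (fst p)" for p :: "nat \<times> 'a"
  define D where "D p = D_bayes (xs (fst p) (snd p)) (k (fst p)) (s2 (fst p)) (th p) (H p)" for p
  define q where "q p = (1 - E p) * (1 / ks p - 2 * th p * E p + 2 * th p * E2 p + (th p)\<^sup>2 * E2 p)" for p
  define c where "c p = (1 - H p * th p) * (E p - 1 / (1 - H p * th p))" for p
  define W where "W p = r p * (E p - 1 / (1 - H p * th p))" for p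
  \<comment> \<open>The derivative of \<open>1 / (1 - x * \<tau>)\<close> at
    \<open>x = \<xi>\<close>: the system centres \<open>E\<close> with \<open>H\<close> in place of
    \<open>\<xi>\<close>, which feeds the Hill error back into \<open>W\<close>.\<close>
  define \<kappa> where "\<kappa> = \<tau> / (1 - \<rho>)\<^sup>2"
  have rho: "\<rho> < 0" unfolding \<rho>_def by (rule mult_pos_neg[OF xi_pos tau_neg])
  have r1: "1 - \<rho> > 0" "1 - 2 * \<rho> > 0" using rho by auto
  show D0: "D\<^sub>0 > 0"
  proof -
    have "\<rho> ^ 3 < 0" using rho by (simp add: power3_eq_cube mult_neg_neg mult_pos_neg)
    then have "\<tau> * \<rho> ^ 3 > 0" using tau_neg by (rule mult_neg_neg[rotated])
    moreover have "(1 - 2 * \<rho>) * (1 - \<rho>)\<^sup>2 > 0" using r1 by simp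
    ultimately show ?thesis unfolding D\<^sub>0_def using xi_pos mu by (intro add_pos_pos divide_pos_pos)
  qed
  have H: "(H \<longlongrightarrow> \<xi>) (prob_filter M)" unfolding H_def by (rule hill_consistent)
  have thH: "th p = rh p / H p" for p by (simp add: th H_def)
  have "((\<lambda>p. rh p / H p) \<longlongrightarrow> \<rho> / \<xi>) (prob_filter M)" using xi_pos by (intro tendsto_divide rh H) simp
  moreover have "\<rho> / \<xi> = \<tau>" using xi_pos by (simp add: \<rho>_def)
  ultimately show th_lim: "(th \<longlongrightarrow> \<tau>) (prob_filter M)" by (simp add: thH[abs_def])
  have Hpos: "\<forall>\<^sub>F p in prob_filter M. H p > 0" by (rule order_tendstoD(1)[OF H xi_pos])
  have Hth: "((\<lambda>p. H p * th p) \<longlongrightarrow> \<rho>) (prob_filter M)" unfolding \<rho>_def by (intro tendsto_mult H th_lim)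
  have xth: "((\<lambda>p. \<xi> * th p) \<longlongrightarrow> \<rho>) (prob_filter M)" unfolding \<rho>_def by (intro tendsto_mult tendsto_const th_lim)
  have Hth1: "\<forall>\<^sub>F p in prob_filter M. H p * th p < 1" by (rule order_tendstoD(2)[OF Hth]) (use rho in simp)
  have xth1: "\<forall>\<^sub>F p in prob_filter M. \<xi> * th p < 1" by (rule order_tendstoD(2)[OF xth]) (use rho in simp)
  have E_lim: "(E \<longlongrightarrow> 1 / (1 - \<rho>)) (prob_filter M)"
    unfolding E_def \<rho>_def by (rule E_stat_consistent[OF th_lim tau_neg])
  have "((\<lambda>p. 2 * th p) \<longlongrightarrow> 2 * \<tau>) (prob_filter M)" by (intro tendsto_mult tendsto_const th_lim)
  from E_stat_consistent[OF this] tau_neg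
  have E2_lim: "(E2 \<longlongrightarrow> 1 / (1 - 2 * \<rho>)) (prob_filter M)" unfolding E2_def \<rho>_def by (simp add: mult_ac)
  have Atight: "tight M A" unfolding A_def by (rule hill_score_tight)
  have Btight: "tight M B" unfolding B_def by (rule E_score_tight[OF tau_neg])
  have HA: "((\<lambda>p. r p * (H p - \<xi>) - A p) \<longlongrightarrow> 0) (prob_filter M)"
    using hill_expansion by (simp add: r_def H_def A_def)
  have EB: "((\<lambda>p. r p * (E p - 1 / (1 - \<xi> * th p)) - B p) \<longlongrightarrow> 0) (prob_filter M)"
    using E_stat_expansion[OF th_lim tau_neg] by (simp add: r_def E_def B_def)
  \<comment> \<open>The exact difference quotient whose limit is \<open>\<kappa>\<close>.\<close>
  define \<kappa>p where "\<kappa>p p = th p / ((1 - \<xi> * th p) * (1 - H p * th p))" for p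
  have "(\<kappa>p \<longlongrightarrow> \<tau> / ((1 - \<rho>) * (1 - \<rho>))) (prob_filter M)"
    unfolding \<kappa>p_def using r1 by (intro tendsto_intros th_lim xth Hth) auto
  then have \<kappa>p: "((\<lambda>p. \<kappa>p p - \<kappa>) \<longlongrightarrow> 0) (prob_filter M)"
    unfolding \<kappa>_def power2_eq_square by (rule LIM_zero)
  have WAB: "((\<lambda>p. W p - (B p - \<kappa> * A p)) \<longlongrightarrow> 0) (prob_filter M)"
  proof -
    have "((\<lambda>p. (r p * (E p - 1 / (1 - \<xi> * th p)) - B p) - (r p * (H p - \<xi>) - A p) * \<kappa>p p - (\<kappa>p p - \<kappa>) * A p) \<longlongrightarrow> 0 - 0 * (\<tau> / ((1 - \<rho>) * (1 - \<rho>))) - 0) (prob_filter M)"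
      by (intro tendsto_diff tendsto_mult EB HA tendsto_0_mult_tight[OF \<kappa>p Atight] \<open>(\<kappa>p \<longlongrightarrow> \<tau> / ((1 - \<rho>) * (1 - \<rho>))) (prob_filter M)\<close>)
    moreover have "\<forall>\<^sub>F p in prob_filter M. (r p * (E p - 1 / (1 - \<xi> * th p)) - B p) - (r p * (H p - \<xi>) - A p) * \<kappa>p p - (\<kappa>p p - \<kappa>) * A p = W p - (B p - \<kappa> * A p)"
      using Hth1 xth1
    proof eventually_elim
      case (elim p)
      have "1 / (1 - \<xi> * th p) - 1 / (1 - H p * th p) = - (H p - \<xi>) * \<kappa>p p"
        using elim by (simp add: \<kappa>p_def diff_frac_eq) (simp add: algebra_simps)
      then have e: "1 / (1 - H p * th p) = 1 / (1 - \<xi> * th p) + (H p - \<xi>) * \<kappa>p p" unfolding mult_minus_left by linarith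
      show ?case unfolding W_def e by (simp add: algebra_simps)
    qed
    ultimately show ?thesis by (auto intro: Lim_transform_eventually)
  qed
  have Wtight: "tight M W"
    by (rule tight_close[OF _ WAB]) (intro tight_diff tight_mult tight_const Atight Btight)
  have "((\<lambda>p. E p - 1 / (1 - H p * th p)) \<longlongrightarrow> 0) (prob_filter M)"
    by (rule tendsto_of_tight_scaled[OF _ sqrt_k_prob]) (use Wtight in \<open>simp add: W_def[abs_def] r_def\<close>)
  then have c0: "(c \<longlongrightarrow> 0) (prob_filter M)"
    unfolding c_def using tendsto_mult[OF tendsto_diff[OF tendsto_const Hth]] by fastforce
  have ks: "(ks \<longlongrightarrow> \<mu>) (prob_filter M)" unfolding ks_def by (rule tendsto_fst_prob[OF s2])
  have "(D \<longlongrightarrow> \<xi> / \<mu> - (1 - 2 * (1 - \<rho>) * (1 / (1 - \<rho>)) + (1 - 2 * \<rho> - \<xi> * \<tau>\<^sup>2) * (1 / (1 - 2 * \<rho>))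
       - \<tau> * (1 - 1 / (1 - \<rho>)) * (1 / (1 - \<rho>)))) (prob_filter M)"
  proof -
    have "D p = H p / ks p - (1 - 2 * (1 - H p * th p) * E p + (1 - 2 * (H p * th p) - H p * (th p)\<^sup>2) * E2 p - th p * (1 - E p) * E p)" for p
      by (simp add: D_def D_bayes_def ks_def E_def E2_def mult.assoc)
    then have D: "D = (\<lambda>p. H p / ks p - (1 - 2 * (1 - H p * th p) * E p + (1 - 2 * (H p * th p) - H p * (th p)\<^sup>2) * E2 p - th p * (1 - E p) * E p))"
      by (rule ext)
    show ?thesis unfolding D using mu by (intro tendsto_intros H ks Hth E_lim E2_lim th_lim) simp
  qed
  \<comment> \<open>The prior contributes \<open>\<xi> / \<mu>\<close>; in the remainder
    \<open>(1 - \<rho>)\<^sup>2 - (1 - 2 * \<rho>) = \<rho>\<^sup>2\<close> is the origin of the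
    factor \<open>\<rho> ^ 3\<close>.\<close>
  moreover have "\<xi> / \<mu> - (1 - 2 * (1 - \<rho>) * (1 / (1 - \<rho>)) + (1 - 2 * \<rho> - \<xi> * \<tau>\<^sup>2) * (1 / (1 - 2 * \<rho>))
       - \<tau> * (1 - 1 / (1 - \<rho>)) * (1 / (1 - \<rho>))) = D\<^sub>0"
  proof -
    define a where "a = 1 - \<rho>"
    define b where "b = 1 - 2 * \<rho>"
    have ab: "a \<noteq> 0" "b \<noteq> 0" using r1 by (auto simp: a_def b_def)
    have "\<xi> * \<tau>\<^sup>2 = \<tau> * \<rho>" by (simp add: \<rho>_def power2_eq_square)
    then have "\<xi> / \<mu> - (1 - 2 * a * (1 / a) + (b - \<xi> * \<tau>\<^sup>2) * (1 / b) - \<tau> * (1 - 1 / a) * (1 / a))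
      = \<xi> / \<mu> + \<tau> * (\<rho> / b + (1 - 1 / a) * (1 / a))" using ab by (simp add: field_simps)
    also have "\<rho> / b + (1 - 1 / a) * (1 / a) = \<rho> ^ 3 / (b * a\<^sup>2)"
    proof -
      have "(1 - 1 / a) * (1 / a) = - \<rho> / a\<^sup>2" using ab by (simp add: field_simps power2_eq_square a_def)
      then have "\<rho> / b + (1 - 1 / a) * (1 / a) = \<rho> / b - \<rho> / a\<^sup>2" by simp
      also have "\<dots> = \<rho> * (a\<^sup>2 - b) / (b * a\<^sup>2)" using ab by (simp add: diff_frac_eq algebra_simps)
      also have "a\<^sup>2 - b = \<rho>\<^sup>2" by (simp add: a_def b_def power2_eq_square algebra_simps)
      finally show ?thesis by (simp add: power3_eq_cube power2_eq_square)
    qed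
    finally show ?thesis by (simp add: D\<^sub>0_def a_def b_def)
  qed
  ultimately have D_lim: "(D \<longlongrightarrow> D\<^sub>0) (prob_filter M)" by simp
  have Dpos: "\<forall>\<^sub>F p in prob_filter M. D p > 0" by (rule order_tendstoD(1)[OF D_lim D0])
  define q0 where "q0 = (1 - 1 / (1 - \<rho>)) * (1 / \<mu> - 2 * \<tau> * (1 / (1 - \<rho>)) + 2 * \<tau> * (1 / (1 - 2 * \<rho>)) + \<tau>\<^sup>2 * (1 / (1 - 2 * \<rho>)))"
  have q_lim: "(q \<longlongrightarrow> q0) (prob_filter M)"
    unfolding q_def q0_def using mu by (intro tendsto_intros ks E_lim E2_lim th_lim) simp
  \<comment> \<open>\<open>c\<close> vanishes while \<open>D\<close> stays away from 0, so the
    condition for a small root holds with probability tending to 1; the system is then solvable and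
    \<open>est\<close> takes effect.\<close>
  have "((\<lambda>p. 4 * \<bar>q p\<bar> * \<bar>c p\<bar> - (D p)\<^sup>2) \<longlongrightarrow> 4 * \<bar>q0\<bar> * \<bar>0\<bar> - D\<^sub>0\<^sup>2) (prob_filter M)"
    by (intro tendsto_intros q_lim c0 D_lim)
  then have "\<forall>\<^sub>F p in prob_filter M. 4 * \<bar>q p\<bar> * \<bar>c p\<bar> - (D p)\<^sup>2 < 0"
    by (rule order_tendstoD(2)) (use D0 in simp)
  with Dpos est have key: "\<forall>\<^sub>F p in prob_filter M. D p > 0 \<and> \<bar>dh p\<bar> \<le> 2 * \<bar>c p\<bar> / D p \<and>
      bayes_system (xs (fst p) (snd p)) (k (fst p)) (s2 (fst p)) (th p) (xh p) (dh p) \<and>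
      D_bayes (xs (fst p) (snd p)) (k (fst p)) (s2 (fst p)) (th p) (xh p) = D p + q p * dh p"
  proof eventually_elim
    case (elim p)
    note S = bayes_estimate_small[of "xs (fst p) (snd p)" "k (fst p)" "s2 (fst p)" "th p",
        folded H_def E_def E2_def, folded c_def, folded ks_def, folded q_def, folded D_def]
    have le: "4 * \<bar>q p\<bar> * \<bar>c p\<bar> \<le> (D p)\<^sup>2" using elim by simp
    from elim(2) have be: "bayes_estimate (xs (fst p) (snd p)) (k (fst p)) (s2 (fst p)) (th p) (xh p) (dh p)"
      by (rule mp) (rule S(1)[OF elim(1) le])
    then have bs: "bayes_system (xs (fst p) (snd p)) (k (fst p)) (s2 (fst p)) (th p) (xh p) (dh p)"
      by (simp add: bayes_estimate_def)
    then have "xh p = H p + dh p * (1 - E p)" unfolding bayes_system_def H_def E_def by (elim conjE)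
    then show ?case using S(2)[OF elim(1) le be] S(3)[OF elim(1) le, of "dh p"] bs elim(1) by (simp only: simp_thms)
  qed
  \<comment> \<open>Consistency of \<open>dh\<close> comes first: it removes the nonlinear term
    \<open>q * dh\<close> from the denominator, after which the rate \<open>1 / sqrt k\<close> is
    inherited from \<open>W\<close>.\<close>
  have "((\<lambda>p. 2 * \<bar>c p\<bar> / D p) \<longlongrightarrow> 2 * \<bar>0\<bar> / D\<^sub>0) (prob_filter M)"
    using D0 by (intro tendsto_intros c0 D_lim) simp
  then have "((\<lambda>p. 2 * \<bar>c p\<bar> / D p) \<longlongrightarrow> 0) (prob_filter M)" by simp
  then have d0: "(dh \<longlongrightarrow> 0) (prob_filter M)"
    by (rule Lim_null_comparison[rotated]) (use key in \<open>eventually_elim, simp\<close>)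
  have "((\<lambda>p. D p + q p * dh p) \<longlongrightarrow> D\<^sub>0 + q0 * 0) (prob_filter M)" by (intro tendsto_intros D_lim q_lim d0)
  then have Dh: "((\<lambda>p. D p + q p * dh p) \<longlongrightarrow> D\<^sub>0) (prob_filter M)" by simp
  have gd: "((\<lambda>p. (1 - H p * th p) / (D p + q p * dh p)) \<longlongrightarrow> (1 - \<rho>) / D\<^sub>0) (prob_filter M)"
    using D0 by (intro tendsto_intros Hth Dh) simp
  have deq: "\<forall>\<^sub>F p in prob_filter M. (1 - H p * th p) / (D p + q p * dh p) * W p = r p * dh p
      \<and> xh p = H p + dh p * (1 - E p)"
    using key
  proof eventually_elim
    case (elim p)
    then have Deq: "D_bayes (xs (fst p) (snd p)) (k (fst p)) (s2 (fst p)) (th p) (xh p) = D p + q p * dh p"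
      and bs: "bayes_system (xs (fst p) (snd p)) (k (fst p)) (s2 (fst p)) (th p) (xh p) (dh p)" by blast+
    have e1: "dh p = (1 - H p * th p) / (D p + q p * dh p) * (E p - 1 / (1 - H p * th p))"
      and e2: "xh p = H p + dh p * (1 - E p)"
      using bs unfolding bayes_system_def H_def[symmetric] E_def[symmetric] Deq by blast+
    have e3: "(1 - H p * th p) / (D p + q p * dh p) * W p = r p * ((1 - H p * th p) / (D p + q p * dh p) * (E p - 1 / (1 - H p * th p)))"
      unfolding W_def by (simp only: mult_ac)
    show ?case using e2 e3 unfolding e1[symmetric] by blast
  qed
  have "tight M (\<lambda>p. (1 - H p * th p) / (D p + q p * dh p) * W p)"
    by (intro tight_mult Wtight tendsto_imp_tight[OF gd])
  then have "tight M (\<lambda>p. r p * dh p)"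
    by (rule tight_mono) (use deq in \<open>eventually_elim, simp\<close>)
  then show "tight M (\<lambda>p. sqrt (real (k (fst p))) * dh p)" by (simp add: r_def)
  define g where "g p = (1 - E p) * ((1 - H p * th p) / (D p + q p * dh p))" for p
  have "(g \<longlongrightarrow> (1 - 1 / (1 - \<rho>)) * ((1 - \<rho>) / D\<^sub>0)) (prob_filter M)"
    unfolding g_def by (intro tendsto_mult tendsto_diff tendsto_const E_lim gd)
  also have "(1 - 1 / (1 - \<rho>)) * ((1 - \<rho>) / D\<^sub>0) = - \<beta>"
  proof -
    have "(1 - 1 / (1 - \<rho>)) * (1 - \<rho>) = - \<rho>" using r1 by (simp add: left_diff_distrib)
    then show ?thesis by (simp only: times_divide_eq_right \<beta>_def minus_divide_left)
  qed
  finally have g: "(g \<longlongrightarrow> - \<beta>) (prob_filter M)" .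
  then have g0: "((\<lambda>p. g p - (- \<beta>)) \<longlongrightarrow> 0) (prob_filter M)" by (rule LIM_zero)
  have "((\<lambda>p. (r p * (H p - \<xi>) - A p) + (g p - (- \<beta>)) * W p + (- \<beta>) * (W p - (B p - \<kappa> * A p))) \<longlongrightarrow> 0 + 0 + (- \<beta>) * 0) (prob_filter M)"
    by (intro tendsto_add HA tendsto_0_mult_tight[OF g0 Wtight] tendsto_mult[OF tendsto_const WAB])
  moreover have "\<forall>\<^sub>F p in prob_filter M. (r p * (H p - \<xi>) - A p) + (g p - (- \<beta>)) * W p + (- \<beta>) * (W p - (B p - \<kappa> * A p))
     = r p * (xh p - \<xi>) - score_sum (1 + \<beta> * \<tau> / (1 - \<rho>)\<^sup>2) \<beta> (fst p) (snd p)"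
    using deq eventually_good
  proof eventually_elim
    case (elim p)
    have gW: "g p * W p = (1 - E p) * (r p * dh p)" using elim by (simp only: g_def mult.assoc)
    have xe: "xh p = H p + dh p * (1 - E p)" using elim by blast
    have x: "r p * (xh p - \<xi>) = r p * (H p - \<xi>) + g p * W p" unfolding gW xe by (simp add: algebra_simps)
    have s: "score_sum (1 + \<beta> * \<tau> / (1 - \<rho>)\<^sup>2) \<beta> (fst p) (snd p) = (1 + \<beta> * \<kappa>) * A p - \<beta> * B p"
      using elim by (subst score_sum_eq) (auto simp: A_def B_def \<kappa>_def)
    show ?case unfolding x s by (simp add: algebra_simps)
  qed
  ultimately have lim: "((\<lambda>p. r p * (xh p - \<xi>) - score_sum (1 + \<beta> * \<tau> / (1 - \<rho>)\<^sup>2) \<beta> (fst p) (snd p)) \<longlongrightarrow> 0) (prob_filter M)"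
    by (auto intro: Lim_transform_eventually)
  then show "((\<lambda>p. sqrt (real (k (fst p))) * (xh p - \<xi>) - score_sum (1 + \<beta> * \<tau> / (1 - \<rho>)\<^sup>2) \<beta> (fst p) (snd p)) \<longlongrightarrow> 0) (prob_filter M)"
    by (simp add: r_def)
  have "tight M (\<lambda>p. score_sum (1 + \<beta> * \<tau> / (1 - \<rho>)\<^sup>2) \<beta> (fst p) (snd p))"
  proof (rule tight_mono)
    show "tight M (\<lambda>p. (1 + \<beta> * \<kappa>) * A p - \<beta> * B p)" by (intro tight_diff tight_mult tight_const Atight Btight)
    show "\<forall>\<^sub>F p in prob_filter M. \<bar>score_sum (1 + \<beta> * \<tau> / (1 - \<rho>)\<^sup>2) \<beta> (fst p) (snd p)\<bar> \<le> \<bar>(1 + \<beta> * \<kappa>) * A p - \<beta> * B p\<bar>"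
      using eventually_good by eventually_elim (subst score_sum_eq, auto simp: A_def B_def \<kappa>_def)
  qed
  from tight_close[OF this lim] show "tight M (\<lambda>p. sqrt (real (k (fst p))) * (xh p - \<xi>))" by (simp add: r_def)
qed

text \<open>The logarithm of the estimate over the true probability is
  \<open>u = l - (ln y + z) / xh\<close> with \<open>ln y = \<xi> * l + ee - ln V\<close>. After
  multiplication by \<open>sqrt k / l\<close> the terms \<open>ee\<close>, \<open>z\<close> and
  \<open>ln V\<close> still vanish, which leaves \<open>sqrt k * (1 - \<xi> / xh)\<close>.\<close>

theorem tail_prob_expansion:
  fixes th xh dh :: "nat \<times> 'a \<Rightarrow> real" and x pr :: "nat \<Rightarrow> real"
  defines "L \<equiv> \<lambda>n. ln (real (k n) / (real n * pr n))"
  assumes xh: "tight M (\<lambda>p. sqrt (real (k (fst p))) * (xh p - \<xi>))"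
    and dh: "tight M (\<lambda>p. sqrt (real (k (fst p))) * dh p)"
    and th: "(th \<longlongrightarrow> \<tau>) (prob_filter M)"
    and pr: "\<forall>\<^sub>F n in sequentially. pr n > 0" and x: "\<forall>\<^sub>F n in sequentially. x n > 0"
    and L: "filterlim L at_top sequentially" and Lk: "(\<lambda>n. L n / sqrt (real (k n))) \<longlonglongrightarrow> 0"
    and e: "(\<lambda>n. sqrt (real (k n)) / L n * (ln (x n / t n) - \<xi> * L n)) \<longlonglongrightarrow> 0"
  shows "((\<lambda>p. sqrt (real (k (fst p))) / L (fst p) * \<xi> *
       (tail_prob_estimate (xs (fst p) (snd p)) (k (fst p)) (xh p) (dh p) (th p) (x (fst p)) / pr (fst p) - 1)
      - sqrt (real (k (fst p))) * (xh p - \<xi>)) \<longlongrightarrow> 0) (prob_filter M)"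
proof -
  obtain g where g: "\<And>z. exp z - 1 = g z * z" "isCont g 0" "g (0::real) = 1"
    using DERIV_exp[of "0::real"] unfolding CARAT_DERIV by auto
  define r where "r p = sqrt (real (k (fst p)))" for p :: "nat \<times> 'a"
  define l where "l p = L (fst p)" for p :: "nat \<times> 'a"
  define y where "y p = x (fst p) / (t (fst p) * V (fst p) (snd p))" for p
  \<comment> \<open>\<open>z\<close> is the logarithm of the EPD correction factor, and
    \<open>ee\<close> the deterministic error of extrapolating from \<open>t\<close> to
    \<open>x\<close> by a pure Pareto tail.\<close>
  define z where "z p = ln (1 + dh p * (1 - y p powr th p))" for p
  define ee where "ee p = ln (x (fst p) / t (fst p)) - \<xi> * l p" for p :: "nat \<times> 'a"
  define u where "u p = l p - (ln (y p) + z p) / xh p" for p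
  have l_top: "filterlim l at_top (prob_filter M)"
    unfolding l_def by (rule filterlim_compose[OF L filterlim_fst_prob_filter])
  have il: "((\<lambda>p. 1 / l p) \<longlongrightarrow> 0) (prob_filter M)"
    by (rule tendsto_divide_0[OF tendsto_const filterlim_at_top_imp_at_infinity[OF l_top]])
  have lpos: "\<forall>\<^sub>F p in prob_filter M. l p > 0" using l_top by (simp add: filterlim_at_top_dense)
  have e': "((\<lambda>p. r p / l p * ee p) \<longlongrightarrow> 0) (prob_filter M)"
    unfolding r_def l_def ee_def by (rule tendsto_fst_prob[OF e])
  have lr: "((\<lambda>p. l p / r p) \<longlongrightarrow> 0) (prob_filter M)"
    unfolding r_def l_def by (rule tendsto_fst_prob[OF Lk])
  have rpos: "\<forall>\<^sub>F p in prob_filter M. r p \<ge> 1"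
    using eventually_good by eventually_elim (simp add: r_def)
  have d0: "(dh \<longlongrightarrow> 0) (prob_filter M)" by (rule tendsto_of_tight_scaled[OF dh sqrt_k_prob])
  have x0: "(xh \<longlongrightarrow> \<xi>) (prob_filter M)" by (rule LIM_zero_cancel, rule tendsto_of_tight_scaled[OF xh sqrt_k_prob])
  have xpos: "\<forall>\<^sub>F p in prob_filter M. xh p > 0" by (rule order_tendstoD(1)[OF x0 xi_pos])
  have thneg: "\<forall>\<^sub>F p in prob_filter M. th p < 0" by (rule order_tendstoD(2)[OF th tau_neg])
  have dsmall: "\<forall>\<^sub>F p in prob_filter M. \<bar>dh p\<bar> < 1 / 2"
    using tendstoD[OF d0, of "1/2"] by (simp add: dist_real_def)
  have lny: "\<forall>\<^sub>F p in prob_filter M. y p > 0 \<and> t (fst p) > 0 \<and> V (fst p) (snd p) > 0 \<and> ln (y p) = \<xi> * l p + ee p - ln (V (fst p) (snd p))"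
    using eventually_good V_pos eventually_fst_prob[OF x]
    by eventually_elim (auto simp: y_def ee_def ln_div ln_mult)
  have U0: "((\<lambda>p. 1 / l p * U p) \<longlongrightarrow> 0) (prob_filter M)" by (rule tendsto_0_mult_tight[OF il U_tight])
  \<comment> \<open>Once \<open>y > 1\<close>, the power \<open>y powr th\<close> lies between 0 and
    1, which will bound \<open>z\<close> by \<open>2 * \<bar>dh\<bar>\<close>.\<close>
  have ypos: "\<forall>\<^sub>F p in prob_filter M. ln (y p) > 0"
  proof -
    have 1: "((\<lambda>p. r p / l p * ee p - 1 / l p * U p) \<longlongrightarrow> 0) (prob_filter M)"
      using tendsto_diff[OF e' U0] by simp
    have "\<forall>\<^sub>F p in prob_filter M. \<bar>r p / l p * ee p - 1 / l p * U p\<bar> < \<xi>"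
      using tendstoD[OF 1 xi_pos] by (simp add: dist_real_def)
    then show ?thesis using lny lpos rpos
    proof eventually_elim
      case (elim p)
      let ?w = "ee p - ln (V (fst p) (snd p))"
      have w: "r p / l p * ee p - 1 / l p * U p = r p / l p * ?w" by (simp add: U_def r_def right_diff_distrib)
      have "1 / l p * \<bar>?w\<bar> \<le> r p / l p * \<bar>?w\<bar>" using elim by (intro mult_right_mono divide_right_mono) auto
      also have "\<dots> < \<xi>" using elim w by (simp add: abs_mult)
      finally have "\<bar>?w\<bar> < \<xi> * l p" using elim by (simp add: field_simps)
      then show ?case using elim by linarith
    qed
  qed
  have zb: "\<forall>\<^sub>F p in prob_filter M. \<bar>z p\<bar> \<le> 2 * \<bar>dh p\<bar> \<and> 1 + dh p * (1 - y p powr th p) > 0"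
    using lny ypos thneg dsmall
  proof eventually_elim
    case (elim p)
    have "y p powr th p \<le> 1" "y p powr th p \<ge> 0"
      using elim by (auto simp: powr_def mult_nonpos_nonneg)
    then have "\<bar>dh p * (1 - y p powr th p)\<bar> \<le> \<bar>dh p\<bar>" unfolding abs_mult by (intro mult_left_le) auto
    moreover define w where "w = dh p * (1 - y p powr th p)"
    ultimately have w: "\<bar>w\<bar> \<le> \<bar>dh p\<bar>" "\<bar>w\<bar> \<le> 1 / 2" using elim by auto
    have "\<bar>ln (1 + w)\<bar> \<le> 2 * \<bar>w\<bar>" by (rule abs_ln_one_plus_le[OF w(2)])
    then show ?case using w by (auto simp: z_def w_def[symmetric])
  qed
  have z0: "((\<lambda>p. r p / l p * z p) \<longlongrightarrow> 0) (prob_filter M)"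
  proof (rule Lim_null_comparison)
    have "((\<lambda>p. 1 / l p * (r p * dh p)) \<longlongrightarrow> 0) (prob_filter M)"
      by (rule tendsto_0_mult_tight[OF il]) (use dh in \<open>simp add: r_def\<close>)
    from tendsto_mult[OF tendsto_const[of 2] tendsto_rabs_zero[OF this]]
    show "((\<lambda>p. 2 * \<bar>1 / l p * (r p * dh p)\<bar>) \<longlongrightarrow> 0) (prob_filter M)" by simp
    show "\<forall>\<^sub>F p in prob_filter M. norm (r p / l p * z p) \<le> 2 * \<bar>1 / l p * (r p * dh p)\<bar>"
      using zb lpos rpos
    proof eventually_elim
      case (elim p)
      have "r p / l p * \<bar>z p\<bar> \<le> r p / l p * (2 * \<bar>dh p\<bar>)" using elim by (intro mult_left_mono) auto
      then show ?case using elim by (simp add: abs_mult mult.left_commute)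
    qed
  qed
  have rt: "((\<lambda>p. \<xi> / xh p) \<longlongrightarrow> \<xi> / \<xi>) (prob_filter M)" using xi_pos by (intro tendsto_intros x0) simp
  then have rt1: "((\<lambda>p. \<xi> / xh p) \<longlongrightarrow> 1) (prob_filter M)" using xi_pos by simp
  then have rt0: "((\<lambda>p. \<xi> / xh p - 1) \<longlongrightarrow> 0) (prob_filter M)" by (rule LIM_zero)
  have xt: "tight M (\<lambda>p. r p * (xh p - \<xi>))" using xh by (simp add: r_def)
  \<comment> \<open>\<open>\<xi> * (1 - \<xi> / xh)\<close> equals
    \<open>\<xi> / xh * (xh - \<xi>)\<close>; replacing \<open>\<xi> / xh\<close> by 1 costs a
    vanishing factor times the tight \<open>r * (xh - \<xi>)\<close>.\<close>
  have "((\<lambda>p. (\<xi> / xh p - 1) * (r p * (xh p - \<xi>)) - \<xi> / xh p * (r p / l p * ee p + r p / l p * z p - 1 / l p * U p)) \<longlongrightarrow> 0 - 1 * (0 + 0 - 0)) (prob_filter M)"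
    by (intro tendsto_diff tendsto_mult tendsto_add rt1 e' z0 U0 tendsto_0_mult_tight[OF rt0 xt])
  moreover have "\<forall>\<^sub>F p in prob_filter M. (\<xi> / xh p - 1) * (r p * (xh p - \<xi>)) - \<xi> / xh p * (r p / l p * ee p + r p / l p * z p - 1 / l p * U p)
      = r p / l p * \<xi> * u p - r p * (xh p - \<xi>)"
    using xpos lpos lny
  proof eventually_elim
    case (elim p)
    define v where "v = ln (V (fst p) (snd p))"
    have U: "U p = r p * v" by (simp add: U_def r_def v_def)
    have "r p / l p * \<xi> * u p = r p * \<xi> - \<xi> / xh p * (r p / l p * (\<xi> * l p + ee p - v + z p))"
      using elim by (simp add: u_def v_def right_diff_distrib mult.commute mult.left_commute)
    also have "r p / l p * (\<xi> * l p + ee p - v + z p) = r p * \<xi> + (r p / l p * ee p + r p / l p * z p - 1 / l p * U p)"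
      unfolding U using elim by (simp add: algebra_simps)
    finally have 1: "r p / l p * \<xi> * u p = r p * \<xi> - \<xi> / xh p * (r p * \<xi>) - \<xi> / xh p * (r p / l p * ee p + r p / l p * z p - 1 / l p * U p)"
      by (simp only: distrib_left diff_diff_eq)
    have 2: "\<xi> / xh p * (r p * (xh p - \<xi>)) = r p * \<xi> - \<xi> / xh p * (r p * \<xi>)"
      using elim by (simp add: right_diff_distrib)
    show ?case unfolding 1 left_diff_distrib 2 by simp
  qed
  ultimately have uu: "((\<lambda>p. r p / l p * \<xi> * u p - r p * (xh p - \<xi>)) \<longlongrightarrow> 0) (prob_filter M)"
    by (auto intro: Lim_transform_eventually)
  have ut: "tight M (\<lambda>p. r p / l p * \<xi> * u p)" by (rule tight_close[OF xt uu])
  \<comment> \<open>Here the condition on \<open>L n / sqrt k\<close> enters: the log ratio itself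
    vanishes, so that \<open>exp u - 1\<close> may be replaced by \<open>u\<close>.\<close>
  have "((\<lambda>p. l p / r p * (1 / \<xi>)) \<longlongrightarrow> 0) (prob_filter M)" using tendsto_mult[OF lr tendsto_const[of "1 / \<xi>"]] by simp
  from tendsto_0_mult_tight[OF this ut]
  have "((\<lambda>p. l p / r p * (1 / \<xi>) * (r p / l p * \<xi> * u p)) \<longlongrightarrow> 0) (prob_filter M)" .
  moreover have "\<forall>\<^sub>F p in prob_filter M. l p / r p * (1 / \<xi>) * (r p / l p * \<xi> * u p) = u p"
    using lpos rpos by eventually_elim (use xi_pos in simp)
  ultimately have u0: "(u \<longlongrightarrow> 0) (prob_filter M)" by (rule Lim_transform_eventually)
  have "((\<lambda>p. g (u p) - 1) \<longlongrightarrow> g 0 - 1) (prob_filter M)"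
    by (intro tendsto_diff tendsto_const isCont_tendsto_compose[OF g(2) u0])
  then have g0: "((\<lambda>p. g (u p) - 1) \<longlongrightarrow> 0) (prob_filter M)" by (simp add: g)
  have "((\<lambda>p. (g (u p) - 1) * (r p / l p * \<xi> * u p) + (r p / l p * \<xi> * u p - r p * (xh p - \<xi>))) \<longlongrightarrow> 0 + 0) (prob_filter M)"
    by (intro tendsto_add uu tendsto_0_mult_tight[OF g0 ut])
  moreover have "\<forall>\<^sub>F p in prob_filter M. (g (u p) - 1) * (r p / l p * \<xi> * u p) + (r p / l p * \<xi> * u p - r p * (xh p - \<xi>)) =
     r p / l p * \<xi> * (tail_prob_estimate (xs (fst p) (snd p)) (k (fst p)) (xh p) (dh p) (th p) (x (fst p)) / pr (fst p) - 1) - r p * (xh p - \<xi>)"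
    using xpos lny zb eventually_good eventually_fst_prob[OF pr]
  proof eventually_elim
    case (elim p)
    obtain n \<omega> where p: "p = (n, \<omega>)" by (cases p)
    have len: "length (xs n \<omega>) = n" by (simp add: xs_def)
    have y: "x n / order_stat (xs n \<omega>) (n - k n) = y p" using elim by (simp add: y_def p V_def)
    have b: "1 + dh p - dh p * y p powr th p = 1 + dh p * (1 - y p powr th p)" by (simp add: algebra_simps)
    have "EPD_tail (xh p) (dh p) (th p) (y p) = exp (- (ln (y p) + z p) / xh p)"
    proof -
      have pos: "y p * (1 + dh p * (1 - y p powr th p)) > 0" using elim by (intro mult_pos_pos) auto
      have ln: "ln (y p * (1 + dh p * (1 - y p powr th p))) = ln (y p) + z p"
        unfolding z_def using elim by (intro ln_mult_pos) auto
      have "EPD_tail (xh p) (dh p) (th p) (y p) = exp (- 1 / xh p * (ln (y p) + z p))"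
        unfolding EPD_tail_def b ln[symmetric] using pos powr_def by (metis less_irrefl)
      then show ?thesis by (simp only: minus_divide_left mult_1 times_divide_eq_left mult_minus_left)
    qed
    moreover have "real (k n) / (real n * pr n) = exp (l p)" using elim by (simp add: l_def L_def p)
    ultimately have "tail_prob_estimate (xs n \<omega>) (k n) (xh p) (dh p) (th p) (x n) / pr n = exp (l p) * exp (- (ln (y p) + z p) / xh p)"
      unfolding tail_prob_estimate_def len y by (simp flip: \<open>real (k n) / (real n * pr n) = exp (l p)\<close>)
    also have "\<dots> = exp (u p)" by (simp only: u_def exp_add[symmetric] minus_divide_left[symmetric] add_uminus_conv_diff)
    finally have t: "tail_prob_estimate (xs (fst p) (snd p)) (k (fst p)) (xh p) (dh p) (th p) (x (fst p)) / pr (fst p) - 1 = g (u p) * u p"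
      by (simp add: p g(1)[symmetric])
    show ?case unfolding t by (simp add: algebra_simps diff_divide_distrib)
  qed
  ultimately show ?thesis unfolding r_def l_def by (auto intro: Lim_transform_eventually)
qed

end

section \<open>Measurability of the statistics\<close>

text \<open>Sublevel sets of an order statistic are count events: rank \<open>j\<close> is at most
  \<open>c\<close> when no more than \<open>n - j\<close> observations exceed
  \<open>c\<close>.\<close>

lemma order_stat_measurable:
  fixes X :: "nat \<Rightarrow> 'a \<Rightarrow> real"
  assumes [measurable]: "\<And>i. X i \<in> borel_measurable M" and j: "1 \<le> j" "j \<le> n"
  shows "(\<lambda>\<omega>. order_stat (map (\<lambda>i. X i \<omega>) [1..<Suc n]) j) \<in> borel_measurable M"
proof (subst borel_measurable_iff_le, intro allI)
  fix c
  have "order_stat (map (\<lambda>i. X i \<omega>) [1..<Suc n]) j \<le> c \<longleftrightarrow> (\<Sum>i=1..n. indicator {c<..} (X i \<omega>) :: real) \<le> real (n - j)" for \<omega>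
  proof -
    have e: "n - (n - j) = j" using j by simp
    have 1: "order_stat (map (\<lambda>i. X i \<omega>) [1..<Suc n]) (n - (n - j)) \<le> c \<longleftrightarrow> card {i\<in>{1..n}. X i \<omega> > c} \<le> n - j"
      using j by (intro order_stat_sample) auto
    have 2: "real (card {i\<in>{1..n}. X i \<omega> > c}) = (\<Sum>i=1..n. indicator {c<..} (X i \<omega>))"
      by (simp add: indicator_def sum.If_cases Int_def)
    show ?thesis using 1 unfolding e 2[symmetric] of_nat_le_iff .
  qed
  then show "{\<omega> \<in> space M. order_stat (map (\<lambda>i. X i \<omega>) [1..<Suc n]) j \<le> c} \<in> sets M" by simp
qed

lemma hill_measurable:
  fixes X :: "nat \<Rightarrow> 'a \<Rightarrow> real"
  assumes X: "\<And>i. X i \<in> borel_measurable M" and k: "k < n"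
  shows "(\<lambda>\<omega>. hill (map (\<lambda>i. X i \<omega>) [1..<Suc n]) k) \<in> borel_measurable M"
proof -
  have "(\<lambda>\<omega>. (\<Sum>j=1..k. ln (order_stat (map (\<lambda>i. X i \<omega>) [1..<Suc n]) (n - j + 1) / order_stat (map (\<lambda>i. X i \<omega>) [1..<Suc n]) (n - k))) / real k) \<in> borel_measurable M"
    using k by (intro borel_measurable_divide borel_measurable_sum borel_measurable_ln order_stat_measurable[OF X] borel_measurable_const) auto
  then show ?thesis by (simp add: hill_def rel_excess_def del: upt_Suc)
qed

lemma tail_prob_estimate_measurable:
  fixes X :: "nat \<Rightarrow> 'a \<Rightarrow> real"
  assumes X: "\<And>i. X i \<in> borel_measurable M" and k: "k < n"
    and [measurable]: "xh \<in> borel_measurable M" "dh \<in> borel_measurable M" "th \<in> borel_measurable M"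
  shows "(\<lambda>\<omega>. tail_prob_estimate (map (\<lambda>i. X i \<omega>) [1..<Suc n]) k (xh \<omega>) (dh \<omega>) (th \<omega>) x) \<in> borel_measurable M"
proof -
  have len: "length (map (\<lambda>i. X i \<omega>) [1..<Suc n]) = n" for \<omega> by simp
  have [measurable]: "(\<lambda>\<omega>. order_stat (map (\<lambda>i. X i \<omega>) [1..<Suc n]) (n - k)) \<in> borel_measurable M"
    using k by (intro order_stat_measurable[OF X]) auto
  show ?thesis unfolding tail_prob_estimate_def EPD_tail_def len by measurable
qed

section \<open>The extreme quantile\<close>

text \<open>The scaled tail at \<open>x n\<close> is \<open>n * p n / k n\<close>, so
  \<open>ln (x n / t n) - \<xi> * L n\<close> equals
  \<open>\<xi> * ln (1 + \<delta> (x n) / \<xi>)\<close>. Potter's bound compares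
  \<open>\<delta> (x n)\<close> with \<open>\<delta>\<close> at the threshold, which is of order
  \<open>1 / sqrt k\<close>.\<close>

lemma (in ep_tail) tail_prob_asymptotics:
  fixes x p :: "nat \<Rightarrow> real"
  assumes mono: "mono F" and k: "filterlim k at_top sequentially" and kn: "(\<lambda>n. real (k n) / real n) \<longlonglongrightarrow> 0"
    and del: "(\<lambda>n. sqrt (real (k n)) * \<delta> (threshold k n)) \<longlonglongrightarrow> lam"
    and p: "\<And>n. p n = 1 - F (x n)" and np: "(\<lambda>n. real n * p n / real (k n)) \<longlonglongrightarrow> 0"
  defines "L \<equiv> \<lambda>n. ln (real (k n) / (real n * p n))"
  shows "p n > 0" and "\<forall>\<^sub>F n in sequentially. x n > 0" and "filterlim L at_top sequentially"
    and "(\<lambda>n. sqrt (real (k n)) / L n * (ln (x n / threshold k n) - \<xi> * L n)) \<longlonglongrightarrow> 0"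
proof -
  have kp: "\<forall>\<^sub>F n in sequentially. k n > 0" by (rule eventually_compose_filterlim[OF eventually_gt_at_top k])
  have "((\<lambda>x. 1 + \<delta> x / \<xi>) \<longlongrightarrow> 1 + 0 / \<xi>) at_top" using xi_pos by (intro tendsto_intros delta_vanishes) simp
  then have d1: "((\<lambda>x. 1 + \<delta> x / \<xi>) \<longlongrightarrow> 1) at_top" by simp
  have "\<forall>\<^sub>F x in at_top. 1 - F x > 0"
    using order_tendstoD(1)[OF d1 zero_less_one] eventually_gt_at_top[of 0]
    by eventually_elim (use C_pos in \<open>auto simp: tail\<close>)
  then obtain x1 where x1: "\<And>x. x \<ge> x1 \<Longrightarrow> 1 - F x > 0" by (auto simp: eventually_at_top_linorder)
  \<comment> \<open>A tail that is positive near infinity is positive everywhere, by monotonicity of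
    \<open>F\<close>.\<close>
  have pos: "1 - F y > 0" for y
  proof -
    have "F y \<le> F (max y x1)" by (rule monoD[OF mono]) simp
    then show ?thesis using x1[of "max y x1"] by simp
  qed
  show pp: "p n > 0" for n unfolding p by (rule pos)
  have "(\<lambda>n. real n * p n / real (k n) * (real (k n) / real n)) \<longlonglongrightarrow> 0" using tendsto_mult[OF np kn] by simp
  moreover have "\<forall>\<^sub>F n in sequentially. real n * p n / real (k n) * (real (k n) / real n) = p n"
    using kp eventually_gt_at_top[of 0] by eventually_elim simp
  ultimately have p0: "p \<longlonglongrightarrow> 0" by (rule Lim_transform_eventually)
  have x_top: "filterlim x at_top sequentially"
    unfolding filterlim_at_top
  proof
    fix B
    have "\<forall>\<^sub>F n in sequentially. p n < 1 - F B" by (rule order_tendstoD(2)[OF p0 pos])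
    then show "\<forall>\<^sub>F n in sequentially. B \<le> x n"
    proof eventually_elim
      case (elim n)
      then have "F B < F (x n)" by (simp add: p)
      then show ?case using monoD[OF mono, of "x n" B] by linarith
    qed
  qed
  show xp: "\<forall>\<^sub>F n in sequentially. x n > 0" by (rule eventually_compose_filterlim[OF eventually_gt_at_top x_top])
  have tp: "\<forall>\<^sub>F n in sequentially. threshold k n > 0"
    using kp eventually_gt_at_top[of 0] by eventually_elim (use C_pos in \<open>simp add: threshold_def\<close>)
  have dx: "(\<lambda>n. \<delta> (x n)) \<longlonglongrightarrow> 0" by (rule filterlim_compose[OF delta_vanishes x_top])
  have dx1: "(\<lambda>n. 1 + \<delta> (x n) / \<xi>) \<longlonglongrightarrow> 1" by (rule filterlim_compose[OF d1 x_top])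
  have inv: "\<forall>\<^sub>F n in sequentially. real n * p n / real (k n) > 0"
    using kp eventually_gt_at_top[of 0] by eventually_elim (simp add: pp)
  show L: "filterlim L at_top sequentially"
    unfolding L_def
    by (rule filterlim_compose[OF ln_at_top]) (use filterlim_inverse_at_top[OF np inv] in \<open>simp add: inverse_eq_divide\<close>)
  have sc: "\<forall>\<^sub>F n in sequentially. real n * p n / real (k n) = (x n / threshold k n) powr (- 1 / \<xi>) * (1 + \<delta> (x n) / \<xi>)"
    using kp eventually_gt_at_top[of 0] xp tp
  proof eventually_elim
    case (elim n)
    then show ?case using scaled_tail[of k n "x n / threshold k n"] by (simp add: p)
  qed
  have "\<forall>\<^sub>F n in sequentially. 1 + \<delta> (x n) / \<xi> > 1 / 2" by (rule order_tendstoD(1)[OF dx1]) simp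
  moreover have "\<forall>\<^sub>F n in sequentially. real n * p n / real (k n) < 1 / 2" by (rule order_tendstoD(2)[OF np]) simp
  \<comment> \<open>Potter's bound requires \<open>x n\<close> above the threshold. Were it below,
    the scaled tail would exceed 1/2, against its limit 0.\<close>
  ultimately have xt: "\<forall>\<^sub>F n in sequentially. x n \<ge> threshold k n"
    using sc xp tp
  proof eventually_elim
    case (elim n)
    show ?case
    proof (rule ccontr)
      assume "\<not> ?thesis"
      then have "x n / threshold k n \<le> 1" "x n / threshold k n > 0" using elim by simp_all
      then have "(x n / threshold k n) powr (- 1 / \<xi>) \<ge> 1"
        using xi_pos powr_mono2'[of "- 1 / \<xi>" "x n / threshold k n" 1] by simp
      then have "1 * (1 + \<delta> (x n) / \<xi>) \<le> (x n / threshold k n) powr (- 1 / \<xi>) * (1 + \<delta> (x n) / \<xi>)"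
        by (rule mult_right_mono) (use elim(1) in linarith)
      then have le: "1 + \<delta> (x n) / \<xi> \<le> real n * p n / real (k n)" unfolding elim(3) by simp
      show False using less_le_trans[OF elim(1) less_imp_le[OF le_less_trans[OF le elim(2)]]] by simp
    qed
  qed
  obtain K x0 where K: "K > 0" "\<And>x v. x \<ge> x0 \<Longrightarrow> v \<ge> 1 \<Longrightarrow> \<bar>\<delta> (x * v)\<bar> \<le> K * v powr (\<tau> / 2) * \<bar>\<delta> x\<bar>"
    using delta_Potter by blast
  have tx0: "\<forall>\<^sub>F n in sequentially. threshold k n \<ge> x0"
    using threshold_at_top[OF k kn] by (simp add: filterlim_at_top)
  have db: "\<forall>\<^sub>F n in sequentially. \<bar>\<delta> (x n)\<bar> \<le> K * \<bar>\<delta> (threshold k n)\<bar>"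
    using tx0 xt tp
  proof eventually_elim
    case (elim n)
    have v: "x n / threshold k n \<ge> 1" using elim by simp
    then have "(x n / threshold k n) powr (\<tau> / 2) \<le> 1" using tau_neg powr_mono2'[of "\<tau> / 2" 1 "x n / threshold k n"] by simp
    then have "K * (x n / threshold k n) powr (\<tau> / 2) * \<bar>\<delta> (threshold k n)\<bar> \<le> K * 1 * \<bar>\<delta> (threshold k n)\<bar>"
      using K(1) by (intro mult_right_mono mult_left_mono) auto
    then show ?case using K(2)[OF elim(1) v] elim by simp
  qed
  have iL: "(\<lambda>n. 1 / L n) \<longlonglongrightarrow> 0"
    by (rule tendsto_divide_0[OF tendsto_const filterlim_at_top_imp_at_infinity[OF L]])
  have "(\<lambda>n. 1 / L n * (2 * K * \<bar>sqrt (real (k n)) * \<delta> (threshold k n)\<bar>)) \<longlonglongrightarrow> 0 * (2 * K * \<bar>lam\<bar>)"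
    by (intro tendsto_intros iL del)
  then have "(\<lambda>n. 1 / L n * (2 * K * \<bar>sqrt (real (k n)) * \<delta> (threshold k n)\<bar>)) \<longlonglongrightarrow> 0" by simp
  then show "(\<lambda>n. sqrt (real (k n)) / L n * (ln (x n / threshold k n) - \<xi> * L n)) \<longlonglongrightarrow> 0"
  proof (rule Lim_null_comparison[rotated])
    have small: "\<forall>\<^sub>F n in sequentially. \<bar>\<delta> (x n)\<bar> < \<xi> / 2"
      using tendstoD[OF dx, of "\<xi> / 2"] xi_pos by (simp add: dist_real_def)
    have Lp: "\<forall>\<^sub>F n in sequentially. L n > 0" using L by (simp add: filterlim_at_top_dense)
    show "\<forall>\<^sub>F n in sequentially. norm (sqrt (real (k n)) / L n * (ln (x n / threshold k n) - \<xi> * L n))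
        \<le> 1 / L n * (2 * K * \<bar>sqrt (real (k n)) * \<delta> (threshold k n)\<bar>)"
      using small Lp sc xp tp db inv
    proof eventually_elim
      case (elim n)
      define w where "w = \<delta> (x n) / \<xi>"
      have w: "\<bar>w\<bar> \<le> 1 / 2" using elim xi_pos by (simp add: w_def field_simps)
      have "real (k n) / (real n * p n) = inverse (real n * p n / real (k n))" by (simp only: inverse_divide)
      then have "L n = - ln (real n * p n / real (k n))"
        unfolding L_def by (simp only: ln_inverse)
      also have "\<dots> = - (- 1 / \<xi> * ln (x n / threshold k n) + ln (1 + w))"
        using elim w unfolding elim(3) w_def[symmetric] by (subst ln_mult_pos) (auto simp: ln_powr abs_le_iff)
      finally have "ln (x n / threshold k n) - \<xi> * L n = \<xi> * ln (1 + w)" using xi_pos by (simp add: field_simps)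
      moreover have "\<bar>ln (1 + w)\<bar> \<le> 2 * \<bar>w\<bar>" by (rule abs_ln_one_plus_le[OF w])
      ultimately have "\<bar>ln (x n / threshold k n) - \<xi> * L n\<bar> \<le> \<xi> * (2 * \<bar>w\<bar>)"
        using xi_pos by (simp add: abs_mult)
      also have "\<dots> = 2 * \<bar>\<delta> (x n)\<bar>" using xi_pos by (simp add: w_def abs_divide)
      also have "\<dots> \<le> 2 * (K * \<bar>\<delta> (threshold k n)\<bar>)" using elim by simp
      finally have "sqrt (real (k n)) / L n * \<bar>ln (x n / threshold k n) - \<xi> * L n\<bar> \<le> sqrt (real (k n)) / L n * (2 * (K * \<bar>\<delta> (threshold k n)\<bar>))"
        using elim by (intro mult_left_mono) auto
      then show ?case using elim by (simp add: abs_mult mult_ac)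
    qed
  qed
qed

text \<open>Each condition on \<open>d\<close> concerns \<open>sqrt k * \<delta>\<close> at the
  threshold times a ratio of values of \<open>\<delta>\<close>: Potter's bound gives
  \<open>d_bound\<close>, regular variation \<open>d_lim\<close>, and the version with a moving
  ratio \<open>d_loc\<close>.\<close>

lemma (in ep_tail) tail_array_threshold:
  assumes M: "prob_space M" and ind: "prob_space.indep_vars M (\<lambda>_. borel) X UNIV"
    and cdf: "\<And>i. cdf (distr M borel (X i)) = F"
    and k: "filterlim k at_top sequentially" and kn: "(\<lambda>n. real (k n) / real n) \<longlonglongrightarrow> 0"
    and del: "(\<lambda>n. sqrt (real (k n)) * \<delta> (threshold k n)) \<longlonglongrightarrow> lam"
  shows "\<exists>K. tail_array M X F \<xi> \<tau> lam K k (threshold k) (\<lambda>n y. \<delta> (threshold k n * exp y) / \<xi>)"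
proof -
  have t_top: "filterlim (threshold k) at_top sequentially" by (rule threshold_at_top[OF k kn])
  have kp: "\<forall>\<^sub>F n in sequentially. k n > 0" by (rule eventually_compose_filterlim[OF eventually_gt_at_top k])
  have "\<forall>\<^sub>F n in sequentially. real (k n) / real n < 1" by (rule order_tendstoD(2)[OF kn]) simp
  then have klt: "\<forall>\<^sub>F n in sequentially. k n < n" using eventually_gt_at_top[of 0]
    by eventually_elim (simp add: field_simps)
  have tz: "\<forall>\<^sub>F n in sequentially. \<delta> (threshold k n) \<noteq> 0" by (rule eventually_compose_filterlim[OF delta_nonzero t_top])
  obtain K x0 where K: "K > 0" "\<And>x v. x \<ge> x0 \<Longrightarrow> v \<ge> 1 \<Longrightarrow> \<bar>\<delta> (x * v)\<bar> \<le> K * v powr (\<tau> / 2) * \<bar>\<delta> x\<bar>"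
    using delta_Potter by blast
  have ratio: "(\<lambda>n. sqrt (real (k n)) * (\<delta> (threshold k n * w n) / \<xi>)) \<longlonglongrightarrow> lam / \<xi> * c"
    if "(\<lambda>n. \<delta> (threshold k n * w n) / \<delta> (threshold k n)) \<longlonglongrightarrow> c" for w c
  proof -
    have "(\<lambda>n. sqrt (real (k n)) * \<delta> (threshold k n) / \<xi> * (\<delta> (threshold k n * w n) / \<delta> (threshold k n))) \<longlonglongrightarrow> lam / \<xi> * c"
      using xi_pos by (intro tendsto_intros del that) simp
    moreover have "\<forall>\<^sub>F n in sequentially. sqrt (real (k n)) * \<delta> (threshold k n) / \<xi> * (\<delta> (threshold k n * w n) / \<delta> (threshold k n)) =
       sqrt (real (k n)) * (\<delta> (threshold k n * w n) / \<xi>)"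
      using tz by eventually_elim simp
    ultimately show ?thesis by (rule Lim_transform_eventually)
  qed
  have "tail_array M X F \<xi> \<tau> lam (K * (\<bar>lam\<bar> + 1) / \<xi>) k (threshold k) (\<lambda>n y. \<delta> (threshold k n * exp y) / \<xi>)"
  proof (intro tail_array.intro tail_array_axioms.intro M ind cdf xi_pos tau_neg k klt)
    show "\<forall>\<^sub>F n in sequentially. threshold k n > 0"
      by (rule eventually_compose_filterlim[OF eventually_gt_at_top t_top])
    show "\<forall>\<^sub>F n in sequentially. \<forall>y. real n / real (k n) * (1 - F (threshold k n * exp y)) = exp (- y / \<xi>) * (1 + \<delta> (threshold k n * exp y) / \<xi>)"
      using kp eventually_gt_at_top[of 0]
    proof eventually_elim
      case (elim n)
      show ?case using scaled_tail[of k n "exp _"] elim by (auto simp: powr_def)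
    qed
    show "\<forall>\<^sub>F n in sequentially. \<forall>y\<ge>0. sqrt (real (k n)) * \<bar>\<delta> (threshold k n * exp y) / \<xi>\<bar> \<le> K * (\<bar>lam\<bar> + 1) / \<xi>"
    proof -
      have "\<forall>\<^sub>F n in sequentially. \<bar>sqrt (real (k n)) * \<delta> (threshold k n)\<bar> < \<bar>lam\<bar> + 1"
        by (rule order_tendstoD(2)[OF tendsto_rabs[OF del]]) simp
      moreover have "\<forall>\<^sub>F n in sequentially. threshold k n \<ge> x0" using t_top by (simp add: filterlim_at_top)
      ultimately show ?thesis
      proof (eventually_elim, intro allI impI)
        fix n and y :: real
        assume a: "\<bar>sqrt (real (k n)) * \<delta> (threshold k n)\<bar> < \<bar>lam\<bar> + 1" and b: "threshold k n \<ge> x0" and y: "y \<ge> 0"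
        have "\<bar>\<delta> (threshold k n * exp y)\<bar> \<le> K * exp y powr (\<tau> / 2) * \<bar>\<delta> (threshold k n)\<bar>" using y by (intro K(2) b) simp
        also have "\<dots> \<le> K * 1 * \<bar>\<delta> (threshold k n)\<bar>"
          using K(1) y tau_neg by (intro mult_right_mono mult_left_mono) (auto simp: powr_def mult_nonpos_nonneg)
        finally have "sqrt (real (k n)) * \<bar>\<delta> (threshold k n * exp y)\<bar> \<le> sqrt (real (k n)) * (K * \<bar>\<delta> (threshold k n)\<bar>)"
          by (intro mult_left_mono) auto
        also have "\<dots> = K * \<bar>sqrt (real (k n)) * \<delta> (threshold k n)\<bar>" by (simp add: abs_mult)
        also have "\<dots> \<le> K * (\<bar>lam\<bar> + 1)" using a K(1) by (intro mult_left_mono) auto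
        finally have "sqrt (real (k n)) * \<bar>\<delta> (threshold k n * exp y)\<bar> / \<xi> \<le> K * (\<bar>lam\<bar> + 1) / \<xi>"
          using xi_pos by (intro divide_right_mono) auto
        then show "sqrt (real (k n)) * \<bar>\<delta> (threshold k n * exp y) / \<xi>\<bar> \<le> K * (\<bar>lam\<bar> + 1) / \<xi>"
          using xi_pos by (simp add: abs_divide)
      qed
    qed
    show "(\<lambda>n. sqrt (real (k n)) * (\<delta> (threshold k n * exp y) / \<xi>)) \<longlonglongrightarrow> lam / \<xi> * exp (\<tau> * y)" for y
    proof -
      have "exp y powr \<tau> = exp (\<tau> * y)" by (simp add: powr_def)
      then show ?thesis using ratio[OF delta_regular[OF t_top, of "exp y"]] by simp
    qed
    show "(\<lambda>n. sqrt (real (k n)) * (\<delta> (threshold k n * exp (y / sqrt (real (k n)))) / \<xi>)) \<longlonglongrightarrow> lam / \<xi>" for y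
    proof -
      have "(\<lambda>n. y / sqrt (real (k n))) \<longlonglongrightarrow> 0"
        by (rule tendsto_divide_0[OF tendsto_const filterlim_at_top_imp_at_infinity[OF sqrt_nat_at_top[OF k]]])
      from tendsto_exp[OF this] have "(\<lambda>n. exp (y / sqrt (real (k n)))) \<longlonglongrightarrow> 1" by simp
      from ratio[OF delta_moving[OF t_top this]] show ?thesis by simp
    qed
  qed
  then show ?thesis by blast
qed

text \<open>With \<open>S = \<zeta> + \<rho> ^ 4\<close>, \<open>a = 1 - \<rho>\<close> and
  \<open>b = 1 - 2 * \<rho>\<close> one has \<open>D\<^sub>0 = S / (\<xi> * b * a\<^sup>2)\<close>.
  Both forms of the variance reduce to
  \<open>\<xi>\<^sup>2 * (1 + \<rho> ^ 6 * b / S\<^sup>2)\<close>, mainly through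
  \<open>a\<^sup>2 = b + \<rho>\<^sup>2\<close>.\<close>

lemma limit_mean_variance:
  fixes \<xi> \<tau> \<rho> \<mu> lam \<zeta> D\<^sub>0 \<alpha> \<beta> :: real
  assumes "\<xi> > 0" "\<tau> < 0" "\<mu> > 0" and rho: "\<rho> = \<xi> * \<tau>"
    and zeta: "\<zeta> = \<xi>\<^sup>2 * (1 - 2 * \<rho>) * (1 - \<rho>)\<^sup>2 / \<mu>"
    and D0: "D\<^sub>0 = \<xi> / \<mu> + \<tau> * \<rho> ^ 3 / ((1 - 2 * \<rho>) * (1 - \<rho>)\<^sup>2)"
    and beta: "\<beta> = \<rho> / D\<^sub>0" and alpha: "\<alpha> = 1 + \<beta> * \<tau> / (1 - \<rho>)\<^sup>2"
  shows "lam * (\<alpha> * \<rho> / (1 - \<rho>) - \<beta> * \<tau> * \<rho> / ((1 - 2 * \<rho>) * (1 - \<rho>))) = lam * \<rho> / (1 - \<rho>) * (\<zeta> / (\<zeta> + \<rho> ^ 4))"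
    and "\<alpha>\<^sup>2 * \<xi>\<^sup>2 - 2 * \<alpha> * \<beta> * \<xi> * \<rho> / (1 - \<rho>)\<^sup>2 + \<beta>\<^sup>2 * \<rho>\<^sup>2 / ((1 - 2 * \<rho>) * (1 - \<rho>)\<^sup>2)
      = \<xi>\<^sup>2 / (1 + \<zeta> / \<rho> ^ 4)\<^sup>2 * (((1 - \<rho>) / \<rho>)\<^sup>2 + \<zeta>\<^sup>2 / \<rho> ^ 8 + 2 * (\<zeta> / \<rho> ^ 4))"
    and "\<xi>\<^sup>2 / (1 + \<zeta> / \<rho> ^ 4)\<^sup>2 * (((1 - \<rho>) / \<rho>)\<^sup>2 + \<zeta>\<^sup>2 / \<rho> ^ 8 + 2 * (\<zeta> / \<rho> ^ 4)) > 0"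
proof -
  define a where "a = 1 - \<rho>"
  define b where "b = 1 - 2 * \<rho>"
  have rn: "\<rho> < 0" unfolding rho using assms(1,2) by (simp add: mult_pos_neg)
  have ab: "a > 0" "b > 0" using rn by (auto simp: a_def b_def)
  have z': "\<zeta> = \<xi>\<^sup>2 * b * a\<^sup>2 / \<mu>" unfolding a_def b_def by (rule zeta)
  have z: "\<zeta> > 0" unfolding z' using assms(1,3) ab by simp
  define S where "S = \<zeta> + \<rho> ^ 4"
  have r4: "\<rho> ^ 4 > 0" using rn by simp
  have S: "S > 0" unfolding S_def by (rule add_pos_pos[OF z r4])
  have tx: "\<tau> = \<rho> / \<xi>" using assms(1) rho by simp
  have D0': "D\<^sub>0 = S / (\<xi> * b * a\<^sup>2)"
  proof -
    have "\<tau> * \<rho> ^ 3 = \<rho> ^ 4 / \<xi>" unfolding tx by (simp add: power_numeral_reduce)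
    then have "D\<^sub>0 = \<xi> / \<mu> + \<rho> ^ 4 / (\<xi> * b * a\<^sup>2)" unfolding D0 a_def b_def by (simp add: mult_ac)
    moreover have "\<xi> / \<mu> = \<zeta> / (\<xi> * b * a\<^sup>2)"
      unfolding z' using assms(1,3) ab by (simp add: field_simps power2_eq_square)
    ultimately show ?thesis by (simp add: S_def add_divide_distrib)
  qed
  have be: "\<beta> = \<rho> * \<xi> * b * a\<^sup>2 / S" unfolding beta D0' using S assms(1) ab by (simp add: field_simps)
  have "\<beta> * \<tau> / a\<^sup>2 = \<rho>\<^sup>2 * b / S" unfolding be tx using S assms(1) ab by (simp add: power2_eq_square)
  then have al: "\<alpha> = 1 + \<rho>\<^sup>2 * b / S" unfolding alpha a_def by simp
  have a2: "a\<^sup>2 = b + \<rho>\<^sup>2" by (simp add: a_def b_def power2_eq_square algebra_simps)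
  show "lam * (\<alpha> * \<rho> / (1 - \<rho>) - \<beta> * \<tau> * \<rho> / ((1 - 2 * \<rho>) * (1 - \<rho>))) = lam * \<rho> / (1 - \<rho>) * (\<zeta> / (\<zeta> + \<rho> ^ 4))"
  proof -
    have "\<beta> * \<tau> / b = \<rho>\<^sup>2 * a\<^sup>2 / S" unfolding be tx using S assms(1) ab by (simp add: power2_eq_square)
    then have "\<alpha> - \<beta> * \<tau> / b = 1 + \<rho>\<^sup>2 * b / S - \<rho>\<^sup>2 * a\<^sup>2 / S" unfolding al by simp
    also have "\<dots> = 1 - \<rho> ^ 4 / S" unfolding a2 by (simp add: diff_divide_distrib[symmetric] add_divide_distrib algebra_simps power_numeral_reduce power2_eq_square)
    also have "\<dots> = \<zeta> / S" using S by (simp add: S_def field_simps)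
    finally have e: "\<alpha> - \<beta> * \<tau> / b = \<zeta> / S" .
    have "lam * (\<alpha> * \<rho> / a - \<beta> * \<tau> * \<rho> / (b * a)) = lam * \<rho> / a * (\<alpha> - \<beta> * \<tau> / b)"
      using ab by (simp add: field_simps)
    then show ?thesis unfolding e S_def by (simp only: a_def b_def)
  qed
  have v1: "\<xi>\<^sup>2 / (1 + \<zeta> / \<rho> ^ 4)\<^sup>2 * (((1 - \<rho>) / \<rho>)\<^sup>2 + \<zeta>\<^sup>2 / \<rho> ^ 8 + 2 * (\<zeta> / \<rho> ^ 4)) = \<xi>\<^sup>2 * (1 + \<rho> ^ 6 * b / S\<^sup>2)"
  proof -
    \<comment> \<open>Completing the square: the bracket equals
      \<open>w\<^sup>2 + b / \<rho>\<^sup>2\<close>.\<close>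
    define w where "w = 1 + \<zeta> / \<rho> ^ 4"
    have w: "w = S / \<rho> ^ 4" using r4 by (simp add: w_def S_def field_simps)
    have w0: "w > 0" using w S r4 by simp
    have "\<zeta>\<^sup>2 / \<rho> ^ 8 = (\<zeta> / \<rho> ^ 4)\<^sup>2" by (simp add: power_divide flip: power_mult)
    then have "((1 - \<rho>) / \<rho>)\<^sup>2 + \<zeta>\<^sup>2 / \<rho> ^ 8 + 2 * (\<zeta> / \<rho> ^ 4) = w\<^sup>2 + (((1 - \<rho>) / \<rho>)\<^sup>2 - 1)"
      by (simp add: w_def power2_sum)
    also have "((1 - \<rho>) / \<rho>)\<^sup>2 - 1 = b / \<rho>\<^sup>2"
      using rn a2 by (simp add: a_def[symmetric] power_divide field_simps)
    finally have "\<xi>\<^sup>2 / w\<^sup>2 * (((1 - \<rho>) / \<rho>)\<^sup>2 + \<zeta>\<^sup>2 / \<rho> ^ 8 + 2 * (\<zeta> / \<rho> ^ 4)) = \<xi>\<^sup>2 * (1 + b / \<rho>\<^sup>2 / w\<^sup>2)"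
      using w0 by (simp add: field_simps)
    also have "b / \<rho>\<^sup>2 / w\<^sup>2 = \<rho> ^ 6 * b / S\<^sup>2"
    proof -
      have "b / \<rho>\<^sup>2 / w\<^sup>2 = b * (\<rho> ^ 4)\<^sup>2 / (\<rho>\<^sup>2 * S\<^sup>2)" unfolding w by (simp add: power_divide)
      also have "(\<rho> ^ 4)\<^sup>2 = \<rho> ^ 6 * \<rho>\<^sup>2" by (simp flip: power_add power_mult)
      also have "b * (\<rho> ^ 6 * \<rho>\<^sup>2) / (\<rho>\<^sup>2 * S\<^sup>2) = \<rho> ^ 6 * b / S\<^sup>2"
      proof -
        have aux: "x * (y * z) / (z * u) = y * x / u" if "z \<noteq> 0" for x y z u :: real using that by simp
        show ?thesis by (rule aux) (use rn in simp)
      qed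
      finally show ?thesis .
    qed
    finally show ?thesis by (simp add: w_def)
  qed
  show "\<xi>\<^sup>2 / (1 + \<zeta> / \<rho> ^ 4)\<^sup>2 * (((1 - \<rho>) / \<rho>)\<^sup>2 + \<zeta>\<^sup>2 / \<rho> ^ 8 + 2 * (\<zeta> / \<rho> ^ 4)) > 0"
    unfolding v1 using assms(1) S ab rn by (intro mult_pos_pos add_pos_nonneg) auto
  have "\<alpha>\<^sup>2 * \<xi>\<^sup>2 - 2 * \<alpha> * \<beta> * \<xi> * \<rho> / a\<^sup>2 + \<beta>\<^sup>2 * \<rho>\<^sup>2 / (b * a\<^sup>2) = \<xi>\<^sup>2 * (1 + \<rho> ^ 6 * b / S\<^sup>2)"
  proof -
    \<comment> \<open>This is \<open>\<alpha> - 1\<close>, so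
      \<open>\<alpha>\<^sup>2 - 2 * \<alpha> * c = 1 - c\<^sup>2\<close> and only the difference in
      fact 3 has to be evaluated.\<close>
    define c where "c = \<rho>\<^sup>2 * b / S"
    have 1: "2 * \<alpha> * \<beta> * \<xi> * \<rho> / a\<^sup>2 = 2 * \<alpha> * \<xi>\<^sup>2 * c" unfolding be c_def using ab by (simp add: power2_eq_square)
    have 2: "\<beta>\<^sup>2 * \<rho>\<^sup>2 / (b * a\<^sup>2) = \<xi>\<^sup>2 * (c\<^sup>2 * a\<^sup>2 / b)"
      unfolding be c_def using ab S by (simp add: power_divide power_mult_distrib) (simp add: field_simps power2_eq_square power4_eq_xxxx)
    have 3: "c\<^sup>2 * a\<^sup>2 / b - c\<^sup>2 = \<rho> ^ 6 * b / S\<^sup>2"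
    proof -
      have "c\<^sup>2 * a\<^sup>2 / b - c\<^sup>2 = c\<^sup>2 * (a\<^sup>2 - b) / b" using ab by (simp add: field_simps)
      also have "a\<^sup>2 - b = \<rho>\<^sup>2" using a2 by simp
      also have "c\<^sup>2 * \<rho>\<^sup>2 / b = \<rho> ^ 6 * b / S\<^sup>2"
        unfolding c_def using ab by (simp add: power_divide power_mult_distrib power2_eq_square power_numeral_reduce)
      finally show ?thesis .
    qed
    have "\<alpha> = 1 + c" using al by (simp add: c_def)
    then have "\<alpha>\<^sup>2 * \<xi>\<^sup>2 - 2 * \<alpha> * \<xi>\<^sup>2 * c + \<xi>\<^sup>2 * (c\<^sup>2 * a\<^sup>2 / b) = \<xi>\<^sup>2 * (1 + (c\<^sup>2 * a\<^sup>2 / b - c\<^sup>2))"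
      by (simp add: power2_sum algebra_simps) (simp add: power2_eq_square algebra_simps)
    then show ?thesis unfolding 1 2 3 .
  qed
  then show "\<alpha>\<^sup>2 * \<xi>\<^sup>2 - 2 * \<alpha> * \<beta> * \<xi> * \<rho> / (1 - \<rho>)\<^sup>2 + \<beta>\<^sup>2 * \<rho>\<^sup>2 / ((1 - 2 * \<rho>) * (1 - \<rho>)\<^sup>2)
      = \<xi>\<^sup>2 / (1 + \<zeta> / \<rho> ^ 4)\<^sup>2 * (((1 - \<rho>) / \<rho>)\<^sup>2 + \<zeta>\<^sup>2 / \<rho> ^ 8 + 2 * (\<zeta> / \<rho> ^ 4))"
    unfolding v1 by (simp only: a_def b_def)
qed

theorem mainTheorem3:
  fixes M :: "'a measure"
    and X :: "nat \<Rightarrow> 'a \<Rightarrow> real"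
    and F :: "real \<Rightarrow> real"
    and \<xi> \<tau> \<rho> C \<mu> lam \<zeta> m v :: real
    and k :: "nat \<Rightarrow> nat"
    and s2 :: "nat \<Rightarrow> nat \<Rightarrow> real"
    and rho_hat tau_hat xi_hat delta_hat p_hat :: "nat \<Rightarrow> 'a \<Rightarrow> real"
    and sample :: "nat \<Rightarrow> 'a \<Rightarrow> real list"
    and x p :: "nat \<Rightarrow> real"
  assumes "prob_space M"
    and "\<xi> > 0" and "\<tau> < 0" and "\<rho> = \<xi> * \<tau>"
    \<comment> \<open>\<open>X 0\<close> plays the role of \<open>X\<close>; the observations are \<open>X 1, X 2, \<dots>\<close>\<close>
    and "prob_space.indep_vars M (\<lambda>_. borel) X UNIV"
    and "\<And>i. cdf (distr M borel (X i)) = F"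
    and "EP_class \<xi> \<tau> C F"
    and "filterlim k at_top sequentially"
    and "(\<lambda>n. real (k n) / real n) \<longlonglongrightarrow> 0"
    and "\<And>n. s2 (k n) n > 0"
    and "(\<lambda>n. real (k n) * s2 (k n) n) \<longlonglongrightarrow> \<mu>" and "\<mu> > 0"
    and "(\<lambda>n. sqrt (real (k n)) * quantile_dev \<xi> C F (real n / real (k n))) \<longlonglongrightarrow> lam"
    and "\<And>n \<omega>. sample n \<omega> = map (\<lambda>i. X i \<omega>) [1..<Suc n]"
    and "\<And>n. rho_hat n \<in> borel_measurable M" and "conv_in_prob M rho_hat \<rho>"
    and "\<And>n \<omega>. tau_hat n \<omega> = rho_hat n \<omega> / hill (sample n \<omega>) (k n)"
    and "\<And>n. xi_hat n \<in> borel_measurable M" and "\<And>n. delta_hat n \<in> borel_measurable M"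
    \<comment> \<open>whenever the system is solvable, otherwise the estimators are arbitrary\<close>
    and "\<And>n \<omega>. \<omega> \<in> space M \<Longrightarrow>
           \<exists>\<xi>' \<delta>'. bayes_system (sample n \<omega>) (k n) (s2 (k n) n) (tau_hat n \<omega>) \<xi>' \<delta>' \<Longrightarrow>
           bayes_estimate (sample n \<omega>) (k n) (s2 (k n) n) (tau_hat n \<omega>) (xi_hat n \<omega>) (delta_hat n \<omega>)"
    and "\<And>n. p n = measure M {\<omega> \<in> space M. X 0 \<omega> > x n}"
    and "(\<lambda>n. real n * p n / real (k n)) \<longlonglongrightarrow> 0"
    and "(\<lambda>n. ln (real n * p n) / sqrt (real (k n))) \<longlonglongrightarrow> 0"
    and "\<And>n \<omega>. p_hat n \<omega> =
           tail_prob_estimate (sample n \<omega>) (k n) (xi_hat n \<omega>) (delta_hat n \<omega>) (tau_hat n \<omega>) (x n)"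
    and "\<zeta> = \<xi>\<^sup>2 * (1 - 2 * \<rho>) * (1 - \<rho>)\<^sup>2 / \<mu>"
    and "m = lam * \<rho> / (1 - \<rho>) * (\<zeta> / (\<zeta> + \<rho> ^ 4))"
    and "v = \<xi>\<^sup>2 / (1 + \<zeta> / \<rho> ^ 4)\<^sup>2 * (((1 - \<rho>) / \<rho>)\<^sup>2 + \<zeta>\<^sup>2 / \<rho> ^ 8 + 2 * (\<zeta> / \<rho> ^ 4))"
  shows "conv_in_distr M
           (\<lambda>n \<omega>. sqrt (real (k n)) / ln (real (k n) / (real n * p n)) * \<xi> * (p_hat n \<omega> / p n - 1))
           (normal_law m v) \<and>
         conv_in_distr M (\<lambda>n \<omega>. sqrt (real (k n)) * (xi_hat n \<omega> - \<xi>)) (normal_law m v) \<and>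
         has_asymptotic_mse M
           (\<lambda>n \<omega>. sqrt (real (k n)) / ln (real (k n) / (real n * p n)) * \<xi> * (p_hat n \<omega> / p n - 1))
           (m\<^sup>2 + v) \<and>
         has_asymptotic_mse M (\<lambda>n \<omega>. sqrt (real (k n)) * (xi_hat n \<omega> - \<xi>)) (m\<^sup>2 + v)"
proof -
  interpret prob_space M by (rule assms(1))
  obtain \<delta> l where EP: "C > 0" "\<And>x. x > 0 \<Longrightarrow> 1 - F x = C * x powr (- 1 / \<xi>) * (1 + \<delta> x / \<xi>)"
    "(\<forall>\<^sub>F x in at_top. \<delta> x > 0) \<or> (\<forall>\<^sub>F x in at_top. \<delta> x < 0)" "slowly_varying l"
    "\<forall>\<^sub>F x in at_top. \<bar>\<delta> x\<bar> = x powr \<tau> * l x"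
    using assms(7) unfolding EP_class_def by blast
  interpret E: ep_tail \<xi> \<tau> C F \<delta> l by (rule ep_tail.intro[OF assms(2,3) EP])
  have rv_X: "X i \<in> borel_measurable M" for i using assms(5) by (simp add: indep_vars_def2)
  have N: "real_distribution (distr M borel (X 0))" by (rule real_distribution_distr[OF rv_X])
  note del = E.delta_threshold[OF N assms(6)[of 0, symmetric] assms(8,9,13)]
  obtain K where "tail_array M X F \<xi> \<tau> lam K k (E.threshold k) (\<lambda>n y. \<delta> (E.threshold k n * exp y) / \<xi>)"
    using E.tail_array_threshold[OF assms(1,5,6,8,9) del] by blast
  then interpret A: tail_array M X F \<xi> \<tau> lam K k "E.threshold k" "\<lambda>n y. \<delta> (E.threshold k n * exp y) / \<xi>" .
  have sample: "sample n \<omega> = A.xs n \<omega>" for n \<omega> unfolding A.xs_def by (rule assms(14))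
  let ?th = "\<lambda>p. tau_hat (fst p) (snd p)" and ?xh = "\<lambda>p. xi_hat (fst p) (snd p)" and ?dh = "\<lambda>p. delta_hat (fst p) (snd p)"
  define D\<^sub>0 where "D\<^sub>0 = \<xi> / \<mu> + \<tau> * \<rho> ^ 3 / ((1 - 2 * \<rho>) * (1 - \<rho>)\<^sup>2)"
  define \<beta> where "\<beta> = \<rho> / D\<^sub>0"
  define \<alpha> where "\<alpha> = 1 + \<beta> * \<tau> / (1 - \<rho>)\<^sup>2"
  have rh: "((\<lambda>p. rho_hat (fst p) (snd p)) \<longlongrightarrow> \<rho>) (prob_filter M)"
    using tendsto_prob_filter_iff[where Z=rho_hat and c=\<rho>, OF assms(15)] assms(16) by simp
  have th: "tau_hat (fst q) (snd q) = rho_hat (fst q) (snd q) / hill (A.xs (fst q) (snd q)) (k (fst q))" for q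
    by (simp add: assms(17) sample)
  have est: "\<forall>\<^sub>F q in prob_filter M.
      (\<exists>\<xi>' \<delta>'. bayes_system (A.xs (fst q) (snd q)) (k (fst q)) (s2 (k (fst q)) (fst q)) (?th q) \<xi>' \<delta>') \<longrightarrow>
      bayes_estimate (A.xs (fst q) (snd q)) (k (fst q)) (s2 (k (fst q)) (fst q)) (?th q) (?xh q) (?dh q)"
    using eventually_in_space by (rule eventually_mono) (rule impI, rule assms(20)[unfolded sample])
  note bayes = A.bayes_expansion[OF assms(11,12) rh[unfolded assms(4)] th est, folded assms(4),
      folded D\<^sub>0_def, folded \<beta>_def, folded \<alpha>_def]
  have p: "p n = 1 - F (x n)" for n unfolding assms(21) by (rule A.prob_greater)
  let ?L = "\<lambda>n. ln (real (k n) / (real n * p n))"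
  note tp = E.tail_prob_asymptotics[OF A.F_mono assms(8,9) del p assms(22)]
  \<comment> \<open>The hypothesis concerns \<open>ln (n * p)\<close>; the missing
    \<open>ln k\<close> is twice \<open>ln (sqrt k)\<close>, which is negligible against
    \<open>sqrt k\<close>.\<close>
  have Lk: "(\<lambda>n. ?L n / sqrt (real (k n))) \<longlonglongrightarrow> 0"
  proof -
    have "(\<lambda>n. ln (sqrt (real (k n))) / sqrt (real (k n))) \<longlonglongrightarrow> 0"
      by (rule filterlim_compose[OF ln_x_over_x_tendsto_0 A.sqrt_k_top])
    from tendsto_diff[OF tendsto_mult[OF tendsto_const[of 2] this] assms(23)]
    have "(\<lambda>n. 2 * (ln (sqrt (real (k n))) / sqrt (real (k n))) - ln (real n * p n) / sqrt (real (k n))) \<longlonglongrightarrow> 0" by simp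
    moreover have "\<forall>\<^sub>F n in sequentially. 2 * (ln (sqrt (real (k n))) / sqrt (real (k n))) - ln (real n * p n) / sqrt (real (k n))
        = ?L n / sqrt (real (k n))"
      using A.k_pos eventually_gt_at_top[of 0]
    proof eventually_elim
      case (elim n)
      have "?L n = 2 * ln (sqrt (real (k n))) - ln (real n * p n)"
        using elim tp(1)[of n] by (simp add: ln_div ln_sqrt)
      then show ?case by (simp only: diff_divide_distrib times_divide_eq_right)
    qed
    ultimately show ?thesis by (rule Lim_transform_eventually)
  qed
  have "((\<lambda>q. sqrt (real (k (fst q))) / ?L (fst q) * \<xi> *
       (tail_prob_estimate (A.xs (fst q) (snd q)) (k (fst q)) (?xh q) (?dh q) (?th q) (x (fst q)) / p (fst q) - 1)
      - sqrt (real (k (fst q))) * (?xh q - \<xi>)) \<longlongrightarrow> 0) (prob_filter M)"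
    by (rule A.tail_prob_expansion[OF bayes(3,4,5) always_eventually tp(2,3) Lk tp(4)]) (simp add: tp(1))
  \<comment> \<open>Both normalised errors are now approximated by the same
    \<open>score_sum\<close>, which is why their limit laws coincide.\<close>
  from tendsto_add[OF this bayes(2)]
  have close: "((\<lambda>q. sqrt (real (k (fst q))) / ?L (fst q) * \<xi> * (p_hat (fst q) (snd q) / p (fst q) - 1)
      - A.score_sum \<alpha> \<beta> (fst q) (snd q)) \<longlongrightarrow> 0) (prob_filter M)"
    by (simp add: assms(24) sample)
  note mv = limit_mean_variance[OF assms(2,3,12,4,25) D\<^sub>0_def \<beta>_def \<alpha>_def]
  have v: "v > 0" unfolding assms(27) by (rule mv(3))
  have "(\<lambda>n. char (distr M borel (A.score_sum \<alpha> \<beta> n)) s) \<longlonglongrightarrow> exp (\<i> * s * m - s\<^sup>2 * v / 2)" for s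
    using A.score_sum_char[of \<alpha> \<beta> s, folded assms(4)] unfolding mv(1,2) assms(26,27) .
  then have char: "(\<lambda>n. char (distr M borel (A.score_sum \<alpha> \<beta> n)) s) \<longlonglongrightarrow>
      exp (\<i> * complex_of_real s * complex_of_real m - (complex_of_real s)\<^sup>2 * complex_of_real v / 2)" for s
    by simp
  have conv_xi: "conv_in_distr M (\<lambda>n \<omega>. sqrt (real (k n)) * (xi_hat n \<omega> - \<xi>)) (normal_law m v)"
  proof (rule conv_in_distr_normal_of_char[OF A.score_sum_meas v _ char bayes(2)])
    have "(\<lambda>\<omega>. sqrt (real (k n)) * (xi_hat n \<omega> - \<xi>)) \<in> borel_measurable M" for n
      using assms(18)[of n] by measurable
    then show "\<forall>\<^sub>F n in sequentially. (\<lambda>\<omega>. sqrt (real (k n)) * (xi_hat n \<omega> - \<xi>)) \<in> borel_measurable M" by simp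
  qed
  have conv_p: "conv_in_distr M (\<lambda>n \<omega>. sqrt (real (k n)) / ?L n * \<xi> * (p_hat n \<omega> / p n - 1)) (normal_law m v)"
  proof (rule conv_in_distr_normal_of_char[OF A.score_sum_meas v _ char close])
    \<comment> \<open>Rank \<open>n - k n\<close> is a genuine rank only for \<open>k n < n\<close>,
      so measurability of the estimate is established for large \<open>n\<close>.\<close>
    show "\<forall>\<^sub>F n in sequentially. (\<lambda>\<omega>. sqrt (real (k n)) / ?L n * \<xi> * (p_hat n \<omega> / p n - 1)) \<in> borel_measurable M"
      using A.k_less
    proof eventually_elim
      case (elim n)
      have "tau_hat n \<in> borel_measurable M"
        unfolding assms(17)[abs_def] assms(14) using hill_measurable[OF rv_X elim] assms(15)[of n] by measurable
      then have "p_hat n \<in> borel_measurable M"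
        unfolding assms(24)[abs_def] assms(14)
        by (rule tail_prob_estimate_measurable[OF rv_X elim assms(18,19)])
      then show ?case by measurable
    qed
  qed
  show ?thesis
    using conv_xi conv_p has_asymptotic_mse_normal[OF conv_xi v] has_asymptotic_mse_normal[OF conv_p v] by blast
qed

thm_deps mainTheorem3

end
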